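(* Let $\mathfrak{g}$ be a (possibly infinite-dimensional) Lie algebra over $\mathbb{C}$ equipped with a non-degenerate symmetric invariant bilinear form $\langle\cdot,\cdot\rangle$, let $p(x)\in\mathbb{C}[x]$, and let $\ell$ be any complex number. There exists a vertex $\mathbb{C}((z))$-algebra structure on the $\check{\mathfrak{g}}_p$-module $V_{\check{\mathfrak{g}}_p}(\ell,0)$ (described in the context), which is uniquely determined by the conditions that $\mathbf{1}$ is the vacuum vector and that $$Y(u,x)=u(x)\qquad\text{for } u\in\mathfrak{g}+\mathfrak{g}^1.$$
   Context: Notation: $x^{-1}\delta(y/x)=\sum_{n\in\mathbb{Z}}y^{n}x^{-n-1}$. $\mathfrak{g}^1$ is a vector space with a fixed linear isomorphism $\mathfrak{g}\to\mathfrak{g}^1$, $a\mapsto a^1$. For $u\in\mathfrak{g}\oplus\mathfrak{g}^1$, $u(n)$ denotes $u\otimes t^n$ (or the corresponding operator on a module), and $u(x)=\sum_{n\in\mathbb{Z}}u(n)x^{-n-1}$. $\check{\mathfrak{g}}_p=\mathbb{C}((z))\otimes(\mathfrak{g}\oplus\mathfrak{g}^1)\otimes\mathbb{C}[t,t^{-1}]\oplus\mathbb{C}((z))\mathbf{k}$ is the Lie algebra over the field $\mathbb{C}((z))$ with $\mathbb{C}((z))$-bilinear bracket such that $\mathbf{k}$ is central and, for $a,b\in\mathfrak{g}$, $$[a(x_1),b(x_2)]=[a,b](x_2)x_2^{-1}\delta\left(\tfrac{x_1}{x_2}\right)+\langle a,b\rangle\mathbf{k}\tfrac{\partial}{\partial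 x_2}x_2^{-1}\delta\left(\tfrac{x_1}{x_2}\right),$$ $$[a(x_1),b^1(x_2)]=[a,b]^1(x_2)x_2^{-1}\delta\left(\tfrac{x_1}{x_2}\right)=[a^1(x_1),b(x_2)],$$ $$[a^1(x_1),b^1(x_2)]=p(z+x_2)[a,b](x_2)x_2^{-1}\delta\left(\tfrac{x_1}{x_2}\right)+\tfrac12\langle a,b\rangle p'(z+x_2)\mathbf{k}x_2^{-1}\delta\left(\tfrac{x_1}{x_2}\right)+\langle a,b\rangle p(z+x_2)\mathbf{k}\tfrac{\partial}{\partial x_2}x_2^{-1}\delta\left(\tfrac{x_1}{x_2}\right).$$ Let $\check{B}=\mathbb{C}((z))\otimes(\mathfrak{g}\oplus\mathfrak{g}^1)\otimes\mathbb{C}[t]\oplus\mathbb{C}((z))\mathbf{k}$, a subalgebra of $\check{\mathfrak{g}}_p$, and let $\mathbb{C}((z))_\ell$ be the $\check{B}$-module $\mathbb{C}((z))$ with $\mathbf{k}$ acting as the scalar $\ell$ and $\mathbb{C}((z))\otimes(\mathfrak{g}\oplus\mathfrak{g}^1)\otimes\mathbb{C}[t]$ acting as zero. Put $V_{\check{\mathfrak{g}}_p}(\ell,0)=U(\check{\mathfrak{g}}_p)\otimes_{U(\check{B})}\mathbb{C}((z))_\ell$ (universal enveloping algebras over $\mathbb{C}((z))$) and $\mathbf{1}=1\otimes1$. By the P-B-W theorem, $\mathbb{C}((z))\otimes(\mathfrak{g}\oplus\mathfrak{g}^1)$ is identified with a subspace of $V_{\check{\mathfrak{g}}_p}(\ell,0)$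 via $f(z)u\mapsto f(z)u(-1)\mathbf{1}$. A vertex $\mathbb{C}((z))$-algebra is a vertex algebra $V$ over $\mathbb{C}$ equipped with a $\mathbb{C}((z))$-module structure such that $Y(f(z)u,x)g(z)v=f(z+x)g(z)Y(u,x)v$ for $f,g\in\mathbb{C}((z))$, $u,v\in V$, where $f(z+x)=e^{x\frac{d}{dz}}f(z)\in\mathbb{C}((z))[[x]]$. In the claim the $\mathbb{C}((z))$-module structure on $V_{\check{\mathfrak{g}}_p}(\ell,0)$ is the given one. *)

theory Defs
  imports
    "HOL-Algebra.Free_Abelian_Groups"
    "HOL-Algebra.Generated_Groups"
    "HOL-Algebra.Module"
    "HOL-Algebra.QuotRing"
    "HOL-Computational_Algebra.Formal_Laurent_Series"
    "HOL-Computational_Algebra.Polynomial_FPS"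
begin

section \<open>Scalars\<close>

definition type_ring :: "'a::comm_ring_1 ring" where
  "type_ring = \<lparr>carrier = UNIV, monoid.mult = (*), one = 1, zero = 0, add = (+)\<rparr>"

definition type_module :: "('a::comm_ring_1, 'a) module" where
  "type_module = ring.extend type_ring (module.fields (*))"

text \<open>The field \<open>\<complex>((z))\<close> is \<^typ>\<open>complex fls\<close>.\<close>

abbreviation CC :: "complex ring" where "CC \<equiv> type_ring"
abbreviation KK :: "complex fls ring" where "KK \<equiv> type_ring"

text \<open>The coefficient of \<open>x ^ j\<close> in \<open>f(z + x) = exp (x d/dz) f(z)\<close>.\<close>

definition shift_coeff :: "complex fls \<Rightarrow> int \<Rightarrow> complex fls" where
  "shift_coeff f j =
     (if j < 0 then 0 else fls_const (1 / fact (nat j)) * (fls_deriv ^^ nat j) f)"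

definition fls_of_poly :: "complex poly \<Rightarrow> complex fls" where
  "fls_of_poly p = fps_to_fls (fps_of_poly p)"


section \<open>Lie algebras with an invariant form\<close>

record ('a, 'b) lie_alg = "('a, 'b) module" +
  lie_bracket :: "'b \<Rightarrow> 'b \<Rightarrow> 'b"

locale lie_algebra = Ring.field R + Module.module R L
  for R :: "('a, 'm) ring_scheme" (structure) and L :: "('a, 'b, 'n) lie_alg_scheme" +
  assumes bracket_closed:
      "\<lbrakk>x \<in> carrier L; y \<in> carrier L\<rbrakk> \<Longrightarrow> lie_bracket L x y \<in> carrier L"
    and bracket_add_left:
      "\<lbrakk>x \<in> carrier L; y \<in> carrier L; w \<in> carrier L\<rbrakk> \<Longrightarrow>
        lie_bracket L (x \<oplus>\<^bsub>L\<^esub> y) w = lie_bracket L x w \<oplus>\<^bsub>L\<^esub> lie_bracket L y w"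
    and bracket_add_right:
      "\<lbrakk>x \<in> carrier L; y \<in> carrier L; w \<in> carrier L\<rbrakk> \<Longrightarrow>
        lie_bracket L w (x \<oplus>\<^bsub>L\<^esub> y) = lie_bracket L w x \<oplus>\<^bsub>L\<^esub> lie_bracket L w y"
    and bracket_smult_left:
      "\<lbrakk>c \<in> carrier R; x \<in> carrier L; y \<in> carrier L\<rbrakk> \<Longrightarrow>
        lie_bracket L (c \<odot>\<^bsub>L\<^esub> x) y = c \<odot>\<^bsub>L\<^esub> lie_bracket L x y"
    and bracket_smult_right:
      "\<lbrakk>c \<in> carrier R; x \<in> carrier L; y \<in> carrier L\<rbrakk> \<Longrightarrow>
        lie_bracket L x (c \<odot>\<^bsub>L\<^esub> y) = c \<odot>\<^bsub>L\<^esub> lie_bracket L x y"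
    and bracket_self: "x \<in> carrier L \<Longrightarrow> lie_bracket L x x = \<zero>\<^bsub>L\<^esub>"
    and jacobi:
      "\<lbrakk>x \<in> carrier L; y \<in> carrier L; w \<in> carrier L\<rbrakk> \<Longrightarrow>
        lie_bracket L x (lie_bracket L y w) \<oplus>\<^bsub>L\<^esub> lie_bracket L y (lie_bracket L w x)
          \<oplus>\<^bsub>L\<^esub> lie_bracket L w (lie_bracket L x y) = \<zero>\<^bsub>L\<^esub>"

locale lie_algebra_with_form = lie_algebra +
  fixes B :: "'b \<Rightarrow> 'b \<Rightarrow> 'a"
  assumes form_closed: "\<lbrakk>x \<in> carrier L; y \<in> carrier L\<rbrakk> \<Longrightarrow> B x y \<in> carrier R"
    and form_add:
      "\<lbrakk>x \<in> carrier L; y \<in> carrier L; w \<in> carrier L\<rbrakk> \<Longrightarrow> B (x \<oplus>\<^bsub>L\<^esub> y) w = B x w \<oplus> B y w"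
    and form_smult:
      "\<lbrakk>c \<in> carrier R; x \<in> carrier L; y \<in> carrier L\<rbrakk> \<Longrightarrow> B (c \<odot>\<^bsub>L\<^esub> x) y = c \<otimes> B x y"
    and form_sym: "\<lbrakk>x \<in> carrier L; y \<in> carrier L\<rbrakk> \<Longrightarrow> B x y = B y x"
    and form_invariant:
      "\<lbrakk>x \<in> carrier L; y \<in> carrier L; w \<in> carrier L\<rbrakk> \<Longrightarrow>
        B (lie_bracket L x y) w = B x (lie_bracket L y w)"
    and form_nondegenerate:
      "\<lbrakk>x \<in> carrier L; \<And>y. y \<in> carrier L \<Longrightarrow> B x y = \<zero>\<rbrakk> \<Longrightarrow> x = \<zero>\<^bsub>L\<^esub>"


section \<open>Tensor products over a possibly noncommutative ring\<close>

text \<open>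
  \<open>M \<otimes>\<^sub>S N\<close> for a right \<open>S\<close>-module \<open>M\<close> and a left \<open>S\<close>-module \<open>N\<close>: the free abelian group on
  pairs modulo the biadditivity and balance relations.  Only the additive structure of the records
  \<open>M\<close> and \<open>N\<close> is used; the actions of \<open>S\<close> are the arguments \<open>ra\<close> and \<open>la\<close>.
\<close>

definition tensor_free ::
  "('m, 'y) ring_scheme \<Rightarrow> ('n, 'z) ring_scheme \<Rightarrow> ('m \<times> 'n \<Rightarrow>\<^sub>0 int) monoid" where
  "tensor_free M N = free_Abelian_group (carrier M \<times> carrier N)"

definition tensor_relations ::
  "('s, 'x) ring_scheme \<Rightarrow> ('m, 'y) ring_scheme \<Rightarrow> ('n, 'z) ring_scheme \<Rightarrow>
   ('m \<Rightarrow> 's \<Rightarrow> 'm) \<Rightarrow> ('s \<Rightarrow> 'n \<Rightarrow> 'n) \<Rightarrow> ('m \<times> 'n \<Rightarrow>\<^sub>0 int) set" where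
  "tensor_relations S M N ra la =
     {frag_of (m \<oplus>\<^bsub>M\<^esub> m', n) - frag_of (m, n) - frag_of (m', n) | m m' n.
        m \<in> carrier M \<and> m' \<in> carrier M \<and> n \<in> carrier N} \<union>
     {frag_of (m, n \<oplus>\<^bsub>N\<^esub> n') - frag_of (m, n) - frag_of (m, n') | m n n'.
        m \<in> carrier M \<and> n \<in> carrier N \<and> n' \<in> carrier N} \<union>
     {frag_of (ra m s, n) - frag_of (m, la s n) | m s n.
        m \<in> carrier M \<and> s \<in> carrier S \<and> n \<in> carrier N}"

definition tensor_kernel ::
  "('s, 'x) ring_scheme \<Rightarrow> ('m, 'y) ring_scheme \<Rightarrow> ('n, 'z) ring_scheme \<Rightarrow>
   ('m \<Rightarrow> 's \<Rightarrow> 'm) \<Rightarrow> ('s \<Rightarrow> 'n \<Rightarrow> 'n) \<Rightarrow> ('m \<times> 'n \<Rightarrow>\<^sub>0 int) set" where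
  "tensor_kernel S M N ra la = generate (tensor_free M N) (tensor_relations S M N ra la)"

definition pure_tensor ::
  "('s, 'x) ring_scheme \<Rightarrow> ('m, 'y) ring_scheme \<Rightarrow> ('n, 'z) ring_scheme \<Rightarrow>
   ('m \<Rightarrow> 's \<Rightarrow> 'm) \<Rightarrow> ('s \<Rightarrow> 'n \<Rightarrow> 'n) \<Rightarrow> 'm \<Rightarrow> 'n \<Rightarrow> ('m \<times> 'n \<Rightarrow>\<^sub>0 int) set" where
  "pure_tensor S M N ra la m n =
     tensor_kernel S M N ra la #>\<^bsub>tensor_free M N\<^esub> frag_of (m, n)"

text \<open>Tensor products are modules, so their ring multiplication and unit are left unspecified.\<close>

definition tensor_group ::
  "('s, 'x) ring_scheme \<Rightarrow> ('m, 'y) ring_scheme \<Rightarrow> ('n, 'z) ring_scheme \<Rightarrow>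
   ('m \<Rightarrow> 's \<Rightarrow> 'm) \<Rightarrow> ('s \<Rightarrow> 'n \<Rightarrow> 'n) \<Rightarrow> ('m \<times> 'n \<Rightarrow>\<^sub>0 int) set ring" where
  "tensor_group S M N ra la =
     (let Q = tensor_free M N Mod tensor_kernel S M N ra la
      in \<lparr>carrier = carrier Q, monoid.mult = undefined, one = undefined,
          zero = \<one>\<^bsub>Q\<^esub>, add = monoid.mult Q\<rparr>)"

text \<open>
  The additive map into \<open>A\<close> sending \<open>m \<otimes> n\<close> to \<open>\<phi> (m, n)\<close>, evaluated on a representative of the
  coset \<open>X\<close>; independent of the choice whenever \<open>\<phi>\<close> is biadditive and balanced.
\<close>

definition tensor_lift ::
  "('c, 'w) ring_scheme \<Rightarrow> ('m \<times> 'n \<Rightarrow> 'c) \<Rightarrow> ('m \<times> 'n \<Rightarrow>\<^sub>0 int) set \<Rightarrow> 'c" where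
  "tensor_lift A \<phi> X =
     (let x = SOME x. x \<in> X
      in \<Oplus>\<^bsub>A\<^esub> i \<in> Poly_Mapping.keys x. [Poly_Mapping.lookup x i] \<cdot>\<^bsub>A\<^esub> \<phi> i)"

text \<open>The tensor product with a left action \<open>lm\<close> inherited from the left factor.\<close>

definition tensor_module ::
  "('s, 'x) ring_scheme \<Rightarrow> ('m, 'y) ring_scheme \<Rightarrow> ('n, 'z) ring_scheme \<Rightarrow>
   ('m \<Rightarrow> 's \<Rightarrow> 'm) \<Rightarrow> ('s \<Rightarrow> 'n \<Rightarrow> 'n) \<Rightarrow> ('r \<Rightarrow> 'm \<Rightarrow> 'm) \<Rightarrow>
   ('r, ('m \<times> 'n \<Rightarrow>\<^sub>0 int) set) module" where
  "tensor_module S M N ra la lm =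
     (let T = tensor_group S M N ra la
      in ring.extend T (module.fields
           (\<lambda>r. tensor_lift T (\<lambda>(m, n). pure_tensor S M N ra la (lm r m) n))))"


section \<open>Universal enveloping algebras\<close>

text \<open>
  The free associative unital \<open>R\<close>-algebra on a set \<open>A\<close>: finitely supported \<open>R\<close>-valued functions
  on words over \<open>A\<close>, with concatenation product.
\<close>

definition free_algebra :: "('a, 'm) ring_scheme \<Rightarrow> 'b set \<Rightarrow> ('b list \<Rightarrow> 'a) ring" where
  "free_algebra R A =
     \<lparr>carrier = {f. (\<forall>w. f w \<in> carrier R) \<and> finite {w. f w \<noteq> \<zero>\<^bsub>R\<^esub>} \<and>
                    (\<forall>w. f w \<noteq> \<zero>\<^bsub>R\<^esub> \<longrightarrow> set w \<subseteq> A)},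
      monoid.mult = (\<lambda>f g w. \<Oplus>\<^bsub>R\<^esub> i \<in> {..length w}. f (take i w) \<otimes>\<^bsub>R\<^esub> g (drop i w)),
      one = (\<lambda>w. if w = [] then \<one>\<^bsub>R\<^esub> else \<zero>\<^bsub>R\<^esub>),
      zero = (\<lambda>w. \<zero>\<^bsub>R\<^esub>),
      add = (\<lambda>f g w. f w \<oplus>\<^bsub>R\<^esub> g w)\<rparr>"

definition word_monom :: "('a, 'm) ring_scheme \<Rightarrow> 'a \<Rightarrow> 'b list \<Rightarrow> 'b list \<Rightarrow> 'a" where
  "word_monom R c v = (\<lambda>w. if w = v then c else \<zero>\<^bsub>R\<^esub>)"

text \<open>
  The first two families cut the free algebra on the set \<open>carrier L\<close> down to the tensor algebra of
  the module \<open>L\<close>; the third is \<open>x y - y x = [x, y]\<close>.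
\<close>

definition env_relations ::
  "('a, 'm) ring_scheme \<Rightarrow> ('a, 'b, 'n) lie_alg_scheme \<Rightarrow> ('b list \<Rightarrow> 'a) set" where
  "env_relations R L =
     (let F = free_algebra R (carrier L); e = (\<lambda>x. word_monom R \<one>\<^bsub>R\<^esub> [x])
      in {e (x \<oplus>\<^bsub>L\<^esub> y) \<ominus>\<^bsub>F\<^esub> (e x \<oplus>\<^bsub>F\<^esub> e y) | x y. x \<in> carrier L \<and> y \<in> carrier L} \<union>
         {e (c \<odot>\<^bsub>L\<^esub> x) \<ominus>\<^bsub>F\<^esub> word_monom R c [x] | c x. c \<in> carrier R \<and> x \<in> carrier L} \<union>
         {(e x \<otimes>\<^bsub>F\<^esub> e y \<ominus>\<^bsub>F\<^esub> e y \<otimes>\<^bsub>F\<^esub> e x) \<ominus>\<^bsub>F\<^esub> e (lie_bracket L x y) | x y.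
            x \<in> carrier L \<and> y \<in> carrier L})"

definition env_ideal ::
  "('a, 'm) ring_scheme \<Rightarrow> ('a, 'b, 'n) lie_alg_scheme \<Rightarrow> ('b list \<Rightarrow> 'a) set" where
  "env_ideal R L = Idl\<^bsub>free_algebra R (carrier L)\<^esub> (env_relations R L)"

definition env ::
  "('a, 'm) ring_scheme \<Rightarrow> ('a, 'b, 'n) lie_alg_scheme \<Rightarrow> ('b list \<Rightarrow> 'a) set ring" where
  "env R L = free_algebra R (carrier L) Quot env_ideal R L"

definition env_of ::
  "('a, 'm) ring_scheme \<Rightarrow> ('a, 'b, 'n) lie_alg_scheme \<Rightarrow> 'b \<Rightarrow> ('b list \<Rightarrow> 'a) set" where
  "env_of R L x = env_ideal R L +>\<^bsub>free_algebra R (carrier L)\<^esub> word_monom R \<one>\<^bsub>R\<^esub> [x]"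

definition env_scalar ::
  "('a, 'm) ring_scheme \<Rightarrow> ('a, 'b, 'n) lie_alg_scheme \<Rightarrow> 'a \<Rightarrow> ('b list \<Rightarrow> 'a) set" where
  "env_scalar R L c = env_ideal R L +>\<^bsub>free_algebra R (carrier L)\<^esub> word_monom R c []"

text \<open>
  For a subalgebra \<open>L'\<close> of \<open>L\<close>, the homomorphism \<open>U(L') \<rightarrow> U(L)\<close> induced by the inclusion: the
  free algebra on \<open>L'\<close> is a subset of that on \<open>L\<close>, and a coset of the smaller ideal is enlarged to
  the coset of the bigger one that contains it.
\<close>

definition env_inclusion ::
  "('a, 'm) ring_scheme \<Rightarrow> ('a, 'b, 'n) lie_alg_scheme \<Rightarrow>
   ('b list \<Rightarrow> 'a) set \<Rightarrow> ('b list \<Rightarrow> 'a) set" where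
  "env_inclusion R L X = env_ideal R L <+>\<^bsub>free_algebra R (carrier L)\<^esub> X"

text \<open>
  The action of \<open>U(L)\<close> on an \<open>L\<close>-module \<open>M\<close> with operators \<open>\<rho>\<close>, computed on a representative of
  the coset \<open>X\<close>.
\<close>

definition env_act ::
  "('a, 'm) ring_scheme \<Rightarrow> ('a, 'c, 'n) module_scheme \<Rightarrow> ('b \<Rightarrow> 'c \<Rightarrow> 'c) \<Rightarrow>
   ('b list \<Rightarrow> 'a) set \<Rightarrow> 'c \<Rightarrow> 'c" where
  "env_act R M \<rho> X m =
     (let x = SOME x. x \<in> X
      in \<Oplus>\<^bsub>M\<^esub> w \<in> {w. x w \<noteq> \<zero>\<^bsub>R\<^esub>}. x w \<odot>\<^bsub>M\<^esub> foldr \<rho> w m)"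

text \<open>\<open>U(L) \<otimes>\<^bsub>U(L')\<^esub> N\<close> as a left \<open>U(L)\<close>-module (the scalar type of the record is \<open>U(L)\<close>).\<close>

definition induced_pure ::
  "('a, 'm) ring_scheme \<Rightarrow> ('a, 'b, 'n) lie_alg_scheme \<Rightarrow> ('a, 'b, 'o) lie_alg_scheme \<Rightarrow>
   ('a, 'c, 'p) module_scheme \<Rightarrow> ('b \<Rightarrow> 'c \<Rightarrow> 'c) \<Rightarrow>
   ('b list \<Rightarrow> 'a) set \<Rightarrow> 'c \<Rightarrow> (('b list \<Rightarrow> 'a) set \<times> 'c \<Rightarrow>\<^sub>0 int) set" where
  "induced_pure R L L' N \<rho> =
     pure_tensor (env R L') (env R L) N
       (\<lambda>u b. u \<otimes>\<^bsub>env R L\<^esub> env_inclusion R L b) (env_act R N \<rho>)"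

definition induced_module ::
  "('a, 'm) ring_scheme \<Rightarrow> ('a, 'b, 'n) lie_alg_scheme \<Rightarrow> ('a, 'b, 'o) lie_alg_scheme \<Rightarrow>
   ('a, 'c, 'p) module_scheme \<Rightarrow> ('b \<Rightarrow> 'c \<Rightarrow> 'c) \<Rightarrow>
   (('b list \<Rightarrow> 'a) set, (('b list \<Rightarrow> 'a) set \<times> 'c \<Rightarrow>\<^sub>0 int) set) module" where
  "induced_module R L L' N \<rho> =
     tensor_module (env R L') (env R L) N
       (\<lambda>u b. u \<otimes>\<^bsub>env R L\<^esub> env_inclusion R L b) (env_act R N \<rho>)
       (\<lambda>u v. u \<otimes>\<^bsub>env R L\<^esub> v)"


section \<open>The affine Lie algebra attached to \<open>p\<close>\<close>

text \<open>\<open>g \<oplus> g\<^sup>1\<close>: the pair \<open>(a, b)\<close> stands for \<open>a + b\<^sup>1\<close>.\<close>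

definition double :: "(complex, 'g, 'n) module_scheme \<Rightarrow> (complex, 'g \<times> 'g) module" where
  "double G =
     \<lparr>carrier = carrier G \<times> carrier G, monoid.mult = undefined, one = undefined,
      zero = (\<zero>\<^bsub>G\<^esub>, \<zero>\<^bsub>G\<^esub>),
      add = (\<lambda>(a, b) (c, d). (a \<oplus>\<^bsub>G\<^esub> c, b \<oplus>\<^bsub>G\<^esub> d)),
      module.smult = (\<lambda>s (a, b). (s \<odot>\<^bsub>G\<^esub> a, s \<odot>\<^bsub>G\<^esub> b))\<rparr>"

text \<open>\<open>\<complex>((z)) \<otimes> (g \<oplus> g\<^sup>1)\<close>, the tensor product being over \<open>\<complex>\<close>.\<close>

type_synonym 'g ext = "(complex fls \<times> ('g \<times> 'g) \<Rightarrow>\<^sub>0 int) set"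

definition ext_pure ::
  "(complex, 'g, 'n) module_scheme \<Rightarrow> complex fls \<Rightarrow> 'g \<times> 'g \<Rightarrow> 'g ext" where
  "ext_pure G = pure_tensor CC KK (double G) (\<lambda>f c. f * fls_const c) (module.smult (double G))"

definition ext_module ::
  "(complex, 'g, 'n) module_scheme \<Rightarrow> (complex fls, 'g ext) module" where
  "ext_module G = tensor_module CC KK (double G) (\<lambda>f c. f * fls_const c) (module.smult (double G)) (*)"

text \<open>
  \<open>\<complex>((z)) \<otimes> (g \<oplus> g\<^sup>1) \<otimes> \<complex>[t, t\<^sup>-\<^sup>1] \<oplus> \<complex>((z)) k\<close>.  An element of the first summand is written
  as a Laurent polynomial \<open>\<Sum>\<^sub>n u\<^sub>n \<otimes> t\<^sup>n\<close>, i.e. as the finitely supported family of its coefficients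
  \<open>u\<^sub>n \<in> \<complex>((z)) \<otimes> (g \<oplus> g\<^sup>1)\<close>; the pair \<open>(u, h)\<close> stands for \<open>\<Sum>\<^sub>n u\<^sub>n \<otimes> t\<^sup>n + h k\<close>.
\<close>

type_synonym 'g chk = "(int \<Rightarrow> 'g ext) \<times> complex fls"

definition check_module ::
  "(complex, 'g, 'n) module_scheme \<Rightarrow> (complex fls, 'g chk) module" where
  "check_module G =
     (let T = ext_module G in
     \<lparr>carrier = {u. (\<forall>n. u n \<in> carrier T) \<and> finite {n. u n \<noteq> \<zero>\<^bsub>T\<^esub>}} \<times> UNIV,
      monoid.mult = undefined, one = undefined,
      zero = ((\<lambda>n. \<zero>\<^bsub>T\<^esub>), 0),
      add = (\<lambda>(u, h) (v, k). ((\<lambda>n. u n \<oplus>\<^bsub>T\<^esub> v n), h + k)),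
      module.smult = (\<lambda>f (u, h). ((\<lambda>n. f \<odot>\<^bsub>T\<^esub> u n), f * h))\<rparr>)"

definition check_mode :: "(complex, 'g, 'n) module_scheme \<Rightarrow> 'g \<times> 'g \<Rightarrow> int \<Rightarrow> 'g chk" where
  "check_mode G w n =
     ((\<lambda>r. if r = n then ext_pure G 1 w else \<zero>\<^bsub>ext_module G\<^esub>), 0)"

text \<open>
  The bracket of \<open>f \<otimes> (a + a'\<^sup>1) \<otimes> t\<^sup>m\<close> and \<open>g \<otimes> (b + b'\<^sup>1) \<otimes> t\<^sup>n\<close>, read off from the generating
  functions as the coefficient of \<open>x\<^sub>1\<^sup>-\<^sup>m\<^sup>-\<^sup>1 x\<^sub>2\<^sup>-\<^sup>n\<^sup>-\<^sup>1\<close>.  Writing \<open>P\<^sub>j\<close> and \<open>Q\<^sub>j\<close> for the coefficients of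
  \<open>x\<^sup>j\<close> in \<open>p(z + x)\<close> and \<open>p'(z + x)\<close>, and using
  \<open>x\<^sub>2\<^sup>-\<^sup>1 \<delta>(x\<^sub>1/x\<^sub>2) = \<Sum>\<^sub>m x\<^sub>1\<^sup>-\<^sup>m\<^sup>-\<^sup>1 x\<^sub>2\<^sup>m\<close>, these are
  \<open>[a(m), b(n)] = [a,b](m+n) + m \<langle>a,b\<rangle> \<delta>\<^bsub>m+n,0\<^esub> k\<close>,
  \<open>[a(m), b\<^sup>1(n)] = [a\<^sup>1(m), b(n)] = [a,b]\<^sup>1(m+n)\<close> and
  \<open>[a\<^sup>1(m), b\<^sup>1(n)] = \<Sum>\<^sub>j P\<^sub>j [a,b](m+n+j) + 1/2 \<langle>a,b\<rangle> Q\<^bsub>-m-n-1\<^esub> k + m \<langle>a,b\<rangle> P\<^bsub>-m-n\<^esub> k\<close>.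
\<close>

fun check_bracket_pure ::
  "(complex, 'g, 'n) lie_alg_scheme \<Rightarrow> ('g \<Rightarrow> 'g \<Rightarrow> complex) \<Rightarrow> complex poly \<Rightarrow>
   int \<Rightarrow> complex fls \<times> ('g \<times> 'g) \<Rightarrow> int \<Rightarrow> complex fls \<times> ('g \<times> 'g) \<Rightarrow> 'g chk" where
  "check_bracket_pure G B p m (f, (a, a')) n (g, (b, b')) =
     (let T = ext_module G;
          P = shift_coeff (fls_of_poly p);
          Q = shift_coeff (fls_of_poly (pderiv p))
      in ((\<lambda>r. (if r = m + n
                then ext_pure G (f * g)
                       (lie_bracket G a b, lie_bracket G a b' \<oplus>\<^bsub>G\<^esub> lie_bracket G a' b)
                else \<zero>\<^bsub>T\<^esub>)
               \<oplus>\<^bsub>T\<^esub> ext_pure G (f * g * P (r - m - n)) (lie_bracket G a' b', \<zero>\<^bsub>G\<^esub>)),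
          f * g * (of_int m * fls_const (B a b) * (if m + n = 0 then 1 else 0)
                   + fls_const (1/2) * fls_const (B a' b') * Q (- m - n - 1)
                   + of_int m * fls_const (B a' b') * P (- m - n))))"

definition check_bracket ::
  "(complex, 'g, 'n) lie_alg_scheme \<Rightarrow> ('g \<Rightarrow> 'g \<Rightarrow> complex) \<Rightarrow> complex poly \<Rightarrow>
   'g chk \<Rightarrow> 'g chk \<Rightarrow> 'g chk" where
  "check_bracket G B p x y =
     (let T = ext_module G; C = check_module G; u = fst x; v = fst y
      in \<Oplus>\<^bsub>C\<^esub> m \<in> {m. u m \<noteq> \<zero>\<^bsub>T\<^esub>}. \<Oplus>\<^bsub>C\<^esub> n \<in> {n. v n \<noteq> \<zero>\<^bsub>T\<^esub>}.
           tensor_lift C (\<lambda>i. tensor_lift C (\<lambda>j. check_bracket_pure G B p m i n j) (v n)) (u m))"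

definition check_alg ::
  "(complex, 'g, 'n) lie_alg_scheme \<Rightarrow> ('g \<Rightarrow> 'g \<Rightarrow> complex) \<Rightarrow> complex poly \<Rightarrow>
   (complex fls, 'g chk) lie_alg" where
  "check_alg G B p = module.extend (check_module G) (lie_alg.fields (check_bracket G B p))"

definition check_borel ::
  "(complex, 'g, 'n) lie_alg_scheme \<Rightarrow> ('g \<Rightarrow> 'g \<Rightarrow> complex) \<Rightarrow> complex poly \<Rightarrow>
   (complex fls, 'g chk) lie_alg" where
  "check_borel G B p =
     (check_alg G B p)
       \<lparr>carrier := {(u, h) \<in> carrier (check_alg G B p). \<forall>n<0. u n = \<zero>\<^bsub>ext_module G\<^esub>}\<rparr>"


section \<open>The induced module of level \<open>lv\<close>\<close>

text \<open>\<open>\<complex>((z))\<^sub>l\<^sub>v\<close>: \<open>k\<close> acts by \<open>lv\<close>, the first summand by zero.\<close>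

definition level_act :: "complex \<Rightarrow> 'g chk \<Rightarrow> complex fls \<Rightarrow> complex fls" where
  "level_act lv = (\<lambda>(u, h) f. fls_const lv * h * f)"

type_synonym 'g vac = "(('g chk list \<Rightarrow> complex fls) set \<times> complex fls \<Rightarrow>\<^sub>0 int) set"

definition vacuum_env_module ::
  "(complex, 'g, 'n) lie_alg_scheme \<Rightarrow> ('g \<Rightarrow> 'g \<Rightarrow> complex) \<Rightarrow> complex poly \<Rightarrow> complex \<Rightarrow>
   (('g chk list \<Rightarrow> complex fls) set, 'g vac) module" where
  "vacuum_env_module G B p lv =
     induced_module KK (check_alg G B p) (check_borel G B p) type_module (level_act lv)"

definition vacuum_module ::
  "(complex, 'g, 'n) lie_alg_scheme \<Rightarrow> ('g \<Rightarrow> 'g \<Rightarrow> complex) \<Rightarrow> complex poly \<Rightarrow> complex \<Rightarrow>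
   (complex fls, 'g vac) module" where
  "vacuum_module G B p lv =
     (let V = vacuum_env_module G B p lv
      in \<lparr>carrier = carrier V, monoid.mult = undefined, one = undefined, zero = \<zero>\<^bsub>V\<^esub>, add = add V,
          module.smult = (\<lambda>f v. env_scalar KK (check_alg G B p) f \<odot>\<^bsub>V\<^esub> v)\<rparr>)"

definition vacuum_vector ::
  "(complex, 'g, 'n) lie_alg_scheme \<Rightarrow> ('g \<Rightarrow> 'g \<Rightarrow> complex) \<Rightarrow> complex poly \<Rightarrow> complex \<Rightarrow>
   'g vac" where
  "vacuum_vector G B p lv =
     induced_pure KK (check_alg G B p) (check_borel G B p) type_module (level_act lv)
       \<one>\<^bsub>env KK (check_alg G B p)\<^esub> 1"

text \<open>The operator \<open>w(n)\<close> on the induced module for \<open>w \<in> g \<oplus> g\<^sup>1\<close>.\<close>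

definition vacuum_op ::
  "(complex, 'g, 'n) lie_alg_scheme \<Rightarrow> ('g \<Rightarrow> 'g \<Rightarrow> complex) \<Rightarrow> complex poly \<Rightarrow> complex \<Rightarrow>
   'g \<times> 'g \<Rightarrow> int \<Rightarrow> 'g vac \<Rightarrow> 'g vac" where
  "vacuum_op G B p lv w n v =
     env_of KK (check_alg G B p) (check_mode G w n) \<odot>\<^bsub>vacuum_env_module G B p lv\<^esub> v"


section \<open>Vertex algebras\<close>

text \<open>\<open>gsum V f\<close> is the sum of a finitely supported family indexed by the natural numbers.\<close>

definition gsum :: "('v, 'm) ring_scheme \<Rightarrow> (nat \<Rightarrow> 'v) \<Rightarrow> 'v" where
  "gsum V f = gfinprod (add_monoid V) f UNIV"

text \<open>
  \<open>Y u n\<close> is the coefficient \<open>u\<^sub>n\<close> of \<open>x\<^sup>-\<^sup>n\<^sup>-\<^sup>1\<close> in \<open>Y(u, x)\<close>.  The assumption \<open>jacobi\<close> is the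
  coefficient of \<open>x\<^sub>0\<^sup>-\<^sup>l\<^sup>-\<^sup>1 x\<^sub>1\<^sup>-\<^sup>m\<^sup>-\<^sup>1 x\<^sub>2\<^sup>-\<^sup>n\<^sup>-\<^sup>1\<close> in the Jacobi identity; its sums are finite by
  \<open>truncation\<close>.
\<close>

locale vertex_algebra = Module.module CC V
  for V :: "(complex, 'v, 'n) module_scheme" (structure) +
  fixes Y :: "'v \<Rightarrow> int \<Rightarrow> 'v \<Rightarrow> 'v" and vac :: 'v
  assumes Y_closed: "\<lbrakk>u \<in> carrier V; v \<in> carrier V\<rbrakk> \<Longrightarrow> Y u n v \<in> carrier V"
    and Y_add_left:
      "\<lbrakk>u \<in> carrier V; u' \<in> carrier V; v \<in> carrier V\<rbrakk> \<Longrightarrow> Y (u \<oplus> u') n v = Y u n v \<oplus> Y u' n v"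
    and Y_add_right:
      "\<lbrakk>u \<in> carrier V; v \<in> carrier V; v' \<in> carrier V\<rbrakk> \<Longrightarrow> Y u n (v \<oplus> v') = Y u n v \<oplus> Y u n v'"
    and Y_smult_left: "\<lbrakk>u \<in> carrier V; v \<in> carrier V\<rbrakk> \<Longrightarrow> Y (c \<odot> u) n v = c \<odot> Y u n v"
    and Y_smult_right: "\<lbrakk>u \<in> carrier V; v \<in> carrier V\<rbrakk> \<Longrightarrow> Y u n (c \<odot> v) = c \<odot> Y u n v"
    and truncation: "\<lbrakk>u \<in> carrier V; v \<in> carrier V\<rbrakk> \<Longrightarrow> \<exists>N. \<forall>n\<ge>N. Y u n v = \<zero>"
    and vac_closed: "vac \<in> carrier V"
    and vacuum: "v \<in> carrier V \<Longrightarrow> Y vac n v = (if n = -1 then v else \<zero>)"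
    and creation: "u \<in> carrier V \<Longrightarrow> Y u (-1) vac = u"
    and creation_nonneg: "\<lbrakk>u \<in> carrier V; n \<ge> 0\<rbrakk> \<Longrightarrow> Y u n vac = \<zero>"
    and jacobi:
      "\<lbrakk>u \<in> carrier V; v \<in> carrier V; w \<in> carrier V\<rbrakk> \<Longrightarrow>
        gsum V (\<lambda>i. ((-1) ^ i * (of_int l gchoose i)) \<odot>
            (Y u (m + l - int i) (Y v (n + int i) w)
              \<ominus> ((-1) powi l) \<odot> Y v (n + l - int i) (Y u (m + int i) w)))
        = gsum V (\<lambda>i. (of_int m gchoose i) \<odot> Y (Y u (l + int i) v) (m + n - int i) w)"

definition complex_restriction ::
  "(complex fls, 'v, 'n) module_scheme \<Rightarrow> (complex, 'v) module" where
  "complex_restriction V =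
     \<lparr>carrier = carrier V, monoid.mult = monoid.mult V, one = one V, zero = zero V, add = add V,
      module.smult = (\<lambda>c v. fls_const c \<odot>\<^bsub>V\<^esub> v)\<rparr>"

text \<open>\<open>shift_compat\<close> is the coefficient of \<open>x\<^sup>-\<^sup>n\<^sup>-\<^sup>1\<close> in \<open>Y(f u, x) g v = f(z + x) g Y(u, x) v\<close>.\<close>

locale vertex_laurent_algebra =
  L: Module.module KK V + vertex_algebra "complex_restriction V" Y vac
  for V :: "(complex fls, 'v, 'n) module_scheme" and Y :: "'v \<Rightarrow> int \<Rightarrow> 'v \<Rightarrow> 'v" and vac :: 'v +
  assumes shift_compat:
    "\<lbrakk>u \<in> carrier V; v \<in> carrier V\<rbrakk> \<Longrightarrow>
      Y (f \<odot>\<^bsub>V\<^esub> u) n (g \<odot>\<^bsub>V\<^esub> v)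
      = gsum V (\<lambda>j. (shift_coeff f (int j) * g) \<odot>\<^bsub>V\<^esub> Y u (n + int j) v)"

end

theory Submission
  imports Defs "HOL-Library.Function_Algebras" "HOL-Library.Product_Plus"
begin

text \<open>
  The fields \<open>u(x)\<close> for \<open>u \<in> g + g\<^sup>1\<close> together with the fields \<open>f(z + x)\<close> for \<open>f \<in> \<complex>((z))\<close> are
  pairwise local, annihilate the vacuum to the right order and generate the module from it.  The
  derivation \<open>f \<otimes> u \<otimes> t\<^sup>n \<mapsto> f' \<otimes> u \<otimes> t\<^sup>n - n f \<otimes> u \<otimes> t\<^sup>n\<^sup>-\<^sup>1\<close> of the Lie algebra (it is one because
  \<open>d/dz - d/dt\<close> kills \<open>p(z + t)\<close>) induces an operator \<open>D\<close> with \<open>[D, A(x)] = A'(x)\<close> for these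
  fields: apply the universal property of the induced module to \<open>V \<oplus> V\<close> with \<open>f (v, w) = (f v, f w + f' v)\<close>.
  Dong's lemma closes the generating fields under \<open>n\<close>-th products without losing locality, and by
  Goddard's uniqueness argument a field \<open>A\<close> of the closure is determined by its state \<open>A\<^sub>-\<^sub>1 1\<close>.  So
  \<open>Y(a, x)\<close> may be taken to be the field with state \<open>a\<close>; no P-B-W theorem is needed.
  The Jacobi identity is the Borcherds identity for local fields combined with uniqueness.  Conversely
  the Jacobi identity expresses \<open>Y(u\<^sub>n v, x)\<close> through \<open>Y(u, x)\<close> and \<open>Y(v, x)\<close>, whence uniqueness of \<open>Y\<close>.
\<close>

text \<open>Three circumstances shape the proof. D satisfies D(f v) = f D v + f' v, so it is linear
  over C only, and a universal property over C((z)) cannot give it directly; as second component of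
  a map into a twisted sum it becomes part of a C((z))-linear map. For the same reason the calculus
  of fields runs over C, and an element f of C((z)) has two roles there: multiplication by f, which
  commutes with all fields (the set \<open>Ks\<close>), and the modes of f(z + x), which form a
  field of their own and let the closure process reach every C((z))-multiple of a state. Next, the
  induced module is a carrier of cosets, whereas the calculus of fields lives on a whole type;
  equality of two fields is therefore claimed only on a subspace \<open>W\<close>. Finally, the
  module is known through two facts alone: it is generated from the vacuum
  (\<open>VE_generated\<close>), and it maps to every representation with a suitable vector
  (\<open>universal\<close>). The first yields truncation, the scalar action of the central element
  and uniqueness; the second yields D.\<close>

section \<open>Fields on a vector space\<close>

text \<open>Read \<open>\<phi>\<close> as the series with coefficient \<phi>(m,n) at x1^(-m-1)
  x2^(-n-1). Multiplying by a variable raises the index of the coefficient by one, so this is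
  multiplication by x1 - x2.\<close>

definition dif :: "(int \<Rightarrow> int \<Rightarrow> 'a::ab_group_add) \<Rightarrow> int \<Rightarrow> int \<Rightarrow> 'a" where
  "dif \<phi> m n = \<phi> (m + 1) n - \<phi> m (n + 1)"

lemma dif_diff: "dif (\<phi> - \<psi>) = dif \<phi> - dif \<psi>"
  by (simp add: dif_def fun_eq_iff algebra_simps)

lemma dif_add: "dif (\<phi> + \<psi>) = dif \<phi> + dif \<psi>"
  by (simp add: dif_def fun_eq_iff algebra_simps)

lemma dif_zero [simp]: "dif 0 = 0"
  by (simp add: dif_def fun_eq_iff)

lemma funpow_dif_zero [simp]: "(dif ^^ N) 0 = 0"
  by (induction N) (simp_all only: funpow.simps comp_apply id_apply dif_zero)

lemma funpow_dif_add: "(dif ^^ N) (\<phi> + \<psi>) = (dif ^^ N) \<phi> + (dif ^^ N) \<psi>"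
  by (induction N) (simp_all only: funpow.simps comp_apply id_apply dif_add)

lemma funpow_dif_diff: "(dif ^^ N) (\<phi> - \<psi>) = (dif ^^ N) \<phi> - (dif ^^ N) \<psi>"
  by (induction N) (simp_all only: funpow.simps comp_apply id_apply dif_diff)

lemma funpow_dif_mono: "(dif ^^ N) \<phi> = 0 \<Longrightarrow> N \<le> M \<Longrightarrow> (dif ^^ M) \<phi> = 0"
  by (metis funpow_dif_zero funpow_add comp_apply le_add_diff_inverse2)

text \<open>Exchanging the variables turns x1 - x2 into its negative; the induction absorbs the sign
  by passing to \<open>0 - dif \<phi>\<close>.\<close>

lemma funpow_dif_swap: "(dif ^^ N) \<phi> = 0 \<Longrightarrow> (dif ^^ N) (\<lambda>m n. \<phi> n m) = 0"
proof (induction N arbitrary: \<phi>)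
  case (Suc N)
  have *: "dif (\<lambda>m n. \<phi> n m) = (\<lambda>m n. (0 - dif \<phi>) n m)"
    by (simp add: dif_def fun_eq_iff)
  have "(dif ^^ N) (0 - dif \<phi>) = 0"
    using Suc.prems by (simp only: funpow_dif_diff funpow_Suc_right comp_apply funpow_dif_zero diff_self)
  from Suc.IH[OF this] show ?case
    by (simp only: funpow_Suc_right comp_apply *)
qed (auto simp: fun_eq_iff)

text \<open>Downward induction on \<open>l\<close>: once everything at level l + 1 vanishes, the
  recursion says that \<open>e l m n\<close> depends on m + n alone, and it is 0 at m = 0.\<close>

lemma grid_zero:
  fixes e :: "int \<Rightarrow> int \<Rightarrow> int \<Rightarrow> 'a::ab_group_add"
  assumes step: "\<And>l m n. e (l + 1) m n = e l (m + 1) n - e l m (n + 1)"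
    and zero: "\<And>l n. e l 0 n = 0"
    and large: "\<And>l m n. N \<le> l \<Longrightarrow> e l m n = 0"
  shows "e l m n = 0"
proof -
  have "e l m n = 0" if "N - int k \<le> l" for k l m n
    using that
  proof (induction k arbitrary: l m n)
    case 0
    then show ?case using large by simp
  next
    case (Suc k)
    have eq: "e l (m + 1) n = e l m (n + 1)" for m n
      using step[of l m n] Suc.IH[of "l + 1" m n] Suc.prems by simp
    show ?case
    proof (induction m arbitrary: n rule: int_induct[where k = 0])
      case base
      show ?case by (rule zero)
    next
      case (step1 i)
      then show ?case by (simp add: eq)
    next
      case (step2 i)
      then show ?case using eq[of "i - 1" "n - 1"] by simp
    qed
  qed
  from this[of "nat (N - l)"] show ?thesis by simp
qed

text \<open>Algebraic core of Dong's lemma. One factor S = U - T is spent on \<open>x\<close>: then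
  \<open>U x\<close> satisfies the hypotheses with \<open>c\<close> lowered by one, and
  \<open>T x\<close> with \<open>d\<close> lowered by one. At c = 0 the first hypothesis says that
  \<open>S ^^ N\<close> kills \<open>x\<close>; at d = 0 the second says x = 0.\<close>

lemma commuting_funpow_zero:
  fixes S U T :: "'a::ab_group_add \<Rightarrow> 'a"
  assumes S: "\<And>x. S x = U x - T x"
    and add: "\<And>x y. S (x - y) = S x - S y"
    and SU: "\<And>x. S (U x) = U (S x)" and ST: "\<And>x. S (T x) = T (S x)" and TU: "\<And>x. T (U x) = U (T x)"
    and zero: "U 0 = 0" "T 0 = 0"
    and 1: "(S ^^ N) ((U ^^ c) x) = 0" and 2: "(T ^^ d) x = 0"
  shows "(S ^^ (N + c + d)) x = 0"
proof -
  have S0: "S 0 = 0" using zero S[of 0] by simp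
  have Sn0: "(S ^^ n) 0 = 0" for n by (induction n) (auto simp: S0)
  have SnU: "(S ^^ n) (U x) = U ((S ^^ n) x)" for n x by (induction n) (auto simp: SU)
  have SnT: "(S ^^ n) (T x) = T ((S ^^ n) x)" for n x by (induction n) (auto simp: ST)
  have UnT: "(U ^^ n) (T x) = T ((U ^^ n) x)" for n x by (induction n) (auto simp: TU)
  have TnU: "(T ^^ n) (U x) = U ((T ^^ n) x)" for n x by (induction n) (auto simp: TU)
  have Sdiff: "(S ^^ n) (x - y) = (S ^^ n) x - (S ^^ n) y" for n x y
    by (induction n) (auto simp: add)
  from 1 2 show ?thesis
  proof (induction "c + d" arbitrary: c d x)
    case 0
    then show ?case by simp
  next
    case (Suc k)
    show ?case
    proof (cases "c = 0 \<or> d = 0")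
      case True
      then show ?thesis
      proof
        assume "c = 0"
        then have "(S ^^ d) ((S ^^ N) x) = 0" using Suc.prems Sn0 by simp
        then show ?thesis using \<open>c = 0\<close> by (simp add: funpow_add add.commute[of N d])
      next
        assume "d = 0"
        then show ?thesis using Suc.prems Sn0 by simp
      qed
    next
      case False
      then obtain c' d' where cd: "c = Suc c'" "d = Suc d'" by (meson not0_implies_Suc)
      have "(S ^^ (N + c' + d)) (U x) = 0"
      proof (rule Suc.hyps(1))
        show "k = c' + d" using Suc.hyps(2) cd by simp
        show "(S ^^ N) ((U ^^ c') (U x)) = 0" using Suc.prems(1) by (simp add: cd funpow_swap1)
        show "(T ^^ d) (U x) = 0" using Suc.prems(2) by (simp only: TnU zero)
      qed
      moreover have "(S ^^ (N + c + d')) (T x) = 0"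
      proof (rule Suc.hyps(1))
        show "k = c + d'" using Suc.hyps(2) cd by simp
        show "(S ^^ N) ((U ^^ c) (T x)) = 0" using Suc.prems(1) by (simp only: UnT SnT zero)
        show "(T ^^ d') (T x) = 0" using Suc.prems(2) by (simp add: cd funpow_swap1)
      qed
      moreover have "N + c + d = Suc (N + c' + d)" "N + c' + d = N + c + d'"
        using cd by auto
      ultimately show ?thesis
        using Sdiff[of "N + c' + d" "U x" "T x"]
        by (simp only: funpow_Suc_right comp_apply S) simp
    qed
  qed
qed

section \<open>Fields, series in two variables and the expansions of (x1 - x2)^l\<close>

locale vector_space_char_0 = vector_space scale
  for scale :: "'a::field_char_0 \<Rightarrow> 'b::ab_group_add \<Rightarrow> 'b"
begin

notation scale (infixr \<open>*s\<close> 75)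

definition lin :: "('b \<Rightarrow> 'b) \<Rightarrow> bool" where
  "lin f \<longleftrightarrow> (\<forall>x y. f (x + y) = f x + f y) \<and> (\<forall>c x. f (c *s x) = c *s f x)"

lemma lin_add: "lin f \<Longrightarrow> f (x + y) = f x + f y"
  and lin_scale: "lin f \<Longrightarrow> f (c *s x) = c *s f x"
  by (auto simp: lin_def)

lemma lin_zero: "lin f \<Longrightarrow> f 0 = 0"
  by (metis lin_scale scale_zero_left)

lemma lin_diff: "lin f \<Longrightarrow> f (x - y) = f x - f y"
  by (metis lin_add diff_add_cancel add_diff_cancel_right')

lemma lin_sum: "lin f \<Longrightarrow> f (\<Sum>i\<in>I. g i) = (\<Sum>i\<in>I. f (g i))"
  by (induction I rule: infinite_finite_induct) (auto simp: lin_zero lin_add)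

lemma lin_id: "lin (\<lambda>x. x)" and lin_0: "lin (\<lambda>x. 0)"
  by (auto simp: lin_def)

lemma lin_plus: "lin f \<Longrightarrow> lin g \<Longrightarrow> lin (\<lambda>x. f x + g x)"
  and lin_minus: "lin f \<Longrightarrow> lin g \<Longrightarrow> lin (\<lambda>x. f x - g x)"
  and lin_smult: "lin f \<Longrightarrow> lin (\<lambda>x. c *s f x)"
  and lin_comp: "lin f \<Longrightarrow> lin g \<Longrightarrow> lin (\<lambda>x. f (g x))"
  by (auto simp: lin_def algebra_simps)

definition quantum_field :: "(int \<Rightarrow> 'b \<Rightarrow> 'b) \<Rightarrow> bool" where
  "quantum_field A \<longleftrightarrow> (\<forall>n. lin (A n)) \<and> (\<forall>v. \<exists>N. \<forall>n\<ge>N. A n v = 0)"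

lemma qf_lin: "quantum_field A \<Longrightarrow> lin (A n)"
  by (auto simp: quantum_field_def)

lemma qf_trunc: "quantum_field A \<Longrightarrow> \<exists>N. \<forall>n\<ge>N. A n v = 0"
  by (auto simp: quantum_field_def)

lemma qf_zero [simp]: "quantum_field A \<Longrightarrow> A n 0 = 0"
  by (rule lin_zero[OF qf_lin])

text \<open>The coefficient of x1^(l-i) x2^i in (x1 - x2)^l, for any integer \<open>l\<close>,
  expanded in nonnegative powers of x2.\<close>

definition binc :: "int \<Rightarrow> nat \<Rightarrow> 'a" where
  "binc l i = (-1) ^ i * (of_int l gchoose i)"

lemma binc_0 [simp]: "binc l 0 = 1"
  by (simp add: binc_def)

lemma binc_zero: "binc 0 i = (if i = 0 then 1 else 0)"
  by (cases i) (auto simp: binc_def)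

lemma gbinomial_of_int_Suc:
  "(of_int (l + 1) gchoose Suc i :: 'a) = (of_int l gchoose i) + (of_int l gchoose Suc i)"
  using gbinomial_Suc_Suc[of "of_int l :: 'a" i] by simp

lemma binc_Suc: "binc (l + 1) (Suc i) = binc l (Suc i) - binc l i"
  unfolding binc_def gbinomial_of_int_Suc by (simp add: algebra_simps)

text \<open>Coefficientwise form of (d/dx1 + d/dx2) (x1 - x2)^l = 0.\<close>

lemma binc_absorb: "of_int (l - int i) * binc l i = - (of_nat (Suc i) * binc l (Suc i))"
proof -
  have "of_int (l - int i) * (of_int l gchoose i :: 'a) = of_nat (Suc i) * (of_int l gchoose Suc i)"
    using gbinomial_absorb_comp[of "of_int l :: 'a" i] gbinomial_absorption[of i "of_int l :: 'a"]
    by simp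
  then show ?thesis by (simp add: binc_def mult.left_commute del: of_nat_Suc of_int_diff)
qed

text \<open>
  \<open>ser g l\<close> is the product of the generating function of \<open>g\<close> with \<open>(x\<^sub>1 - x\<^sub>2)\<^sup>l\<close>, the latter
  expanded in nonnegative powers of \<open>x\<^sub>2\<close>.
\<close>

definition ser :: "(int \<Rightarrow> int \<Rightarrow> 'b) \<Rightarrow> int \<Rightarrow> int \<Rightarrow> int \<Rightarrow> 'b" where
  "ser g l m n = Sum_any (\<lambda>i. binc l i *s g (m + l - int i) (n + int i))"

text \<open>Both indices of \<open>g\<close> move along the sum in \<open>ser\<close>, so the bound
  on the second index has to be uniform in the first for that sum to be finite.\<close>

definition tame :: "(int \<Rightarrow> int \<Rightarrow> 'b) \<Rightarrow> bool" where
  "tame g \<longleftrightarrow> (\<exists>N. \<forall>m n. N \<le> n \<longrightarrow> g m n = 0)"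

lemma ser_eq_sum:
  assumes "\<And>m n. N \<le> n \<Longrightarrow> g m n = 0" "N \<le> n + int K"
  shows "ser g l m n = (\<Sum>i<K. binc l i *s g (m + l - int i) (n + int i))"
  unfolding ser_def
proof (rule Sum_any.expand_superset)
  show "{a. binc l a *s g (m + l - int a) (n + int a) \<noteq> 0} \<subseteq> {..<K}"
  proof
    fix a assume "a \<in> {a. binc l a *s g (m + l - int a) (n + int a) \<noteq> 0}"
    then have "g (m + l - int a) (n + int a) \<noteq> 0" by auto
    then have "\<not> N \<le> n + int a" using assms(1) by blast
    then show "a \<in> {..<K}" using assms(2) by simp
  qed
qed simp

text \<open>One \<open>N\<close> serves all \<open>l\<close>, \<open>m\<close>, \<open>n\<close>;
  series at neighbouring indices can thus be written as finite sums of matching lengths.\<close>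

lemma tame_bound:
  assumes "tame g"
  obtains N where "\<And>K n l m. N \<le> n + int K \<Longrightarrow>
      ser g l m n = (\<Sum>i<K. binc l i *s g (m + l - int i) (n + int i))"
proof -
  obtain N where N: "\<And>m n. N \<le> n \<Longrightarrow> g m n = 0" using assms by (auto simp: tame_def)
  show ?thesis by (rule that[of N], rule ser_eq_sum[of N], rule N)
qed

lemma tame_add: "tame g \<Longrightarrow> tame h \<Longrightarrow> tame (\<lambda>m n. g m n + h m n)"
proof -
  assume "tame g" "tame h"
  then obtain M N where "\<And>m n. M \<le> n \<Longrightarrow> g m n = 0" "\<And>m n. N \<le> n \<Longrightarrow> h m n = 0"
    by (auto simp: tame_def)
  then show ?thesis unfolding tame_def by (intro exI[of _ "max M N"]) auto
qed

lemma tame_lin: "tame g \<Longrightarrow> lin f \<Longrightarrow> tame (\<lambda>m n. f (g m n))"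
  unfolding tame_def by (metis lin_zero)

lemma ser_add:
  assumes "tame g" "tame h"
  shows "ser (\<lambda>m n. g m n + h m n) l m n = ser g l m n + ser h l m n"
proof -
  obtain M where M: "\<And>K n l m. M \<le> n + int K \<Longrightarrow>
      ser g l m n = (\<Sum>i<K. binc l i *s g (m + l - int i) (n + int i))"
    using tame_bound[OF assms(1)] by blast
  obtain N where N: "\<And>K n l m. N \<le> n + int K \<Longrightarrow>
      ser h l m n = (\<Sum>i<K. binc l i *s h (m + l - int i) (n + int i))"
    using tame_bound[OF assms(2)] by blast
  obtain L where L: "\<And>K n l m. L \<le> n + int K \<Longrightarrow>
      ser (\<lambda>m n. g m n + h m n) l m n = (\<Sum>i<K. binc l i *s (g (m + l - int i) (n + int i) + h (m + l - int i) (n + int i)))"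
    using tame_bound[OF tame_add[OF assms]] by blast
  define K where "K = nat (max L (max M N) - n)"
  have "L \<le> n + int K" "M \<le> n + int K" "N \<le> n + int K" by (auto simp: K_def)
  then show ?thesis
    by (simp add: L M N sum.distrib[symmetric] scale_right_distrib)
qed

lemma ser_lin:
  assumes "tame g" "lin f"
  shows "ser (\<lambda>m n. f (g m n)) l m n = f (ser g l m n)"
proof -
  obtain N where N: "\<And>m n. N \<le> n \<Longrightarrow> g m n = 0" using assms by (auto simp: tame_def)
  define K where "K = nat (N - n)"
  have K: "N \<le> n + int K" by (auto simp: K_def)
  show ?thesis
    by (subst (1 2) ser_eq_sum[OF _ K])
       (use N assms(2) in \<open>auto simp: lin_zero lin_sum lin_scale\<close>)
qed

lemma ser_diff:
  assumes "tame g" "tame h"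
  shows "ser (\<lambda>m n. g m n - h m n) l m n = ser g l m n - ser h l m n"
proof -
  have l: "lin uminus" by (auto simp: lin_def)
  show ?thesis
    using ser_add[OF assms(1) tame_lin[OF assms(2) l]] ser_lin[OF assms(2) l] by simp
qed

lemma ser_shift1: "ser (\<lambda>m n. g (m + 1) n) l m n = ser g l (m + 1) n"
  by (simp add: ser_def algebra_simps)

lemma ser_shift2: "ser (\<lambda>m n. g m (n + 1)) l m n = ser g l m (n + 1)"
  by (simp add: ser_def algebra_simps)

lemma ser_0: "ser g 0 m n = g m n"
proof -
  have "ser g 0 m n = Sum_any (\<lambda>i. if i = 0 then g (m + 0 - int i) (n + int i) else 0)"
    unfolding ser_def by (rule Sum_any.cong) (auto simp: binc_zero)
  then show ?thesis by simp
qed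

lemma ser_pascal:
  assumes "tame g"
  shows "ser g (l + 1) m n = ser g l (m + 1) n - ser g l m (n + 1)"
proof -
  obtain N where N: "\<And>K n l m. N \<le> n + int K \<Longrightarrow>
      ser g l m n = (\<Sum>i<K. binc l i *s g (m + l - int i) (n + int i))"
    using tame_bound[OF assms] by blast
  \<comment> \<open>The sums at second index \<open>n\<close> get one term more than the one at n +
    1. Splitting off their first term makes all of them run over the same range, where Pascal's rule
    for \<open>binc\<close> acts termwise.\<close>
  define K where "K = nat (N - n)"
  have K: "N \<le> n + int (Suc K)" "N \<le> (n + 1) + int K" by (auto simp: K_def)
  have idx: "m + 1 + l - int (Suc i) = m + l - int i" "m + (l + 1) - int (Suc i) = m + l - int i"
    "n + int (Suc i) = n + 1 + int i" for i
    by simp_all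
  show ?thesis
    by (simp only: N[OF K(1)] N[OF K(2)] sum.lessThan_Suc_shift idx binc_Suc
        scale_left_diff_distrib sum_subtractf)
       (simp add: ac_simps)
qed

text \<open>In terms of coefficients the operator is -(d/dx1 + d/dx2), which annihilates (x1 - x2)^l
  and therefore commutes with multiplication by it.\<close>

lemma ser_derivation:
  assumes "tame g"
  shows "ser (\<lambda>m n. of_int m *s g (m - 1) n + of_int n *s g m (n - 1)) l m n
       = of_int m *s ser g l (m - 1) n + of_int n *s ser g l m (n - 1)"
proof -
  obtain N where N: "\<And>m n. N \<le> n \<Longrightarrow> g m n = 0" using assms by (auto simp: tame_def)
  define K where "K = nat (N + 1 - n)"
  have K: "N + 1 \<le> n + int K" "N \<le> n + int K" "N \<le> n - 1 + int (Suc K)" by (auto simp: K_def)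
  let ?t = "\<lambda>i. g (m - 1 + l - int i) (n + int i)"
  have S: "(\<Sum>i<K. binc l i *s (of_int (n + int i) *s g (m + l - int i) (n + int i - 1)))
      = of_int n *s g (m + l) (n - 1)
        + (\<Sum>i<K. binc l (Suc i) *s (of_int (n + 1 + int i) *s ?t i))"
  proof -
    have "(\<Sum>i<K. binc l i *s (of_int (n + int i) *s g (m + l - int i) (n + int i - 1)))
       = (\<Sum>i<Suc K. binc l i *s (of_int (n + int i) *s g (m + l - int i) (n + int i - 1)))"
      using K by (simp add: N)
    then show ?thesis by (simp only: sum.lessThan_Suc_shift) (simp add: algebra_simps)
  qed
  \<comment> \<open>After the index shift in \<open>S\<close>, the coefficient of
    \<open>?t i\<close> unites both derivatives; \<open>binc_absorb\<close> cancels the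
    contributions that come from differentiating (x1 - x2)^l.\<close>
  have c: "binc l i * of_int (m + l - int i) + binc l (Suc i) * of_int (n + 1 + int i)
     = of_int m * binc l i + of_int n * binc l (Suc i)" for i
    using binc_absorb[of l i] by (simp add: algebra_simps)
  have "ser (\<lambda>m n. of_int m *s g (m - 1) n + of_int n *s g m (n - 1)) l m n
     = (\<Sum>i<K. binc l i *s (of_int (m + l - int i) *s g (m + l - int i - 1) (n + int i)
           + of_int (n + int i) *s g (m + l - int i) (n + int i - 1)))"
    by (rule ser_eq_sum[OF _ K(1)]) (auto simp: N)
  also have "\<dots> = (\<Sum>i<K. binc l i *s (of_int (m + l - int i) *s ?t i))
      + (\<Sum>i<K. binc l i *s (of_int (n + int i) *s g (m + l - int i) (n + int i - 1)))"
  proof -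
    have "m + l - int i - 1 = m - 1 + l - int i" for i by simp
    then show ?thesis by (simp only: scale_right_distrib sum.distrib)
  qed
  also have "\<dots> = of_int n *s g (m + l) (n - 1)
      + (\<Sum>i<K. (binc l i * of_int (m + l - int i) + binc l (Suc i) * of_int (n + 1 + int i)) *s ?t i)"
    unfolding S by (simp only: scale_left_distrib sum.distrib scale_scale) (simp add: ac_simps)
  also have "\<dots> = of_int m *s (\<Sum>i<K. binc l i *s ?t i)
      + of_int n *s (\<Sum>i<Suc K. binc l i *s g (m + l - int i) (n - 1 + int i))"
    unfolding c sum.lessThan_Suc_shift
    by (simp add: scale_left_distrib sum.distrib scale_sum_right algebra_simps)
  also have "(\<Sum>i<K. binc l i *s ?t i) = ser g l (m - 1) n"
    by (rule ser_eq_sum[OF _ K(2), symmetric]) (rule N)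
  also have "(\<Sum>i<Suc K. binc l i *s g (m + l - int i) (n - 1 + int i)) = ser g l m (n - 1)"
    by (rule ser_eq_sum[OF _ K(3), symmetric]) (rule N)
  finally show ?thesis .
qed

lemma tame_fields: "quantum_field A \<Longrightarrow> quantum_field B \<Longrightarrow> tame (\<lambda>m n. A m (B n v))"
  unfolding tame_def by (metis qf_trunc qf_zero)

text \<open>The left-hand side of the Jacobi identity of a vertex algebra, for a pair of fields.\<close>

definition bor :: "(int \<Rightarrow> 'b \<Rightarrow> 'b) \<Rightarrow> (int \<Rightarrow> 'b \<Rightarrow> 'b) \<Rightarrow> int \<Rightarrow> int \<Rightarrow> int \<Rightarrow> 'b \<Rightarrow> 'b" where
  "bor A B l m n v =
     ser (\<lambda>m n. A m (B n v)) l m n - (-1) powi l *s ser (\<lambda>n m. B n (A m v)) l n m"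

lemma bor_0: "bor A B 0 m n v = A m (B n v) - B n (A m v)"
  by (simp add: bor_def ser_0)

text \<open>Both expansions obey Pascal's rule; the sign (-1)^l in the second half accounts for x2 -
  x1 = -(x1 - x2).\<close>

lemma bor_step:
  assumes "quantum_field A" "quantum_field B"
  shows "bor A B (l + 1) m n v = bor A B l (m + 1) n v - bor A B l m (n + 1) v"
proof -
  have "(-1 :: 'a) powi (l + 1) = - ((-1) powi l)" by (simp add: power_int_add)
  then show ?thesis
    unfolding bor_def ser_pascal[OF tame_fields[OF assms], of v l m n]
      ser_pascal[OF tame_fields[OF assms(2,1)], of v l n m]
    by (simp add: scale_right_diff_distrib)
qed

text \<open>For nonnegative exponents the two expansions of (x1 - x2)^l coincide, so
  \<open>bor\<close> is a power of x1 - x2 times the commutator. Through this, locality becomes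
  vanishing of \<open>bor\<close> for large \<open>l\<close>.\<close>

lemma bor_of_nat:
  assumes "quantum_field A" "quantum_field B"
  shows "(\<lambda>m n. bor A B (int N) m n v) = (dif ^^ N) (\<lambda>m n. A m (B n v) - B n (A m v))"
proof (induction N)
  case (Suc N)
  have "(\<lambda>m n. bor A B (int (Suc N)) m n v) = dif (\<lambda>m n. bor A B (int N) m n v)"
    using bor_step[OF assms, of "int N"] by (simp add: dif_def fun_eq_iff add.commute)
  then show ?case using Suc by simp
qed (simp add: bor_0)

section \<open>Locality, products of fields and the Borcherds identity\<close>

definition local :: "(int \<Rightarrow> 'b \<Rightarrow> 'b) \<Rightarrow> (int \<Rightarrow> 'b \<Rightarrow> 'b) \<Rightarrow> bool" where
  "local A B \<longleftrightarrow> (\<exists>N. \<forall>v. (dif ^^ N) (\<lambda>m n. A m (B n v) - B n (A m v)) = 0)"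

lemma local_sym:
  assumes "local A B" shows "local B A"
proof -
  obtain N where N: "\<And>v. (dif ^^ N) (\<lambda>m n. A m (B n v) - B n (A m v)) = 0"
    using assms by (auto simp: local_def)
  have "(dif ^^ N) (\<lambda>m n. B m (A n v) - A n (B m v)) = 0" for v
  proof -
    have "(dif ^^ N) (0 - (\<lambda>m n. A m (B n v) - B n (A m v))) = 0"
      by (simp only: funpow_dif_diff N funpow_dif_zero diff_self)
    from funpow_dif_swap[OF this] show ?thesis by (simp add: fun_diff_def)
  qed
  then show ?thesis unfolding local_def by blast
qed

lemma local_add:
  assumes "quantum_field C" "local A C" "local B C"
  shows "local (\<lambda>n v. A n v + B n v) C"
proof -
  obtain N M where N: "\<And>v. (dif ^^ N) (\<lambda>m n. A m (C n v) - C n (A m v)) = 0"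
     and M: "\<And>v. (dif ^^ M) (\<lambda>m n. B m (C n v) - C n (B m v)) = 0"
    using assms by (auto simp: local_def)
  have "(dif ^^ (N + M)) (\<lambda>m n. (A m (C n v) + B m (C n v)) - C n (A m v + B m v)) = 0" for v
  proof -
    have "(\<lambda>m n. (A m (C n v) + B m (C n v)) - C n (A m v + B m v))
      = (\<lambda>m n. A m (C n v) - C n (A m v)) + (\<lambda>m n. B m (C n v) - C n (B m v))"
      by (simp add: fun_eq_iff lin_add[OF qf_lin[OF assms(1)]])
    then show ?thesis
      by (simp only: funpow_dif_add funpow_dif_mono[OF N[of v], of "N + M", simplified]
          funpow_dif_mono[OF M[of v], of "N + M", simplified] add_0)
  qed
  then show ?thesis unfolding local_def by blast
qed

lemma bor_local_vanish:
  assumes "quantum_field A" "quantum_field B" "local A B"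
  shows "\<exists>N. \<forall>l m n v. N \<le> l \<longrightarrow> bor A B l m n v = 0"
proof -
  obtain N where N: "\<And>v. (dif ^^ N) (\<lambda>m n. A m (B n v) - B n (A m v)) = 0"
    using assms by (auto simp: local_def)
  have "bor A B l m n v = 0" if "int N \<le> l" for l m n v
  proof -
    have "(dif ^^ nat l) (\<lambda>m n. A m (B n v) - B n (A m v)) = 0"
      by (rule funpow_dif_mono[OF N]) (use that in simp)
    then show ?thesis
      using bor_of_nat[OF assms(1,2), of "nat l" v] that by (simp add: fun_eq_iff)
  qed
  then show ?thesis by blast
qed

text \<open>The usual \<open>l\<close>-th product of fields: m = 0 selects the coefficient of
  x1^(-1), that is, the residue in x1 of (x1 - x2)^l A(x1) B(x2) minus the oppositely expanded (x1 -
  x2)^l B(x2) A(x1).\<close>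

definition nprod :: "(int \<Rightarrow> 'b \<Rightarrow> 'b) \<Rightarrow> (int \<Rightarrow> 'b \<Rightarrow> 'b) \<Rightarrow> int \<Rightarrow> int \<Rightarrow> 'b \<Rightarrow> 'b" where
  "nprod A B l n v = bor A B l 0 n v"

text \<open>
  Both sides satisfy \<open>e (l + 1) m n = e l (m + 1) n - e l m (n + 1)\<close>, agree for \<open>m = 0\<close> by the
  definition of the products, and vanish for large \<open>l\<close> by locality; \<open>grid_zero\<close> applies to the difference.
\<close>

theorem borcherds_identity:
  assumes "quantum_field A" "quantum_field B" "local A B"
  shows "bor A B l m n v = Sum_any (\<lambda>i. (of_int m gchoose i) *s nprod A B (l + int i) (m + n - int i) v)"
proof -
  obtain N where N: "\<And>l m n v. N \<le> l \<Longrightarrow> bor A B l m n v = 0"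
    using bor_local_vanish[OF assms] by blast
  define R where "R l m n = Sum_any (\<lambda>i. (of_int m gchoose i) *s nprod A B (l + int i) (m + n - int i) v)"
    for l m n
  have R_sum: "R l m n = (\<Sum>i<K. (of_int m gchoose i) *s nprod A B (l + int i) (m + n - int i) v)"
    if "N \<le> l + int K" for l m n K
    unfolding R_def
  proof (rule Sum_any.expand_superset)
    show "{a. (of_int m gchoose a) *s nprod A B (l + int a) (m + n - int a) v \<noteq> 0} \<subseteq> {..<K}"
    proof
      fix a assume "a \<in> {a. (of_int m gchoose a) *s nprod A B (l + int a) (m + n - int a) v \<noteq> 0}"
      then have "\<not> N \<le> l + int a" using N by (auto simp: nprod_def)
      then show "a \<in> {..<K}" using that by simp
    qed
  qed simp
  have "bor A B l m n v - R l m n = 0"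
  proof (rule grid_zero[where e = "\<lambda>l m n. bor A B l m n v - R l m n" and N = N])
    fix l m n
    define K where "K = nat (N - l)"
    have K: "N \<le> l + int (Suc K)" "N \<le> (l + 1) + int K" by (auto simp: K_def)
    \<comment> \<open>The recursion for \<open>R\<close> is Pascal's rule in the upper entry of the
      binomial; the sum for l + 1 starts one product later and is one term shorter.\<close>
    have "R l (m + 1) n - R l m (n + 1) = R (l + 1) m n"
    proof -
      have idx: "l + int (Suc i) = l + 1 + int i" "m + 1 + n - int (Suc i) = m + n - int i"
        "m + (n + 1) - int (Suc i) = m + n - int i" for i by simp_all
      show ?thesis
        by (simp only: R_sum[OF K(1)] R_sum[OF K(2)] sum.lessThan_Suc_shift idx
            gbinomial_of_int_Suc scale_left_distrib sum.distrib)
           (simp add: ac_simps)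
    qed
    then have "R (l + 1) m n = R l (m + 1) n - R l m (n + 1)" by simp
    then show "bor A B (l + 1) m n v - R (l + 1) m n
       = bor A B l (m + 1) n v - R l (m + 1) n - (bor A B l m (n + 1) v - R l m (n + 1))"
      by (simp add: bor_step[OF assms(1,2)])
  next
    fix l n
    have "R l 0 n = Sum_any (\<lambda>i. if i = 0 then nprod A B (l + int i) (0 + n - int i) v else 0)"
      unfolding R_def by (rule Sum_any.cong) (auto simp: gr0_conv_Suc)
    then show "bor A B l 0 n v - R l 0 n = 0" by (simp add: nprod_def)
  next
    fix l m n assume "N \<le> l"
    then show "bor A B l m n v - R l m n = 0" using R_sum[of l 0 m n] by (simp add: N)
  qed
  then show ?thesis by (simp add: R_def)
qed

lemma lin_ser:
  assumes "\<And>v. tame (g v)" "\<And>m n. lin (\<lambda>v. g v m n)"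
  shows "lin (\<lambda>v. ser (g v) l m n)"
proof -
  have "ser (g (x + y)) l m n = ser (g x) l m n + ser (g y) l m n" for x y
  proof -
    have "g (x + y) = (\<lambda>m n. g x m n + g y m n)"
      using lin_add[OF assms(2)] by (simp add: fun_eq_iff)
    then show ?thesis using ser_add[OF assms(1) assms(1)] by simp
  qed
  moreover have "ser (g (c *s x)) l m n = c *s ser (g x) l m n" for c x
  proof -
    have "g (c *s x) = (\<lambda>m n. c *s g x m n)"
      using lin_scale[OF assms(2)] by (simp add: fun_eq_iff)
    then show ?thesis using ser_lin[OF assms(1) lin_smult[OF lin_id]] by simp
  qed
  ultimately show ?thesis by (simp add: lin_def)
qed

text \<open>For truncation: since the first index is fixed at 0, the reversed half only involves the
  finitely many vectors A_i v with 0 <= i < L, and one bound for B serves all of them.\<close>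

lemma qf_nprod:
  assumes "quantum_field A" "quantum_field B"
  shows "quantum_field (nprod A B l)"
  unfolding quantum_field_def
proof (intro conjI allI)
  fix n
  show "lin (nprod A B l n)"
  proof -
    have L: "lin (\<lambda>v. ser (\<lambda>m n. A m (B n v)) l m n)"
      if "quantum_field A" "quantum_field B" for A B m n
      by (rule lin_ser[of "\<lambda>v m n. A m (B n v)"])
         (rule tame_fields[OF that], rule lin_comp[OF qf_lin[OF that(1)] qf_lin[OF that(2)]])
    show ?thesis
      using lin_minus[OF L[OF assms] lin_smult[OF L[OF assms(2,1)]]]
      by (simp add: nprod_def[abs_def] bor_def)
  qed
next
  fix v
  obtain M where M: "\<And>n. M \<le> n \<Longrightarrow> B n v = 0" using qf_trunc[OF assms(2)] by blast
  obtain L where L: "\<And>n. L \<le> n \<Longrightarrow> A n v = 0" using qf_trunc[OF assms(1)] by blast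
  have "\<exists>N. \<forall>n\<ge>N. \<forall>i<k. B n (A (int i) v) = 0" for k
  proof (induction k)
    case (Suc k)
    then obtain N where "\<And>n i. N \<le> n \<Longrightarrow> i < k \<Longrightarrow> B n (A (int i) v) = 0" by blast
    moreover obtain N' where "\<And>n. N' \<le> n \<Longrightarrow> B n (A (int k) v) = 0" using qf_trunc[OF assms(2)] by blast
    ultimately show ?case by (intro exI[of _ "max N N'"]) (auto simp: less_Suc_eq)
  qed auto
  then obtain N where N: "\<And>n i. N \<le> n \<Longrightarrow> i < nat L \<Longrightarrow> B n (A (int i) v) = 0" by blast
  \<comment> \<open>The modes of B in the reversed half have index n + l - i with i below
    \<open>nat L\<close>, which explains the shift of the bound by \<open>nat L\<close> and
    \<open>l\<close>.\<close>
  have "nprod A B l n v = 0" if n: "max M (N + nat L - l) \<le> n" for n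
  proof -
    have "ser (\<lambda>m n. A m (B n v)) l 0 n = 0"
      using ser_eq_sum[of M "\<lambda>m n. A m (B n v)" n 0 l 0] n assms M by simp
    moreover have "ser (\<lambda>n m. B n (A m v)) l n 0
        = (\<Sum>i<nat L. binc l i *s B (n + l - int i) (A (0 + int i) v))"
      by (rule ser_eq_sum[of L]) (auto simp: L assms)
    moreover have "B (n + l - int i) (A (0 + int i) v) = 0" if "i < nat L" for i
    proof -
      have "N + int (nat L) - l \<le> n" using n by (rule max.boundedE)
      then have "N \<le> n + l - int i" using that by linarith
      from N[OF this that] show ?thesis by simp
    qed
    ultimately show ?thesis by (simp add: nprod_def bor_def)
  qed
  then show "\<exists>N. \<forall>n\<ge>N. nprod A B l n v = 0" by blast
qed

lemma bor_commutes:
  assumes "quantum_field A" "quantum_field B" "lin f"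
    and "\<And>n v. f (A n v) = A n (f v)" "\<And>n v. f (B n v) = B n (f v)"
  shows "f (bor A B l m n v) = bor A B l m n (f v)"
  using ser_lin[OF tame_fields[OF assms(1,2)] assms(3), of v l m n]
    ser_lin[OF tame_fields[OF assms(2,1)] assms(3), of v l n m]
  by (simp add: bor_def lin_diff[OF assms(3)] lin_scale[OF assms(3)] assms(4,5))

text \<open>Both halves follow from \<open>ser_derivation\<close>; the derivative in x1 carries the
  factor m and disappears at m = 0, so [D, A(x)] = A'(x) passes to products.\<close>

lemma nprod_derivation:
  assumes "quantum_field A" "quantum_field B" "lin D"
    and DA: "\<And>n v. D (A n v) = A n (D v) - of_int n *s A (n - 1) v"
    and DB: "\<And>n v. D (B n v) = B n (D v) - of_int n *s B (n - 1) v"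
  shows "D (nprod A B l n v) = nprod A B l n (D v) - of_int n *s nprod A B l (n - 1) v"
proof -
  have *: "D (ser (\<lambda>m n. A m (B n v)) l m n) = ser (\<lambda>m n. A m (B n (D v))) l m n
      - (of_int m *s ser (\<lambda>m n. A m (B n v)) l (m - 1) n + of_int n *s ser (\<lambda>m n. A m (B n v)) l m (n - 1))"
    if A: "quantum_field A" and B: "quantum_field B"
    and DA: "\<And>n v. D (A n v) = A n (D v) - of_int n *s A (n - 1) v"
    and DB: "\<And>n v. D (B n v) = B n (D v) - of_int n *s B (n - 1) v" for A B m n
  proof -
    have t: "tame (\<lambda>m n. of_int m *s A (m - 1) (B n v) + of_int n *s A m (B (n - 1) v))"
    proof -
      obtain N where N: "\<And>n. N \<le> n \<Longrightarrow> B n v = 0" using qf_trunc[OF B] by blast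
      then show ?thesis unfolding tame_def by (intro exI[of _ "N + 1"]) (simp add: A)
    qed
    have "D (ser (\<lambda>m n. A m (B n v)) l m n) = ser (\<lambda>m n. D (A m (B n v))) l m n"
      by (rule ser_lin[OF tame_fields[OF A B] assms(3), symmetric])
    also have "(\<lambda>m n. D (A m (B n v))) = (\<lambda>m n. A m (B n (D v))
       - (of_int m *s A (m - 1) (B n v) + of_int n *s A m (B (n - 1) v)))"
      by (simp add: fun_eq_iff DA DB lin_diff[OF qf_lin[OF A]] lin_scale[OF qf_lin[OF A]] algebra_simps)
    also have "ser \<dots> l m n = ser (\<lambda>m n. A m (B n (D v))) l m n
       - ser (\<lambda>m n. of_int m *s A (m - 1) (B n v) + of_int n *s A m (B (n - 1) v)) l m n"
      by (rule ser_diff[OF tame_fields[OF A B] t])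
    finally show ?thesis
      by (simp only: ser_derivation[OF tame_fields[OF A B], of v l m n])
  qed
  show ?thesis
    unfolding nprod_def bor_def lin_diff[OF assms(3)] lin_scale[OF assms(3)]
      *[of A B 0 n, OF assms(1,2) DA DB] *[of B A n 0, OF assms(2,1) DB DA]
    by (simp add: scale_right_diff_distrib mult.commute)
qed

text \<open>The reversed half vanishes because A_i v = 0 for i >= 0. In the other half only B_(n+i)
  v with n + i < 0 survives, which leaves nothing for n >= 0 and the single term i = 0 for n = -1.
  So the state of the product is \<open>A l\<close> applied to the state of B.\<close>

lemma nprod_vacuum:
  assumes "quantum_field A" "quantum_field B"
    and A: "\<And>n. 0 \<le> n \<Longrightarrow> A n v = 0" and B: "\<And>n. 0 \<le> n \<Longrightarrow> B n v = 0"
  shows "0 \<le> n \<Longrightarrow> nprod A B l n v = 0" "nprod A B l (-1) v = A l (B (-1) v)"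
proof -
  have 1: "ser (\<lambda>n m. B n (A m v)) l n 0 = 0" for n
    using ser_eq_sum[of 0 "\<lambda>n m. B n (A m v)" 0 0 l n] A assms(2) by simp
  have 2: "ser (\<lambda>m n. A m (B n v)) l 0 n = 0" if "0 \<le> n" for n
    using ser_eq_sum[of 0 "\<lambda>m n. A m (B n v)" n 0 l 0] B assms(1) that by simp
  have 3: "ser (\<lambda>m n. A m (B n v)) l 0 (-1) = A l (B (-1) v)"
    using ser_eq_sum[of 0 "\<lambda>m n. A m (B n v)" "-1" 1 l 0] B assms(1) by simp
  show "0 \<le> n \<Longrightarrow> nprod A B l n v = 0" "nprod A B l (-1) v = A l (B (-1) v)"
    using 1 2 3 by (auto simp: nprod_def bor_def)
qed

lemma subspace_ser:
  assumes "subspace W" "\<And>m n. g m n \<in> W"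
  shows "ser g l m n \<in> W"
  unfolding ser_def Sum_any.expand_set
  by (intro subspace_sum subspace_scale assms)

lemma subspace_nprod:
  assumes "subspace W" "\<And>n v. v \<in> W \<Longrightarrow> A n v \<in> W" "\<And>n v. v \<in> W \<Longrightarrow> B n v \<in> W" "v \<in> W"
  shows "nprod A B l n v \<in> W"
  unfolding nprod_def bor_def
  by (intro subspace_diff subspace_scale subspace_ser assms)

text \<open>
  The idea of Dong's lemma: with three variables put \<open>S = x\<^sub>2 - x\<^sub>3\<close>, \<open>U = x\<^sub>1 - x\<^sub>3\<close>, \<open>T = x\<^sub>1 - x\<^sub>2\<close>; the
  commutator of \<open>(x\<^sub>1 - x\<^sub>2)\<^sup>l\<close>-weighted products of \<open>A(x\<^sub>1)\<close>, \<open>B(x\<^sub>2)\<close> with \<open>C(x\<^sub>3)\<close> is killed by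
  \<open>S\<^sup>N U\<^sup>N\<close> and by a power of \<open>T = U - S\<close>, hence by a power of \<open>S\<close>.
\<close>

definition opS :: "(int \<Rightarrow> int \<Rightarrow> int \<Rightarrow> 'b) \<Rightarrow> int \<Rightarrow> int \<Rightarrow> int \<Rightarrow> 'b" where
  "opS \<phi> m n k = \<phi> m (n + 1) k - \<phi> m n (k + 1)"
definition opU :: "(int \<Rightarrow> int \<Rightarrow> int \<Rightarrow> 'b) \<Rightarrow> int \<Rightarrow> int \<Rightarrow> int \<Rightarrow> 'b" where
  "opU \<phi> m n k = \<phi> (m + 1) n k - \<phi> m n (k + 1)"
definition opT :: "(int \<Rightarrow> int \<Rightarrow> int \<Rightarrow> 'b) \<Rightarrow> int \<Rightarrow> int \<Rightarrow> int \<Rightarrow> 'b" where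
  "opT \<phi> m n k = \<phi> (m + 1) n k - \<phi> m (n + 1) k"

lemma funpow_opS: "(opS ^^ N) \<phi> m = (dif ^^ N) (\<phi> m)"
proof (induction N arbitrary: m)
  case (Suc N)
  have "opS \<psi> m = dif (\<psi> m)" for \<psi> by (simp add: opS_def dif_def fun_eq_iff)
  then show ?case using Suc by simp
qed simp

lemma funpow_opU: "(opU ^^ N) \<phi> m n k = (dif ^^ N) (\<lambda>m k. \<phi> m n k) m k"
proof (induction N arbitrary: m n k)
  case (Suc N)
  show ?case
    by (simp only: funpow.simps comp_apply opU_def[of "(opU ^^ N) \<phi>"] dif_def[of "(dif ^^ N) _"] Suc)
qed simp

lemma opS_diff: "opS (\<phi> - \<psi>) = opS \<phi> - opS \<psi>"
  and opU_diff: "opU (\<phi> - \<psi>) = opU \<phi> - opU \<psi>"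
  and opS_add: "opS (\<phi> + \<psi>) = opS \<phi> + opS \<psi>"
  and opU_add: "opU (\<phi> + \<psi>) = opU \<phi> + opU \<psi>"
  and opS_0: "opS 0 = 0" and opU_0: "opU 0 = 0" and opT_0: "opT 0 = 0"
  by (simp_all add: opS_def opU_def opT_def fun_eq_iff algebra_simps)

lemma funpow_op_0: "(opS ^^ N) 0 = 0" "(opU ^^ N) 0 = 0"
  by (induction N) (simp_all only: funpow.simps comp_apply id_apply opS_0 opU_0)

lemma funpow_op_diff:
  "(opS ^^ N) (\<phi> - \<psi>) = (opS ^^ N) \<phi> - (opS ^^ N) \<psi>"
  "(opU ^^ N) (\<phi> - \<psi>) = (opU ^^ N) \<phi> - (opU ^^ N) \<psi>"
  by (induction N) (simp_all only: funpow.simps comp_apply id_apply opS_diff opU_diff)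

lemma funpow_op_add:
  "(opS ^^ N) (\<phi> + \<psi>) = (opS ^^ N) \<phi> + (opS ^^ N) \<psi>"
  "(opU ^^ N) (\<phi> + \<psi>) = (opU ^^ N) \<phi> + (opU ^^ N) \<psi>"
  by (induction N) (simp_all only: funpow.simps comp_apply id_apply opS_add opU_add)

lemma opS_opU: "opS (opU \<phi>) = opU (opS \<phi>)"
  and opS_opT: "opS (opT \<phi>) = opT (opS \<phi>)"
  and opT_opU: "opT (opU \<phi>) = opU (opT \<phi>)"
  by (simp_all add: opS_def opU_def opT_def fun_eq_iff algebra_simps)

lemma funpow_opS_opU: "(opS ^^ N) (opU \<phi>) = opU ((opS ^^ N) \<phi>)"
  by (induction N) (simp_all add: opS_opU)

lemma funpow_opS_funpow_opU: "(opS ^^ N) ((opU ^^ M) \<phi>) = (opU ^^ M) ((opS ^^ N) \<phi>)"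
  by (induction M) (simp_all add: funpow_opS_opU)

text \<open>Multiplication by (x1 - x2)^l with x3 as a parameter; it commutes with multiplication by
  x2 - x3 and by x1 - x3.\<close>

definition ser3 :: "int \<Rightarrow> (int \<Rightarrow> int \<Rightarrow> int \<Rightarrow> 'b) \<Rightarrow> int \<Rightarrow> int \<Rightarrow> int \<Rightarrow> 'b" where
  "ser3 l g m n k = ser (\<lambda>m n. g m n k) l m n"

definition tame3 :: "(int \<Rightarrow> int \<Rightarrow> int \<Rightarrow> 'b) \<Rightarrow> bool" where
  "tame3 g \<longleftrightarrow> (\<forall>k. tame (\<lambda>m n. g m n k))"

lemma tame_shift: "tame g \<Longrightarrow> tame (\<lambda>m n. g m (n + 1))" "tame g \<Longrightarrow> tame (\<lambda>m n. g (m + 1) n)"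
  unfolding tame_def by (meson add_increasing2 zero_le_one)+

lemma tame_diff: "tame g \<Longrightarrow> tame h \<Longrightarrow> tame (\<lambda>m n. g m n - h m n)"
  using tame_add[of g "\<lambda>m n. - h m n"] tame_lin[of h uminus] by (simp add: lin_def)

lemma tame3_opS: "tame3 g \<Longrightarrow> tame3 (opS g)"
  and tame3_opU: "tame3 g \<Longrightarrow> tame3 (opU g)"
  unfolding tame3_def opS_def opU_def by (intro allI tame_diff tame_shift; blast)+

lemma ser3_opS: "tame3 g \<Longrightarrow> ser3 l (opS g) = opS (ser3 l g)"
proof -
  assume "tame3 g"
  then have g: "tame (\<lambda>m n. g m n k)" for k by (simp add: tame3_def)
  have "ser (\<lambda>m n. g m (n + 1) k - g m n (k + 1)) l m n
      = ser (\<lambda>m n. g m n k) l m (n + 1) - ser (\<lambda>m n. g m n (k + 1)) l m n" for m n k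
    using ser_diff[OF tame_shift(1)[OF g[of k]] g[of "k + 1"]] ser_shift2[of "\<lambda>m n. g m n k"] by simp
  then show ?thesis by (simp add: fun_eq_iff ser3_def opS_def)
qed

lemma ser3_opU: "tame3 g \<Longrightarrow> ser3 l (opU g) = opU (ser3 l g)"
proof -
  assume "tame3 g"
  then have g: "tame (\<lambda>m n. g m n k)" for k by (simp add: tame3_def)
  have "ser (\<lambda>m n. g (m + 1) n k - g m n (k + 1)) l m n
      = ser (\<lambda>m n. g m n k) l (m + 1) n - ser (\<lambda>m n. g m n (k + 1)) l m n" for m n k
    using ser_diff[OF tame_shift(2)[OF g[of k]] g[of "k + 1"]] ser_shift1[of "\<lambda>m n. g m n k"] by simp
  then show ?thesis by (simp add: fun_eq_iff ser3_def opU_def)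
qed

lemma ser3_funpow: "tame3 g \<Longrightarrow> ser3 l ((opS ^^ N) g) = (opS ^^ N) (ser3 l g)"
  "tame3 g \<Longrightarrow> ser3 l ((opU ^^ N) g) = (opU ^^ N) (ser3 l g)"
proof -
  assume g: "tame3 g"
  have "tame3 ((opS ^^ N) g) \<and> ser3 l ((opS ^^ N) g) = (opS ^^ N) (ser3 l g)" for N
    by (induction N) (auto simp: g tame3_opS ser3_opS)
  moreover have "tame3 ((opU ^^ N) g) \<and> ser3 l ((opU ^^ N) g) = (opU ^^ N) (ser3 l g)" for N
    by (induction N) (auto simp: g tame3_opU ser3_opU)
  ultimately show "ser3 l ((opS ^^ N) g) = (opS ^^ N) (ser3 l g)"
    "ser3 l ((opU ^^ N) g) = (opU ^^ N) (ser3 l g)" by auto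
qed

lemma ser3_0: "ser3 l 0 = 0"
  by (simp add: fun_eq_iff ser3_def ser_def)

text \<open>Each summand is annihilated by one of the commuting factors (x2 - x3)^N and (x1 - x3)^N,
  and multiplication by (x1 - x2)^l respects this.\<close>

lemma ser3_killed:
  assumes "tame3 g" "tame3 h" "(opS ^^ N) g = 0" "(opU ^^ N) h = 0"
  shows "(opS ^^ N) ((opU ^^ N) (ser3 l (g + h))) = 0"
proof -
  have "ser3 l (g + h) = ser3 l g + ser3 l h"
    using assms(1,2) by (simp add: fun_eq_iff ser3_def tame3_def ser_add)
  moreover have "(opS ^^ N) ((opU ^^ N) (ser3 l g)) = 0"
    unfolding funpow_opS_funpow_opU
    by (simp only: ser3_funpow(1)[OF assms(1), symmetric] assms(3) ser3_0 funpow_op_0)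
  moreover have "(opS ^^ N) ((opU ^^ N) (ser3 l h)) = 0"
    by (simp only: ser3_funpow(2)[OF assms(2), symmetric] assms(4) ser3_0 funpow_op_0)
  ultimately show ?thesis by (simp only: funpow_op_add add_0)
qed

text \<open>The reversed half of \<open>bor\<close> is a series with x1 and x2 exchanged; the
  exchange interchanges \<open>opS\<close> and \<open>opU\<close>.\<close>

lemma opS_swap: "opS (\<lambda>m n k. \<phi> n m k) = (\<lambda>m n k. opU \<phi> n m k)"
  and opU_swap: "opU (\<lambda>m n k. \<phi> n m k) = (\<lambda>m n k. opS \<phi> n m k)"
  by (simp_all add: opS_def opU_def fun_eq_iff)

lemma funpow_opS_swap: "(opS ^^ N) (\<lambda>m n k. \<phi> n m k) = (\<lambda>m n k. (opU ^^ N) \<phi> n m k)"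
  by (induction N) (simp_all add: opS_swap)

lemma funpow_opU_swap: "(opU ^^ N) (\<lambda>m n k. \<phi> n m k) = (\<lambda>m n k. (opS ^^ N) \<phi> n m k)"
  by (induction N) (simp_all add: opU_swap)

theorem dong:
  assumes A: "quantum_field A" and B: "quantum_field B" and C: "quantum_field C"
    and "local A B" "local A C" "local B C"
  shows "local (nprod A B l) C"
proof -
  obtain N1 where N1: "\<And>l m n v. N1 \<le> l \<Longrightarrow> bor A B l m n v = 0"
    using bor_local_vanish[OF A B \<open>local A B\<close>] by blast
  obtain N2 N3 where N2: "\<And>v. (dif ^^ N2) (\<lambda>m n. A m (C n v) - C n (A m v)) = 0"
     and N3: "\<And>v. (dif ^^ N3) (\<lambda>m n. B m (C n v) - C n (B m v)) = 0"
    using assms by (auto simp: local_def)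
  define N where "N = max N2 N3"
  have AC: "(dif ^^ N) (\<lambda>m n. A m (C n v) - C n (A m v)) = 0"
   and BC: "(dif ^^ N) (\<lambda>m n. B m (C n v) - C n (B m v)) = 0" for v
    using funpow_dif_mono[OF N2] funpow_dif_mono[OF N3] by (auto simp: N_def)
  \<comment> \<open>\<open>opT ^^ d\<close> raises the exponent of x1 - x2 from \<open>l\<close> to
    at least \<open>N1\<close>, where locality of A and B makes \<open>bor\<close> vanish.\<close>
  define d where "d = nat (N1 - l)"
  have "(dif ^^ (N + N + d)) (\<lambda>n k. nprod A B l n (C k v) - C k (nprod A B l n v)) = 0" for v
  proof -
    define G where "G l m n k = bor A B l m n (C k v) - C k (bor A B l m n v)" for l m n k
    have G_step: "opT (G l) = G (l + 1)" for l
      by (simp add: fun_eq_iff opT_def G_def bor_step[OF A B] lin_diff[OF qf_lin[OF C]])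
    have G_funpow: "(opT ^^ j) (G l) = G (l + int j)" for j
      by (induction j) (auto simp: G_step algebra_simps)
    have Td: "(opT ^^ d) (G l) = 0"
      unfolding G_funpow using N1 C by (simp add: fun_eq_iff G_def d_def)
    have lin_comm_zero: "(dif ^^ N) (\<lambda>n k. f (\<phi> n k)) = 0" if "lin f" "(dif ^^ N) \<phi> = 0" for f \<phi>
    proof -
      have "(dif ^^ N) (\<lambda>n k. f (\<phi> n k)) = (\<lambda>n k. f ((dif ^^ N) \<phi> n k))"
        by (induction N) (auto simp: dif_def lin_diff[OF that(1)] fun_eq_iff)
      then show ?thesis using that by (simp add: fun_eq_iff lin_zero)
    qed
    \<comment> \<open>Split [A B, C] = A [B, C] + [A, C] B: the first summand (\<open>g\<close>) is
      killed by (x2 - x3)^N, the second (\<open>h\<close>) by (x1 - x3)^N.\<close>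
    have killed: "(opS ^^ N) ((opU ^^ N) (ser3 l (\<lambda>m n k. A m (B n (C k v)) - C k (A m (B n v))))) = 0"
      if A: "quantum_field A" and B: "quantum_field B"
      and AC: "\<And>v. (dif ^^ N) (\<lambda>m n. A m (C n v) - C n (A m v)) = 0"
      and BC: "\<And>v. (dif ^^ N) (\<lambda>m n. B m (C n v) - C n (B m v)) = 0" for A B
    proof -
      define g where "g m n k = A m (B n (C k v) - C k (B n v))" for m n k
      define h where "h m n k = A m (C k (B n v)) - C k (A m (B n v))" for m n k
      have "(\<lambda>m n k. A m (B n (C k v)) - C k (A m (B n v))) = g + h"
        by (simp add: fun_eq_iff g_def h_def lin_diff[OF qf_lin[OF A]])
      moreover have "tame3 g"
        unfolding tame3_def g_def
      proof (intro allI)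
        fix k
        obtain N N' where "\<And>n. N \<le> n \<Longrightarrow> B n (C k v) = 0" "\<And>n. N' \<le> n \<Longrightarrow> B n v = 0"
          using qf_trunc[OF B] by meson
        then show "tame (\<lambda>m n. A m (B n (C k v) - C k (B n v)))"
          unfolding tame_def by (intro exI[of _ "max N N'"]) (simp add: A C)
      qed
      moreover have "tame3 h"
        unfolding tame3_def h_def
      proof (intro allI)
        fix k
        obtain N where "\<And>n. N \<le> n \<Longrightarrow> B n v = 0"
          using qf_trunc[OF B] by meson
        then show "tame (\<lambda>m n. A m (C k (B n v)) - C k (A m (B n v)))"
          unfolding tame_def by (intro exI[of _ N]) (simp add: A C)
      qed
      moreover have "(opS ^^ N) g = 0"
      proof -
        have "(opS ^^ N) g m = 0" for m
          unfolding funpow_opS g_def by (rule lin_comm_zero[OF qf_lin[OF A] BC])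
        then show ?thesis by (simp add: fun_eq_iff)
      qed
      moreover have "(opU ^^ N) h = 0"
      proof -
        have "(opU ^^ N) h m n k = 0" for m n k
          unfolding funpow_opU h_def using AC[of "B n v"] by (simp add: fun_eq_iff)
        then show ?thesis by (simp add: fun_eq_iff)
      qed
      ultimately show ?thesis using ser3_killed by simp
    qed
    define g where "g m n k = A m (B n (C k v)) - C k (A m (B n v))" for m n k
    define h where "h n m k = B n (A m (C k v)) - C k (B n (A m v))" for m n k
    have tg: "tame (\<lambda>m n. A m (B n (C k v)))" "tame (\<lambda>m n. C k (A m (B n v)))"
        "tame (\<lambda>m n. B m (A n (C k v)))" "tame (\<lambda>m n. C k (B m (A n v)))" for k
      using tame_fields[OF A B] tame_fields[OF B A] tame_lin[OF _ qf_lin[OF C]] by auto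
    have G_eq: "G l = ser3 l g - (\<lambda>m n k. (-1) powi l *s ser3 l h n m k)"
      by (simp add: fun_eq_iff G_def bor_def ser3_def g_def h_def ser_diff tg
          ser_lin[OF tame_fields[OF A B] qf_lin[OF C]] ser_lin[OF tame_fields[OF B A] qf_lin[OF C]]
          lin_diff[OF qf_lin[OF C]] lin_scale[OF qf_lin[OF C]] scale_right_diff_distrib)
    have 1: "(opS ^^ N) ((opU ^^ N) (ser3 l g)) = 0"
      unfolding g_def by (rule killed[OF A B AC BC])
    have 2: "(opS ^^ N) ((opU ^^ N) (\<lambda>m n k. (-1) powi l *s ser3 l h n m k)) = 0"
    proof -
      let ?c = "(-1) powi l :: 'a"
      have h: "(opS ^^ N) ((opU ^^ N) (ser3 l h)) = 0"
        unfolding h_def by (rule killed[OF B A BC AC])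
      have s: "(opS ^^ M) (\<lambda>m n k. ?c *s \<phi> m n k) = (\<lambda>m n k. ?c *s (opS ^^ M) \<phi> m n k)"
         "(opU ^^ M) (\<lambda>m n k. ?c *s \<phi> m n k) = (\<lambda>m n k. ?c *s (opU ^^ M) \<phi> m n k)" for M \<phi>
        by (induction M) (auto simp: opS_def opU_def fun_eq_iff scale_right_diff_distrib)
      have "(opS ^^ N) ((opU ^^ N) (\<lambda>m n k. ?c *s ser3 l h n m k))
          = (\<lambda>m n k. ?c *s (opU ^^ N) ((opS ^^ N) (ser3 l h)) n m k)"
        by (simp only: s(2)[of N "\<lambda>m n k. ser3 l h n m k"] funpow_opU_swap[of N "ser3 l h"]
            s(1)[of N "\<lambda>m n k. (opS ^^ N) (ser3 l h) n m k"] funpow_opS_swap[of N "(opS ^^ N) (ser3 l h)"])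
      also have "\<dots> = 0"
        using h by (simp add: funpow_opS_funpow_opU fun_eq_iff)
      finally show ?thesis .
    qed
    have "(opS ^^ N) ((opU ^^ N) (G l)) = 0"
      by (simp only: G_eq funpow_op_diff 1 2 diff_self)
    then have "(opS ^^ (N + N + d)) (G l) = 0"
      by (rule commuting_funpow_zero[OF _ opS_diff opS_opU opS_opT opT_opU opU_0 opT_0 _ Td, rotated])
         (simp add: opS_def opU_def opT_def fun_eq_iff)
    \<comment> \<open>At first index 0 the array \<open>G l\<close> is the commutator of the product
      with C, and \<open>opS\<close> acts on the remaining indices as \<open>dif\<close>.\<close>
    then have "(dif ^^ (N + N + d)) (G l 0) = 0"
      using funpow_opS[of "N + N + d" "G l" 0] by simp
    moreover have "(\<lambda>n k. nprod A B l n (C k v) - C k (nprod A B l n v)) = G l 0"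
      by (simp add: fun_eq_iff G_def nprod_def)
    ultimately show ?thesis by (simp only:)
  qed
  then show ?thesis unfolding local_def by blast
qed

text \<open>Locality gives (x1 - x2)^N A(x1) B(x2) v = (x1 - x2)^N B(x2) A(x1) v = 0. Since B(x2) v
  has no negative powers of x2, setting x2 = 0 leaves x1^N A(x1) B_(-1) v = 0.\<close>

lemma goddard:
  assumes A: "quantum_field A" and B: "quantum_field B" and "local A B"
    and "\<And>n. A n v = 0" and Bv: "\<And>n. 0 \<le> n \<Longrightarrow> B n v = 0"
  shows "A m (B (-1) v) = 0"
proof -
  obtain N where N: "(dif ^^ N) (\<lambda>m n. A m (B n v) - B n (A m v)) = 0"
    using \<open>local A B\<close> by (auto simp: local_def)
  \<comment> \<open>The value at x2 = 0 is the coefficient with n = -1; there multiplication by (x1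
    - x2)^N reduces to the shift of \<open>m\<close> by N.\<close>
  have "(\<forall>m n. 0 \<le> n \<longrightarrow> (dif ^^ N) \<phi> m n = 0) \<and> (\<forall>m. (dif ^^ N) \<phi> m (-1) = \<phi> (m + int N) (-1))"
    if "\<And>m n. 0 \<le> n \<Longrightarrow> \<phi> m n = 0" for \<phi> :: "int \<Rightarrow> int \<Rightarrow> 'b"
    by (induction N) (use that in \<open>auto simp: dif_def algebra_simps\<close>)
  from this[of "\<lambda>m n. A m (B n v) - B n (A m v)"] N assms
  have "\<And>m. A (m + int N) (B (-1) v) = 0" by (simp add: fun_eq_iff)
  from this[of "m - int N"] show ?thesis by simp
qed

end

section \<open>The vertex operators generated by a family of local fields\<close>

text \<open>The fields act on a whole type, the states form the subspace \<open>W\<close>.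
  \<open>Ks\<close> holds operators commuting with every generator, later multiplication by elements
  of C((z)). In \<open>generated\<close>, scalar multiples are meant to be reached as modes of
  generators.\<close>

locale field_system = vector_space_char_0 scale
  for scale :: "'a::field_char_0 \<Rightarrow> 'b::ab_group_add \<Rightarrow> 'b" (infixr \<open>*s\<close> 75) +
  fixes gen :: "(int \<Rightarrow> 'b \<Rightarrow> 'b) set" and W :: "'b set" and vac :: 'b
    and D :: "'b \<Rightarrow> 'b" and Ks :: "('b \<Rightarrow> 'b) set"
  assumes gen_field: "g \<in> gen \<Longrightarrow> quantum_field g"
    and gen_local: "g \<in> gen \<Longrightarrow> h \<in> gen \<Longrightarrow> local g h"
    and gen_vac: "g \<in> gen \<Longrightarrow> 0 \<le> n \<Longrightarrow> g n vac = 0"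
    and gen_W: "g \<in> gen \<Longrightarrow> v \<in> W \<Longrightarrow> g n v \<in> W"
    and gen_D: "g \<in> gen \<Longrightarrow> D (g n v) = g n (D v) - of_int n *s g (n - 1) v"
    and gen_K: "g \<in> gen \<Longrightarrow> f \<in> Ks \<Longrightarrow> f (g n v) = g n (f v)"
    and W_subspace: "subspace W" and vac_W: "vac \<in> W"
    and D_lin: "lin D" and D_vac: "D vac = 0"
    and K_lin: "f \<in> Ks \<Longrightarrow> lin f"
    and generated: "vac \<in> X \<Longrightarrow> (\<And>x y. x \<in> X \<Longrightarrow> y \<in> X \<Longrightarrow> x + y \<in> X) \<Longrightarrow>
      (\<And>g n x. g \<in> gen \<Longrightarrow> x \<in> X \<Longrightarrow> g n x \<in> X) \<Longrightarrow> W \<subseteq> X"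
begin

definition idf :: "int \<Rightarrow> 'b \<Rightarrow> 'b" where
  "idf n v = (if n = -1 then v else 0)"

text \<open>Those properties of generators that concern one field at a time and pass to sums and
  products; locality, a relation between two fields, is treated apart.\<close>

definition good :: "(int \<Rightarrow> 'b \<Rightarrow> 'b) \<Rightarrow> bool" where
  "good A \<longleftrightarrow> quantum_field A \<and> (\<forall>n\<ge>0. A n vac = 0) \<and> (\<forall>n. \<forall>v\<in>W. A n v \<in> W)
     \<and> (\<forall>n v. D (A n v) = A n (D v) - of_int n *s A (n - 1) v) \<and> (\<forall>f\<in>Ks. \<forall>n v. f (A n v) = A n (f v))"

lemma good_idf: "good idf"
  unfolding good_def
proof (intro conjI allI ballI impI)
  show "quantum_field idf"
    unfolding quantum_field_def
  proof (intro conjI allI)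
    show "\<exists>N. \<forall>n\<ge>N. idf n v = 0" for v by (intro exI[of _ 0]) (simp add: idf_def)
  qed (simp add: idf_def lin_def)
qed (auto simp: idf_def subspace_0[OF W_subspace] lin_zero[OF D_lin] lin_zero[OF K_lin])

lemma good_gen: "g \<in> gen \<Longrightarrow> good g"
  unfolding good_def using gen_field gen_vac gen_W gen_D gen_K by auto

lemma good_field: "good A \<Longrightarrow> quantum_field A"
  by (simp add: good_def)

lemma good_vac: "good A \<Longrightarrow> 0 \<le> n \<Longrightarrow> A n vac = 0"
  by (simp add: good_def)

lemma good_W: "good A \<Longrightarrow> v \<in> W \<Longrightarrow> A n v \<in> W"
  by (simp add: good_def)

lemma good_nprod: "good A \<Longrightarrow> good B \<Longrightarrow> good (nprod A B l)"
  unfolding good_def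
  by (auto simp: qf_nprod nprod_vacuum D_lin nprod_derivation subspace_nprod[OF W_subspace])
     (simp add: nprod_def bor_commutes K_lin)

lemma good_add: "good A \<Longrightarrow> good B \<Longrightarrow> good (\<lambda>n v. A n v + B n v)"
  unfolding good_def
proof (elim conjE, intro conjI allI ballI impI)
  assume A: "quantum_field A" and B: "quantum_field B"
  show "quantum_field (\<lambda>n v. A n v + B n v)"
    unfolding quantum_field_def
  proof (intro conjI allI)
    fix v
    obtain N N' where "\<And>n. N \<le> n \<Longrightarrow> A n v = 0" "\<And>n. N' \<le> n \<Longrightarrow> B n v = 0"
      using qf_trunc[OF A] qf_trunc[OF B] by meson
    then show "\<exists>N. \<forall>n\<ge>N. A n v + B n v = 0" by (intro exI[of _ "max N N'"]) auto
  qed (intro lin_plus qf_lin A B)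
qed (auto simp: subspace_add[OF W_subspace] lin_add[OF D_lin] lin_add[OF K_lin] algebra_simps)

lemma local_idf: "quantum_field A \<Longrightarrow> local idf A"
  unfolding local_def
  by (intro exI[of _ 0]) (simp add: idf_def fun_eq_iff)

text \<open>
  Left products by generators suffice to reach every state; that all products stay in the family
  up to equality on \<open>W\<close> is a consequence of \<open>field_determined\<close>.
\<close>

inductive_set FF :: "(int \<Rightarrow> 'b \<Rightarrow> 'b) set" where
  FF_id: "idf \<in> FF"
| FF_prod: "g \<in> gen \<Longrightarrow> A \<in> FF \<Longrightarrow> nprod g A l \<in> FF"
| FF_add: "A \<in> FF \<Longrightarrow> B \<in> FF \<Longrightarrow> (\<lambda>n v. A n v + B n v) \<in> FF"

lemma FF_good: "A \<in> FF \<Longrightarrow> good A"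
  by (induction rule: FF.induct) (auto intro: good_idf good_nprod good_gen good_add)

text \<open>Dong's lemma makes a product local to C once its factors are local to C and to each
  other. Locality is therefore spread in two inductions: members of \<open>FF\<close> against
  generators here, then members of \<open>FF\<close> against each other.\<close>

lemma FF_local_gen: "A \<in> FF \<Longrightarrow> g \<in> gen \<Longrightarrow> local A g"
proof (induction arbitrary: g rule: FF.induct)
  case FF_id
  then show ?case by (simp add: local_idf gen_field)
next
  case (FF_prod h A l)
  show ?case
    by (rule dong[OF gen_field[OF FF_prod(1)] good_field[OF FF_good[OF FF_prod(2)]] gen_field[OF FF_prod(4)]
          local_sym[OF FF_prod(3)[OF FF_prod(1)]] gen_local[OF FF_prod(1,4)] FF_prod(3)[OF FF_prod(4)]])
next
  case (FF_add A B)
  then show ?case by (intro local_add gen_field) auto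
qed

lemma FF_local: "A \<in> FF \<Longrightarrow> C \<in> FF \<Longrightarrow> local A C"
proof (induction rule: FF.induct)
  case FF_id
  then show ?case by (simp add: local_idf good_field FF_good)
next
  case (FF_prod h A l)
  show ?case
    by (rule dong[OF gen_field[OF FF_prod(1)] good_field[OF FF_good[OF FF_prod(2)]]
          good_field[OF FF_good[OF FF_prod(4)]] local_sym[OF FF_local_gen[OF FF_prod(2,1)]]
          local_sym[OF FF_local_gen[OF FF_prod(4,1)]] FF_prod(3)[OF FF_prod(4)]])
next
  case (FF_add A B)
  then show ?case by (intro local_add good_field[OF FF_good]) auto
qed

text \<open>The states of \<open>FF\<close> contain the vacuum, are closed under sums and, by
  \<open>nprod_vacuum\<close>, under the modes of generators: g_n x is the state of the
  \<open>n\<close>-th product of \<open>g\<close> with a field of state x.\<close>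

lemma FF_surj: "w \<in> W \<Longrightarrow> \<exists>A\<in>FF. A (-1) vac = w"
proof -
  have "W \<subseteq> {A (-1) vac | A. A \<in> FF}"
  proof (rule generated)
    show "vac \<in> {A (-1) vac | A. A \<in> FF}" using FF_id by (auto simp: idf_def intro!: exI[of _ idf])
  next
    fix x y assume "x \<in> {A (-1) vac | A. A \<in> FF}" "y \<in> {A (-1) vac | A. A \<in> FF}"
    then obtain A C where "A \<in> FF" "C \<in> FF" "x = A (-1) vac" "y = C (-1) vac" by auto
    then show "x + y \<in> {A (-1) vac | A. A \<in> FF}"
      using FF_add[of A C] by (auto intro!: exI[of _ "\<lambda>n v. A n v + C n v"])
  next
    fix g n x assume g: "g \<in> gen" and "x \<in> {A (-1) vac | A. A \<in> FF}"
    then obtain A where A: "A \<in> FF" "x = A (-1) vac" by auto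
    have "nprod g A n (-1) vac = g n x"
      using nprod_vacuum(2)[OF gen_field[OF g] good_field[OF FF_good[OF A(1)]] gen_vac[OF g]
          good_vac[OF FF_good[OF A(1)]]] A by simp
    then show "g n x \<in> {A (-1) vac | A. A \<in> FF}"
      using FF_prod[OF g A(1)] by (metis (mono_tags, lifting) mem_Collect_eq)
  qed
  then show "w \<in> W \<Longrightarrow> \<exists>A\<in>FF. A (-1) vac = w" by blast
qed

text \<open>For the difference \<open>E\<close>, translation gives D E_n 1 = -n E_(n-1) 1, so E_(-1)
  1 = 0 propagates to every E_n 1. Then \<open>goddard\<close>, applied to \<open>E\<close> and a
  member of \<open>FF\<close> with state \<open>v\<close>, yields E_n v = 0.\<close>

lemma field_determined:
  assumes A: "good A" "\<And>C. C \<in> FF \<Longrightarrow> local A C"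
    and B: "good B" "\<And>C. C \<in> FF \<Longrightarrow> local B C"
    and eq: "A (-1) vac = B (-1) vac" and v: "v \<in> W"
  shows "A n v = B n v"
proof -
  define E where "E n v = A n v + - B n v" for n v
  have neg: "quantum_field (\<lambda>n v. - B n v)"
    using good_field[OF B(1)] by (auto simp: quantum_field_def lin_def)
  have negl: "local (\<lambda>n v. - B n v) C" if C: "C \<in> FF" for C
  proof -
    obtain N where N: "\<And>v. (dif ^^ N) (\<lambda>m n. B m (C n v) - C n (B m v)) = 0"
      using B(2)[OF C] by (auto simp: local_def)
    have "(dif ^^ N) (\<lambda>m n. - B m (C n v) - C n (- B m v)) = 0" for v
    proof -
      have "(\<lambda>m n. - B m (C n v) - C n (- B m v)) = 0 - (\<lambda>m n. B m (C n v) - C n (B m v))"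
        using lin_diff[OF qf_lin[OF good_field[OF FF_good[OF C]]], of _ 0]
          qf_zero[OF good_field[OF FF_good[OF C]]] by (simp add: fun_eq_iff)
      then show ?thesis by (simp only: funpow_dif_diff N funpow_dif_zero diff_self)
    qed
    then show ?thesis by (auto simp: local_def)
  qed
  have "good (\<lambda>n v. - B n v)"
    using B(1) neg lin_diff[OF D_lin, of 0] lin_diff[OF K_lin, of _ 0]
    by (auto simp: good_def subspace_neg[OF W_subspace] lin_zero[OF D_lin] lin_zero[OF K_lin])
  then have E: "good E" unfolding E_def by (rule good_add[OF A(1)])
  have E_local: "local E C" if "C \<in> FF" for C
    unfolding E_def by (rule local_add[OF good_field[OF FF_good[OF that]] A(2)[OF that] negl[OF that]])
  have E_neg: "E (- 1 - int k) vac = 0" for k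
  proof (induction k)
    case 0
    then show ?case by (simp add: E_def eq)
  next
    case (Suc k)
    have "D (E (- 1 - int k) vac) = E (- 1 - int k) (D vac) - of_int (- 1 - int k) *s E (- 1 - int k - 1) vac"
      using E by (simp add: good_def)
    then have "of_int (- 1 - int k) *s E (- 1 - int k - 1) vac = 0"
      using Suc lin_zero[OF D_lin] D_vac qf_zero[OF good_field[OF E]] by simp
    \<comment> \<open>The index is negative and the characteristic is 0, so it may be divided
      out.\<close>
    moreover have "of_int (- 1 - int k) \<noteq> (0 :: 'a)" by (simp only: of_int_eq_0_iff)
    ultimately have "E (- 1 - int k - 1) vac = 0" by (metis scale_eq_0_iff)
    then show ?case by (simp add: algebra_simps)
  qed
  have Ev: "E n vac = 0" for n
  proof (cases "0 \<le> n")
    case True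
    then show ?thesis using good_vac[OF E] by simp
  next
    case False
    then show ?thesis using E_neg[of "nat (- 1 - n)"] by simp
  qed
  obtain C where C: "C \<in> FF" "C (-1) vac = v" using FF_surj[OF v] by auto
  have "E n v = 0"
    using goddard[OF good_field[OF E] good_field[OF FF_good[OF C(1)]] E_local[OF C(1)] Ev
        good_vac[OF FF_good[OF C(1)]]] C(2) by simp
  then show ?thesis by (simp add: E_def)
qed

definition state_field :: "'b \<Rightarrow> int \<Rightarrow> 'b \<Rightarrow> 'b" where
  "state_field u = (SOME A. A \<in> FF \<and> A (-1) vac = u)"

lemma state_field_FF: "u \<in> W \<Longrightarrow> state_field u \<in> FF" and state_field_creation: "u \<in> W \<Longrightarrow> state_field u (-1) vac = u"
  using someI_ex[of "\<lambda>A. A \<in> FF \<and> A (-1) vac = u"] FF_surj[of u] by (auto simp: state_field_def)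

text \<open>Reduces an identity for \<open>state_field\<close> to the computation of one vector: a
  \<open>good\<close> field local to \<open>FF\<close> is recognized by its value on the
  vacuum.\<close>

lemma state_field_unique:
  assumes "good A" "\<And>C. C \<in> FF \<Longrightarrow> local A C" "v \<in> W"
  shows "state_field (A (-1) vac) n v = A n v"
proof -
  have u: "A (-1) vac \<in> W" using good_W[OF assms(1) vac_W] .
  show ?thesis
    by (rule field_determined[OF FF_good[OF state_field_FF[OF u]] FF_local[OF state_field_FF[OF u]] assms(1,2)
          state_field_creation[OF u] assms(3)])
qed

lemma state_field_field: "u \<in> W \<Longrightarrow> quantum_field (state_field u)"
  by (rule good_field[OF FF_good[OF state_field_FF]])

lemma state_field_W: "u \<in> W \<Longrightarrow> v \<in> W \<Longrightarrow> state_field u n v \<in> W"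
  by (rule good_W[OF FF_good[OF state_field_FF]])

lemma state_field_K: "u \<in> W \<Longrightarrow> f \<in> Ks \<Longrightarrow> f (state_field u n v) = state_field u n (f v)"
  using FF_good[OF state_field_FF] by (simp add: good_def)

lemma state_field_creation_nonneg: "u \<in> W \<Longrightarrow> 0 \<le> n \<Longrightarrow> state_field u n vac = 0"
  by (rule good_vac[OF FF_good[OF state_field_FF]])

lemma state_field_vac: "v \<in> W \<Longrightarrow> state_field vac n v = (if n = -1 then v else 0)"
  using state_field_unique[OF good_idf FF_local[OF FF_id], of v n] by (simp add: idf_def)

lemma state_field_gen: "g \<in> gen \<Longrightarrow> v \<in> W \<Longrightarrow> state_field (g (-1) vac) n v = g n v"
  by (rule state_field_unique[OF good_gen local_sym[OF FF_local_gen]])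

lemma state_field_add:
  assumes "u \<in> W" "u' \<in> W" "v \<in> W"
  shows "state_field (u + u') n v = state_field u n v + state_field u' n v"
  using state_field_unique[OF FF_good[OF FF_add] FF_local[OF FF_add], OF state_field_FF[OF assms(1)] state_field_FF[OF assms(2)]
      state_field_FF[OF assms(1)] state_field_FF[OF assms(2)] _ assms(3)] assms
  by (simp add: state_field_creation)

text \<open>The rules of \<open>FF\<close> do not form the product of two arbitrary members, but
  Dong's lemma makes it local to all of \<open>FF\<close>, and its state is u_l v; so it is
  recognized by that state.\<close>

lemma state_field_nprod:
  assumes "u \<in> W" "v \<in> W" "w \<in> W"
  shows "state_field (state_field u l v) n w = nprod (state_field u) (state_field v) l n w"
proof -
  note u = state_field_FF[OF assms(1)] and v = state_field_FF[OF assms(2)]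
  have "nprod (state_field u) (state_field v) l (-1) vac = state_field u l v"
    using nprod_vacuum(2)[OF state_field_field state_field_field state_field_creation_nonneg state_field_creation_nonneg, OF assms(1,2) assms(1) _ assms(2)]
    by (simp add: state_field_creation assms)
  moreover have "local (nprod (state_field u) (state_field v) l) C" if "C \<in> FF" for C
    using u v that by (intro dong good_field[OF FF_good] FF_local)
  ultimately show ?thesis
    using state_field_unique[OF good_nprod[OF FF_good[OF u] FF_good[OF v]] _ assms(3), of l n] by simp
qed

lemma state_field_jacobi:
  assumes "u \<in> W" "v \<in> W" "w \<in> W"
  shows "bor (state_field u) (state_field v) l m n w
    = Sum_any (\<lambda>i. (of_int m gchoose i) *s state_field (state_field u (l + int i) v) (m + n - int i) w)"
  using borcherds_identity[OF state_field_field[OF assms(1)] state_field_field[OF assms(2)]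
      FF_local[OF state_field_FF[OF assms(1)] state_field_FF[OF assms(2)]]]
  by (simp add: state_field_nprod assms)

end

section \<open>Additive maps and the scalars\<close>

lemma type_ring_simps [simp]:
  "carrier type_ring = UNIV" "\<zero>\<^bsub>type_ring\<^esub> = 0" "\<one>\<^bsub>type_ring\<^esub> = 1"
  "x \<oplus>\<^bsub>type_ring\<^esub> y = x + y" "x \<otimes>\<^bsub>type_ring\<^esub> y = x * y"
  by (simp_all add: type_ring_def)

lemma cring_type_ring: "cring type_ring"
  by (intro cringI abelian_groupI comm_monoidI)
     (auto simp: algebra_simps intro: exI[of _ "- x" for x])

lemma finsum_type_ring [simp]: "finsum type_ring f A = sum f A"
proof -
  interpret cring "type_ring :: 'a ring" by (rule cring_type_ring)
  show ?thesis
    by (induction A rule: infinite_finite_induct) auto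
qed

text \<open>Over a noncommutative ring a tensor product is first of all an abelian group, so maps
  between such groups are only asked to be additive; linearity is proved case by case.\<close>

definition amap :: "('a, 'm) ring_scheme \<Rightarrow> ('b, 'n) ring_scheme \<Rightarrow> ('a \<Rightarrow> 'b) \<Rightarrow> bool" where
  "amap A B f \<longleftrightarrow> (\<forall>x\<in>carrier A. f x \<in> carrier B) \<and>
     (\<forall>x\<in>carrier A. \<forall>y\<in>carrier A. f (x \<oplus>\<^bsub>A\<^esub> y) = f x \<oplus>\<^bsub>B\<^esub> f y)"

lemma amapI:
  "(\<And>x. x \<in> carrier A \<Longrightarrow> f x \<in> carrier B) \<Longrightarrow>
   (\<And>x y. x \<in> carrier A \<Longrightarrow> y \<in> carrier A \<Longrightarrow> f (x \<oplus>\<^bsub>A\<^esub> y) = f x \<oplus>\<^bsub>B\<^esub> f y) \<Longrightarrow> amap A B f"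
  by (simp add: amap_def)

lemma amap_closed: "amap A B f \<Longrightarrow> x \<in> carrier A \<Longrightarrow> f x \<in> carrier B"
  and amap_add: "amap A B f \<Longrightarrow> x \<in> carrier A \<Longrightarrow> y \<in> carrier A \<Longrightarrow> f (x \<oplus>\<^bsub>A\<^esub> y) = f x \<oplus>\<^bsub>B\<^esub> f y"
  by (simp_all add: amap_def)

lemma amap_zero:
  assumes "abelian_group A" "abelian_group B" "amap A B f"
  shows "f \<zero>\<^bsub>A\<^esub> = \<zero>\<^bsub>B\<^esub>"
proof -
  interpret A: abelian_group A by fact
  interpret B: abelian_group B by fact
  have "f \<zero>\<^bsub>A\<^esub> \<oplus>\<^bsub>B\<^esub> f \<zero>\<^bsub>A\<^esub> = f \<zero>\<^bsub>A\<^esub>"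
    using amap_add[OF assms(3), of "\<zero>\<^bsub>A\<^esub>" "\<zero>\<^bsub>A\<^esub>"] by simp
  then show ?thesis
    using amap_closed[OF assms(3), of "\<zero>\<^bsub>A\<^esub>"] B.add.l_cancel_one by auto
qed

lemma amap_uminus:
  assumes "abelian_group A" "abelian_group B" "amap A B f" "x \<in> carrier A"
  shows "f (\<ominus>\<^bsub>A\<^esub> x) = \<ominus>\<^bsub>B\<^esub> f x"
proof -
  interpret A: abelian_group A by fact
  interpret B: abelian_group B by fact
  have "f (\<ominus>\<^bsub>A\<^esub> x) \<oplus>\<^bsub>B\<^esub> f x = \<zero>\<^bsub>B\<^esub>"
    using amap_add[OF assms(3), of "\<ominus>\<^bsub>A\<^esub> x" x] assms(4) amap_zero[OF assms(1-3)] by (simp add: A.l_neg)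
  then show ?thesis
    using amap_closed[OF assms(3)] assms(4) by (metis A.a_inv_closed B.minus_equality)
qed

section \<open>Tensor products\<close>

locale tensor_prod = M: abelian_group M + N: abelian_group N
  for S :: "('s, 'x) ring_scheme" and M :: "('m, 'y) ring_scheme" and N :: "('n, 'z) ring_scheme" +
  fixes ra :: "'m \<Rightarrow> 's \<Rightarrow> 'm" and la :: "'s \<Rightarrow> 'n \<Rightarrow> 'n"
  assumes ra_closed: "m \<in> carrier M \<Longrightarrow> s \<in> carrier S \<Longrightarrow> ra m s \<in> carrier M"
    and la_closed: "s \<in> carrier S \<Longrightarrow> n \<in> carrier N \<Longrightarrow> la s n \<in> carrier N"
begin

abbreviation T where "T \<equiv> tensor_group S M N ra la"
abbreviation FM where "FM \<equiv> tensor_free M N"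
abbreviation Ker where "Ker \<equiv> tensor_kernel S M N ra la"
abbreviation pt where "pt \<equiv> pure_tensor S M N ra la"
abbreviation coset_of where "coset_of x \<equiv> Ker #>\<^bsub>FM\<^esub> x"

definition balanced :: "('c, 'w) ring_scheme \<Rightarrow> ('m \<times> 'n \<Rightarrow> 'c) \<Rightarrow> bool" where
  "balanced A \<phi> \<longleftrightarrow>
     (\<forall>m\<in>carrier M. amap N A (\<lambda>n. \<phi> (m, n))) \<and> (\<forall>n\<in>carrier N. amap M A (\<lambda>m. \<phi> (m, n))) \<and>
     (\<forall>m\<in>carrier M. \<forall>s\<in>carrier S. \<forall>n\<in>carrier N. \<phi> (ra m s, n) = \<phi> (m, la s n))"

lemma FM_simps [simp]:
  "x \<in> carrier FM \<longleftrightarrow> Poly_Mapping.keys x \<subseteq> carrier M \<times> carrier N"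
  "x \<otimes>\<^bsub>FM\<^esub> y = x + y" "\<one>\<^bsub>FM\<^esub> = 0"
  by (simp_all add: tensor_free_def)

lemma FM_comm: "comm_group FM"
  by (simp add: tensor_free_def abelian_free_Abelian_group)

lemma relations_carrier: "tensor_relations S M N ra la \<subseteq> carrier FM"
proof
  fix r assume "r \<in> tensor_relations S M N ra la"
  moreover have 1: "Poly_Mapping.keys (frag_of a - frag_of b) \<subseteq> {a, b}" for a b :: "'m \<times> 'n"
    by (rule order.trans[OF keys_diff]) simp
  moreover have "Poly_Mapping.keys (frag_of a - frag_of b - frag_of c) \<subseteq> {a, b, c}" for a b c :: "'m \<times> 'n"
    by (rule order.trans[OF keys_diff], rule Un_least, rule order.trans[OF 1]) auto
  ultimately show "r \<in> carrier FM"
    unfolding tensor_relations_def FM_simps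
    by (elim UnE CollectE exE conjE; simp only:) (rule order.trans, assumption, simp add: ra_closed la_closed)+
qed

lemma Ker_subgroup: "subgroup Ker FM"
proof -
  interpret comm_group FM by (rule FM_comm)
  show ?thesis unfolding tensor_kernel_def by (rule generate_is_subgroup[OF relations_carrier])
qed

lemma Ker_normal: "Ker \<lhd> FM"
proof -
  interpret comm_group FM by (rule FM_comm)
  show ?thesis by (rule subgroup_imp_normal[OF Ker_subgroup])
qed

lemma T_simps: "carrier T = carrier (FM Mod Ker)" "add T = monoid.mult (FM Mod Ker)" "\<zero>\<^bsub>T\<^esub> = \<one>\<^bsub>FM Mod Ker\<^esub>"
  by (simp_all add: tensor_group_def Let_def)

lemma T_abelian: "abelian_group T"
proof -
  interpret comm_group FM by (rule FM_comm)
  have "comm_group (FM Mod Ker)" by (rule abelian_FactGroup[OF Ker_subgroup])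
  moreover have "add_monoid T = FM Mod Ker"
    by (simp add: T_simps FactGroup_def)
  ultimately show ?thesis by (metis comm_group_abelian_groupI)
qed

sublocale T: abelian_group T by (rule T_abelian)

lemma coset_of_closed: "x \<in> carrier FM \<Longrightarrow> coset_of x \<in> carrier T"
  by (auto simp: T_simps carrier_FactGroup)

lemma coset_of_add: "x \<in> carrier FM \<Longrightarrow> y \<in> carrier FM \<Longrightarrow> coset_of x \<oplus>\<^bsub>T\<^esub> coset_of y = coset_of (x + y)"
  using normal.rcos_sum[OF Ker_normal, of x y] by (simp add: T_simps)

lemma coset_of_surj: "X \<in> carrier T \<Longrightarrow> \<exists>x\<in>carrier FM. X = coset_of x"
  by (auto simp: T_simps carrier_FactGroup)

lemma coset_of_0: "coset_of 0 = \<zero>\<^bsub>T\<^esub>"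
proof -
  interpret comm_group FM by (rule FM_comm)
  show ?thesis using coset_join2[OF one_closed Ker_subgroup] subgroup.one_closed[OF Ker_subgroup]
    by (simp add: T_simps)
qed

lemma coset_of_eq:
  assumes "x \<in> carrier FM" "y \<in> carrier FM" "x - y \<in> Ker"
  shows "coset_of x = coset_of y"
proof -
  interpret comm_group FM by (rule FM_comm)
  have "x \<in> coset_of y"
    using assms unfolding r_coset_def by (auto intro!: bexI[of _ "x - y"])
  then show ?thesis using repr_independence[OF _ assms(2) Ker_subgroup] by simp
qed

lemma pt_cos: "pt m n = coset_of (frag_of (m, n))"
  by (simp add: pure_tensor_def)

lemma pt_closed: "m \<in> carrier M \<Longrightarrow> n \<in> carrier N \<Longrightarrow> pt m n \<in> carrier T"
  unfolding pt_cos by (rule coset_of_closed) simp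

lemma coset_of_relation:
  assumes "x - y - z \<in> tensor_relations S M N ra la" "x \<in> carrier FM" "y \<in> carrier FM" "z \<in> carrier FM"
  shows "coset_of x = coset_of y \<oplus>\<^bsub>T\<^esub> coset_of z"
proof -
  interpret comm_group FM by (rule FM_comm)
  have "x - (y + z) \<in> Ker"
    using generate.incl[OF assms(1), of FM] by (simp add: tensor_kernel_def algebra_simps)
  moreover have "y + z \<in> carrier FM" using m_closed[OF assms(3,4)] by simp
  ultimately show ?thesis using coset_of_eq[OF assms(2)] coset_of_add[OF assms(3,4)] by simp
qed

lemma pt_add_left:
  "m \<in> carrier M \<Longrightarrow> m' \<in> carrier M \<Longrightarrow> n \<in> carrier N \<Longrightarrow> pt (m \<oplus>\<^bsub>M\<^esub> m') n = pt m n \<oplus>\<^bsub>T\<^esub> pt m' n"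
  unfolding pt_cos by (rule coset_of_relation) (auto simp: tensor_relations_def)

lemma pt_add_right:
  "m \<in> carrier M \<Longrightarrow> n \<in> carrier N \<Longrightarrow> n' \<in> carrier N \<Longrightarrow> pt m (n \<oplus>\<^bsub>N\<^esub> n') = pt m n \<oplus>\<^bsub>T\<^esub> pt m n'"
  unfolding pt_cos by (rule coset_of_relation) (auto simp: tensor_relations_def)

lemma pt_balanced:
  assumes "m \<in> carrier M" "s \<in> carrier S" "n \<in> carrier N"
  shows "pt (ra m s) n = pt m (la s n)"
proof -
  have "frag_of (ra m s, n) - frag_of (m, la s n) \<in> Ker"
    using assms unfolding tensor_kernel_def by (intro generate.incl) (auto simp: tensor_relations_def)
  then show ?thesis unfolding pt_cos by (intro coset_of_eq) (auto simp: assms ra_closed la_closed)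
qed

lemma amap_pt: "n \<in> carrier N \<Longrightarrow> amap M T (\<lambda>m. pt m n)"
  by (auto intro!: amapI simp: pt_closed pt_add_left)

lemma balanced_closed: "balanced A \<phi> \<Longrightarrow> i \<in> carrier M \<times> carrier N \<Longrightarrow> \<phi> i \<in> carrier A"
  by (auto simp: balanced_def amap_def)

definition ext :: "('c, 'w) ring_scheme \<Rightarrow> ('m \<times> 'n \<Rightarrow> 'c) \<Rightarrow> ('m \<times> 'n \<Rightarrow>\<^sub>0 int) \<Rightarrow> 'c" where
  "ext A \<phi> x = (\<Oplus>\<^bsub>A\<^esub> i \<in> Poly_Mapping.keys x. [Poly_Mapping.lookup x i] \<cdot>\<^bsub>A\<^esub> \<phi> i)"

lemma tensor_lift_ext: "tensor_lift A \<phi> X = ext A \<phi> (SOME x. x \<in> X)"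
  by (simp add: tensor_lift_def ext_def Let_def)

context
  fixes A :: "('c, 'w) ring_scheme" and \<phi> :: "'m \<times> 'n \<Rightarrow> 'c"
  assumes A: "abelian_group A" and bal: "balanced A \<phi>"
begin

interpretation A: abelian_group A by (rule A)

lemma ext_superset:
  assumes "finite I" "Poly_Mapping.keys x \<subseteq> I" "I \<subseteq> carrier M \<times> carrier N"
  shows "ext A \<phi> x = (\<Oplus>\<^bsub>A\<^esub> i \<in> I. [Poly_Mapping.lookup x i] \<cdot>\<^bsub>A\<^esub> \<phi> i)"
  unfolding ext_def
proof (rule A.add.finprod_mono_neutral_cong_left[OF assms(1,2)])
  fix i assume "i \<in> I - Poly_Mapping.keys x"
  then show "[Poly_Mapping.lookup x i] \<cdot>\<^bsub>A\<^esub> \<phi> i = \<zero>\<^bsub>A\<^esub>"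
    by (auto simp: in_keys_iff add_pow_def)
qed (use assms balanced_closed[OF bal] in auto)

lemma ext_closed: "x \<in> carrier FM \<Longrightarrow> ext A \<phi> x \<in> carrier A"
  unfolding ext_def using balanced_closed[OF bal] by (intro A.finsum_closed) auto

lemma ext_add:
  assumes "x \<in> carrier FM" "y \<in> carrier FM"
  shows "ext A \<phi> (x + y) = ext A \<phi> x \<oplus>\<^bsub>A\<^esub> ext A \<phi> y"
proof -
  let ?I = "Poly_Mapping.keys x \<union> Poly_Mapping.keys y"
  have I: "finite ?I" "?I \<subseteq> carrier M \<times> carrier N" using assms by auto
  have "ext A \<phi> (x + y) = (\<Oplus>\<^bsub>A\<^esub> i \<in> ?I. [Poly_Mapping.lookup x i] \<cdot>\<^bsub>A\<^esub> \<phi> i \<oplus>\<^bsub>A\<^esub> [Poly_Mapping.lookup y i] \<cdot>\<^bsub>A\<^esub> \<phi> i)"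
    unfolding ext_superset[OF I(1) keys_add I(2)]
  proof (rule A.finsum_cong')
    fix i assume "i \<in> ?I"
    then have c: "\<phi> i \<in> carrier A" using I balanced_closed[OF bal] by blast
    show "[Poly_Mapping.lookup (x + y) i] \<cdot>\<^bsub>A\<^esub> \<phi> i
       = [Poly_Mapping.lookup x i] \<cdot>\<^bsub>A\<^esub> \<phi> i \<oplus>\<^bsub>A\<^esub> [Poly_Mapping.lookup y i] \<cdot>\<^bsub>A\<^esub> \<phi> i"
      by (simp only: lookup_add A.add.int_pow_mult[OF c])
  qed (use I balanced_closed[OF bal] in auto)
  also have "\<dots> = ext A \<phi> x \<oplus>\<^bsub>A\<^esub> ext A \<phi> y"
    unfolding ext_superset[OF I(1) Un_upper1 I(2)] ext_superset[OF I(1) Un_upper2 I(2)]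
    using I balanced_closed[OF bal] by (intro A.finsum_addf) auto
  finally show ?thesis .
qed

lemma ext_frag_of: "i \<in> carrier M \<times> carrier N \<Longrightarrow> ext A \<phi> (frag_of i) = \<phi> i"
  using balanced_closed[OF bal] by (simp add: ext_def keys_frag_of)

lemma ext_diff:
  assumes "x \<in> carrier FM" "y \<in> carrier FM"
  shows "ext A \<phi> (x - y) = ext A \<phi> x \<ominus>\<^bsub>A\<^esub> ext A \<phi> y"
proof -
  have "x - y \<in> carrier FM" using assms keys_diff[of x y] by auto
  then have "ext A \<phi> (x - y) \<oplus>\<^bsub>A\<^esub> ext A \<phi> y = ext A \<phi> x" "ext A \<phi> (x - y) \<in> carrier A"
    using ext_add[of "x - y" y] assms ext_closed by auto
  then show ?thesis using ext_closed assms
    by (metis A.a_inv_closed A.a_assoc A.r_neg A.r_zero a_minus_def)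
qed

text \<open>The zero set \<open>Z\<close> of the extension is a subgroup, and the relations lie in
  it by additivity in each argument and by balance; hence so does the subgroup they generate. This
  makes \<open>tensor_lift\<close> independent of the chosen representative.\<close>

lemma ext_Ker: "x \<in> Ker \<Longrightarrow> ext A \<phi> x = \<zero>\<^bsub>A\<^esub>"
proof -
  interpret F: comm_group FM by (rule FM_comm)
  define Z where "Z = {x \<in> carrier FM. ext A \<phi> x = \<zero>\<^bsub>A\<^esub>}"
  have e0: "ext A \<phi> 0 = \<zero>\<^bsub>A\<^esub>" by (simp add: ext_def)
  have Zsub: "subgroup Z FM"
  proof (rule F.subgroupI)
    show "Z \<noteq> {}" using e0 by (auto simp: Z_def intro!: exI[of _ 0])
  next
    fix a assume a: "a \<in> Z"
    then have "inv\<^bsub>FM\<^esub> a = 0 - a"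
      using inv_free_Abelian_group[of a "carrier M \<times> carrier N"] by (simp add: Z_def tensor_free_def)
    then show "inv\<^bsub>FM\<^esub> a \<in> Z"
      using a F.inv_closed[of a] ext_diff[of 0 a] e0 by (simp add: Z_def a_minus_def)
  next
    fix a b assume "a \<in> Z" "b \<in> Z"
    then show "a \<otimes>\<^bsub>FM\<^esub> b \<in> Z" using F.m_closed[of a b] ext_add[of a b] by (simp add: Z_def)
  qed (auto simp: Z_def simp del: FM_simps)
  have cl: "frag_of (m, n) \<in> carrier FM" if "m \<in> carrier M" "n \<in> carrier N" for m n
    using that by simp
  have cd: "x - y \<in> carrier FM" if "x \<in> carrier FM" "y \<in> carrier FM" for x y
    using that keys_diff[of x y] by auto
  have "r \<in> Z" if r: "r \<in> tensor_relations S M N ra la" for r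
  proof -
    have "r \<in> carrier FM" using relations_carrier r by (rule set_mp)
    moreover have "ext A \<phi> r = \<zero>\<^bsub>A\<^esub>"
      using r unfolding tensor_relations_def
    proof (elim UnE CollectE exE conjE)
      fix m m' n assume *: "r = frag_of (m \<oplus>\<^bsub>M\<^esub> m', n) - frag_of (m, n) - frag_of (m', n)"
        and mm: "m \<in> carrier M" "m' \<in> carrier M" "n \<in> carrier N"
      then have "ext A \<phi> r = \<phi> (m \<oplus>\<^bsub>M\<^esub> m', n) \<ominus>\<^bsub>A\<^esub> \<phi> (m, n) \<ominus>\<^bsub>A\<^esub> \<phi> (m', n)"
        unfolding * by (subst ext_diff, (intro cd cl; simp), (intro cl; simp), subst ext_diff)
          (auto simp: ext_frag_of)
      moreover have "\<phi> (m \<oplus>\<^bsub>M\<^esub> m', n) = \<phi> (m, n) \<oplus>\<^bsub>A\<^esub> \<phi> (m', n)" "\<phi> (m, n) \<in> carrier A" "\<phi> (m', n) \<in> carrier A"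
        using bal mm by (auto simp: balanced_def amap_def)
      ultimately show ?thesis by (simp add: a_minus_def A.a_ac A.r_neg A.r_neg1 A.r_neg2)
    next
      fix m n n' assume *: "r = frag_of (m, n \<oplus>\<^bsub>N\<^esub> n') - frag_of (m, n) - frag_of (m, n')"
        and mm: "m \<in> carrier M" "n \<in> carrier N" "n' \<in> carrier N"
      then have "ext A \<phi> r = \<phi> (m, n \<oplus>\<^bsub>N\<^esub> n') \<ominus>\<^bsub>A\<^esub> \<phi> (m, n) \<ominus>\<^bsub>A\<^esub> \<phi> (m, n')"
        unfolding * by (subst ext_diff, (intro cd cl; simp), (intro cl; simp), subst ext_diff)
          (auto simp: ext_frag_of)
      moreover have "\<phi> (m, n \<oplus>\<^bsub>N\<^esub> n') = \<phi> (m, n) \<oplus>\<^bsub>A\<^esub> \<phi> (m, n')" "\<phi> (m, n) \<in> carrier A" "\<phi> (m, n') \<in> carrier A"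
        using bal mm by (auto simp: balanced_def amap_def)
      ultimately show ?thesis by (simp add: a_minus_def A.a_ac A.r_neg A.r_neg1 A.r_neg2)
    next
      fix m s n assume *: "r = frag_of (ra m s, n) - frag_of (m, la s n)"
        and mm: "m \<in> carrier M" "s \<in> carrier S" "n \<in> carrier N"
      then have "ext A \<phi> r = \<phi> (ra m s, n) \<ominus>\<^bsub>A\<^esub> \<phi> (m, la s n)"
        unfolding * by (subst ext_diff) (auto simp: ext_frag_of ra_closed la_closed)
      moreover have "\<phi> (ra m s, n) = \<phi> (m, la s n)" "\<phi> (m, la s n) \<in> carrier A"
        using bal mm by (auto simp: balanced_def amap_def la_closed)
      ultimately show ?thesis by (simp add: a_minus_def A.r_neg)
    qed
    ultimately show ?thesis by (simp add: Z_def)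
  qed
  then have "Ker \<subseteq> Z"
    unfolding tensor_kernel_def by (intro F.generate_subgroup_incl[OF _ Zsub]) auto
  then show "x \<in> Ker \<Longrightarrow> ext A \<phi> x = \<zero>\<^bsub>A\<^esub>" by (auto simp: Z_def)
qed

lemma tensor_lift_cos:
  assumes "x \<in> carrier FM" shows "tensor_lift A \<phi> (coset_of x) = ext A \<phi> x"
proof -
  interpret F: comm_group FM by (rule FM_comm)
  have "(SOME y. y \<in> coset_of x) \<in> coset_of x"
    using F.rcos_self[OF assms Ker_subgroup] by (rule someI)
  then obtain k where k: "k \<in> Ker" "(SOME y. y \<in> coset_of x) = k + x"
    by (auto simp: r_coset_def)
  moreover have "k \<in> carrier FM" using k(1) subgroup.subset[OF Ker_subgroup] by (rule set_mp[rotated])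
  ultimately show ?thesis
    using assms ext_add[of k x] ext_Ker[OF k(1)] ext_closed[OF assms] by (simp add: tensor_lift_ext)
qed

lemma amap_tensor_lift: "amap T A (tensor_lift A \<phi>)"
proof (rule amapI)
  fix X assume "X \<in> carrier T"
  then show "tensor_lift A \<phi> X \<in> carrier A"
    using coset_of_surj tensor_lift_cos ext_closed by metis
next
  fix X Y assume "X \<in> carrier T" "Y \<in> carrier T"
  then obtain x y where xy: "x \<in> carrier FM" "X = coset_of x" "y \<in> carrier FM" "Y = coset_of y"
    using coset_of_surj by meson
  have "x + y \<in> carrier FM"
    using comm_group.axioms(1)[OF FM_comm] monoid.m_closed[of FM x y] xy(1,3)
    by (simp add: comm_monoid_def)
  then show "tensor_lift A \<phi> (X \<oplus>\<^bsub>T\<^esub> Y) = tensor_lift A \<phi> X \<oplus>\<^bsub>A\<^esub> tensor_lift A \<phi> Y"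
    using xy by (simp add: coset_of_add tensor_lift_cos ext_add)
qed

lemma tensor_lift_pt:
  "m \<in> carrier M \<Longrightarrow> n \<in> carrier N \<Longrightarrow> tensor_lift A \<phi> (pt m n) = \<phi> (m, n)"
  by (simp add: pt_cos tensor_lift_cos ext_frag_of)

end

text \<open>The free abelian group is exhausted by differences, so the induction carries
  \<open>P\<close> for the negative as well. Sums of pure tensors suffice because the negative of a
  pure tensor is again pure: negate its left factor.\<close>

lemma tensor_induct:
  assumes X: "X \<in> carrier T"
    and pure: "\<And>m n. m \<in> carrier M \<Longrightarrow> n \<in> carrier N \<Longrightarrow> P (pt m n)"
    and add: "\<And>X Y. X \<in> carrier T \<Longrightarrow> Y \<in> carrier T \<Longrightarrow> P X \<Longrightarrow> P Y \<Longrightarrow> P (X \<oplus>\<^bsub>T\<^esub> Y)"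
  shows "P X"
proof -
  have pt0: "pt \<zero>\<^bsub>M\<^esub> \<zero>\<^bsub>N\<^esub> = \<zero>\<^bsub>T\<^esub>"
    using amap_zero[OF M.abelian_group_axioms T_abelian amap_pt[OF N.zero_closed]] .
  have neg: "\<ominus>\<^bsub>T\<^esub> pt m n = pt (\<ominus>\<^bsub>M\<^esub> m) n" if "m \<in> carrier M" "n \<in> carrier N" for m n
    using amap_uminus[OF M.abelian_group_axioms T_abelian amap_pt[OF that(2)] that(1)] by simp
  have main: "P (coset_of x) \<and> P (\<ominus>\<^bsub>T\<^esub> coset_of x)" if "Poly_Mapping.keys x \<subseteq> carrier M \<times> carrier N" for x
    using that
  proof (induction x rule: free_Abelian_group_induct[consumes 1, case_names zero diff frag])
    case zero
    have z: "\<ominus>\<^bsub>T\<^esub> \<zero>\<^bsub>T\<^esub> = \<zero>\<^bsub>T\<^esub>" by (rule T.minus_equality) auto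
    show ?case using pure[of "\<zero>\<^bsub>M\<^esub>" "\<zero>\<^bsub>N\<^esub>"]  by (simp add: coset_of_0 pt0 z)
  next
    case (diff x y)
    have xy: "coset_of (x - y) = coset_of x \<ominus>\<^bsub>T\<^esub> coset_of y"
    proof -
      have "x - y \<in> carrier FM" using diff keys_diff[of x y] by auto
      then have "coset_of (x - y) \<oplus>\<^bsub>T\<^esub> coset_of y = coset_of x" "coset_of (x - y) \<in> carrier T" "coset_of y \<in> carrier T"
        using coset_of_add[of "x - y" y] diff by (auto intro: coset_of_closed)
      then show ?thesis
        by (metis T.a_inv_closed T.a_assoc T.r_neg T.r_zero a_minus_def)
    qed
    have c: "coset_of x \<in> carrier T" "coset_of y \<in> carrier T" using diff by (auto intro: coset_of_closed)
    then have "\<ominus>\<^bsub>T\<^esub> (coset_of x \<ominus>\<^bsub>T\<^esub> coset_of y) = coset_of y \<oplus>\<^bsub>T\<^esub> \<ominus>\<^bsub>T\<^esub> coset_of x"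
      by (simp add: a_minus_def T.minus_add T.a_comm)
    then show ?case
      unfolding xy using add diff c by (simp add: a_minus_def)
  next
    case (frag a)
    then show ?case using pure neg by (cases a) (auto simp flip: pt_cos)
  qed
  obtain x where "x \<in> carrier FM" "X = coset_of x" using coset_of_surj[OF X] by auto
  then show ?thesis using main by simp
qed

context
  fixes R :: "'r set" and lm :: "'r \<Rightarrow> 'm \<Rightarrow> 'm"
  assumes lm_amap: "\<And>r. r \<in> R \<Longrightarrow> amap M M (lm r)"
    and lm_ra: "\<And>r m s. r \<in> R \<Longrightarrow> m \<in> carrier M \<Longrightarrow> s \<in> carrier S \<Longrightarrow> lm r (ra m s) = ra (lm r m) s"
begin

abbreviation TM where "TM \<equiv> tensor_module S M N ra la lm"

lemma TM_simps: "carrier TM = carrier T" "add TM = add T" "\<zero>\<^bsub>TM\<^esub> = \<zero>\<^bsub>T\<^esub>"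
  "r \<odot>\<^bsub>TM\<^esub> X = tensor_lift T (\<lambda>(m, n). pt (lm r m) n) X"
  by (simp_all add: tensor_module_def ring.defs module.defs Let_def)

text \<open>Balance is the point: the action on the left factor commutes with the right action of
  \<open>S\<close>.\<close>

lemma lm_balanced: "r \<in> R \<Longrightarrow> balanced T (\<lambda>(m, n). pt (lm r m) n)"
  unfolding balanced_def
  by (auto intro!: amapI simp: pt_closed pt_add_left pt_add_right amap_closed[OF lm_amap]
      amap_add[OF lm_amap] lm_ra pt_balanced)

lemma amap_TM_smult: "r \<in> R \<Longrightarrow> amap T T (\<lambda>X. r \<odot>\<^bsub>TM\<^esub> X)"
  unfolding TM_simps(4) by (rule amap_tensor_lift[OF T_abelian lm_balanced])

lemma TM_smult_pt:
  "r \<in> R \<Longrightarrow> m \<in> carrier M \<Longrightarrow> n \<in> carrier N \<Longrightarrow> r \<odot>\<^bsub>TM\<^esub> pt m n = pt (lm r m) n"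
  unfolding TM_simps(4) by (subst tensor_lift_pt[OF T_abelian lm_balanced]) auto

lemma TM_abelian: "abelian_group TM"
proof -
  show ?thesis
  proof (rule abelian_groupI)
    fix x assume "x \<in> carrier TM"
    then show "\<exists>y\<in>carrier TM. y \<oplus>\<^bsub>TM\<^esub> x = \<zero>\<^bsub>TM\<^esub>"
      using T.l_neg[of x] by (auto simp: TM_simps)
  qed (simp_all add: TM_simps T.a_ac)
qed

end

end

section \<open>The affine Lie algebra\<close>

lemma shift_coeff_neg [simp]: "j < 0 \<Longrightarrow> shift_coeff f j = 0"
  by (simp add: shift_coeff_def)

lemma shift_coeff_0 [simp]: "shift_coeff f 0 = f"
  by (simp add: shift_coeff_def)

lemma fls_deriv_fls_of_poly: "fls_deriv (fls_of_poly q) = fls_of_poly (pderiv q)"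
  by (simp add: fls_of_poly_def fls_deriv_fps_to_fls fps_of_poly_pderiv)

text \<open>d/dz and d/dx agree on f(z + x). At j = -1 both sides vanish, the right one through its
  factor.\<close>

lemma shift_coeff_deriv: "fls_deriv (shift_coeff f j) = of_int (j + 1) * shift_coeff f (j + 1)"
proof (cases "j < 0")
  case True
  then show ?thesis by (cases "j = -1") auto
next
  case False
  then have "nat (j + 1) = Suc (nat j)" by simp
  moreover have "(of_int (j + 1) :: complex fls) * fls_const (1 / fact (Suc (nat j))) = fls_const (1 / fact (nat j))"
  proof -
    have "(of_int (j + 1) :: complex) * (1 / fact (Suc (nat j))) = 1 / fact (nat j)"
    proof -
      have "(of_int (j + 1) :: complex) = of_nat (Suc (nat j))" using False by simp
      then show ?thesis by (simp only: fact_Suc) (simp del: of_nat_Suc)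
    qed
    then show ?thesis by (simp only: fls_of_int fls_const_mult_const)
  qed
  ultimately show ?thesis
    using False by (simp add: shift_coeff_def mult.assoc[symmetric] del: of_int_add)
qed

text \<open>p(z + x) is a polynomial in x; this keeps brackets inside the Laurent
  polynomials.\<close>

lemma shift_coeff_poly_large:
  assumes "int (degree q) < j" shows "shift_coeff (fls_of_poly q) j = 0"
proof -
  have d: "(fls_deriv ^^ k) (fls_of_poly q) = fls_of_poly ((pderiv ^^ k) q)" for k
    by (induction k) (simp_all add: fls_deriv_fls_of_poly)
  have "degree ((pderiv ^^ k) q) \<le> degree q - k" for k
    by (induction k) (auto simp: degree_pderiv)
  from this[of "degree q"] have "degree ((pderiv ^^ degree q) q) = 0" by simp
  then have z: "(pderiv ^^ Suc (degree q)) q = 0" by (simp add: pderiv_eq_0_iff)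
  have "(pderiv ^^ (k + Suc (degree q))) q = 0" for k
    unfolding funpow_add comp_apply z by (induction k) auto
  from this[of "nat j - Suc (degree q)"] have "(pderiv ^^ nat j) q = 0"
    using assms by simp
  moreover have "fls_of_poly 0 = 0" by (simp add: fls_of_poly_def)
  ultimately show ?thesis using assms by (simp add: shift_coeff_def d)
qed

section \<open>The tensor product of C((z)) with two copies of g\<close>

locale loop_algebra = lie_algebra_with_form CC G B
  for G :: "(complex, 'g) lie_alg" and B :: "'g \<Rightarrow> 'g \<Rightarrow> complex" +
  fixes p :: "complex poly"
begin

abbreviation DG where "DG \<equiv> double G"

lemma DG_simps [simp]:
  "carrier DG = carrier G \<times> carrier G" "\<zero>\<^bsub>DG\<^esub> = (\<zero>\<^bsub>G\<^esub>, \<zero>\<^bsub>G\<^esub>)"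
  "(a, b) \<oplus>\<^bsub>DG\<^esub> (c, d) = (a \<oplus>\<^bsub>G\<^esub> c, b \<oplus>\<^bsub>G\<^esub> d)" "s \<odot>\<^bsub>DG\<^esub> (a, b) = (s \<odot>\<^bsub>G\<^esub> a, s \<odot>\<^bsub>G\<^esub> b)"
  by (simp_all add: double_def)

lemma G_smult_closed [simp]: "a \<in> carrier G \<Longrightarrow> c \<odot>\<^bsub>G\<^esub> a \<in> carrier G"
  using smult_closed by simp

lemma DG_abelian: "abelian_group DG"
proof (rule abelian_groupI)
  fix x assume "x \<in> carrier DG"
  then show "\<exists>y\<in>carrier DG. y \<oplus>\<^bsub>DG\<^esub> x = \<zero>\<^bsub>DG\<^esub>"
    by (intro bexI[of _ "(\<ominus>\<^bsub>G\<^esub> fst x, \<ominus>\<^bsub>G\<^esub> snd x)"]) (auto simp: M.l_neg)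
qed (auto simp: M.a_ac)

lemma DG_module: "Module.module CC DG"
proof (rule Module.moduleI)
  show "cring CC" by (rule cring_type_ring)
qed (use smult_l_distr smult_r_distr smult_assoc1 smult_one in \<open>auto simp: DG_abelian\<close>)

sublocale TP: tensor_prod CC KK DG "\<lambda>f c. f * fls_const c" "module.smult DG"
proof -
  interpret D: Module.module CC DG by (rule DG_module)
  interpret K: cring KK by (rule cring_type_ring)
  show "tensor_prod CC KK DG (\<lambda>f c. f * fls_const c) (module.smult DG)"
    by (intro tensor_prod.intro tensor_prod_axioms.intro K.abelian_group_axioms D.abelian_group_axioms)
       (use D.smult_closed in auto)
qed

abbreviation EE where "EE \<equiv> ext_module G"
abbreviation ep where "ep \<equiv> ext_pure G"

lemma lm_amap: "amap KK KK ((*) r)"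
  by (simp add: amap_def algebra_simps)

lemma EE_TM: "EE = TP.TM (*)"
  by (simp add: ext_module_def)

lemma ep_pt: "ep f w = TP.pt f w"
  by (simp add: ext_pure_def)

lemma EE_T: "carrier EE = carrier TP.T" "add EE = add TP.T" "\<zero>\<^bsub>EE\<^esub> = \<zero>\<^bsub>TP.T\<^esub>"
  unfolding EE_TM by (rule TP.TM_simps[where R = UNIV]; simp add: lm_amap)+

sublocale EE: abelian_group EE
  unfolding EE_TM by (rule TP.TM_abelian[where R = UNIV]) (simp_all add: lm_amap)

lemma ep_closed [simp]: "w \<in> carrier DG \<Longrightarrow> ep f w \<in> carrier EE"
  unfolding ep_pt EE_T by (rule TP.pt_closed) auto

lemma ep_add_left: "w \<in> carrier DG \<Longrightarrow> ep (f + g) w = ep f w \<oplus>\<^bsub>EE\<^esub> ep g w"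
  unfolding ep_pt EE_T using TP.pt_add_left[of f g w] by simp

lemma ep_add_right: "w \<in> carrier DG \<Longrightarrow> w' \<in> carrier DG \<Longrightarrow> ep f (w \<oplus>\<^bsub>DG\<^esub> w') = ep f w \<oplus>\<^bsub>EE\<^esub> ep f w'"
  unfolding ep_pt EE_T by (rule TP.pt_add_right) auto

lemma ep_balanced: "w \<in> carrier DG \<Longrightarrow> ep f (c \<odot>\<^bsub>DG\<^esub> w) = ep (f * fls_const c) w"
  unfolding ep_pt by (rule TP.pt_balanced[symmetric]) auto

lemma ep_smult: "w \<in> carrier DG \<Longrightarrow> f \<odot>\<^bsub>EE\<^esub> ep g w = ep (f * g) w"
  unfolding ep_pt EE_TM by (rule TP.TM_smult_pt[where R = UNIV]) (auto simp: lm_amap)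

lemma amap_EE_smult: "amap EE EE (\<lambda>X. f \<odot>\<^bsub>EE\<^esub> X)"
proof -
  have "amap TP.T TP.T (\<lambda>X. f \<odot>\<^bsub>EE\<^esub> X)"
    unfolding EE_TM by (rule TP.amap_TM_smult[of UNIV]) (auto simp: lm_amap)
  then show ?thesis by (simp add: amap_def EE_T)
qed

lemma EE_induct [consumes 1, case_names pure add]:
  assumes "X \<in> carrier EE" "\<And>f w. w \<in> carrier DG \<Longrightarrow> P (ep f w)"
    "\<And>X Y. X \<in> carrier EE \<Longrightarrow> Y \<in> carrier EE \<Longrightarrow> P X \<Longrightarrow> P Y \<Longrightarrow> P (X \<oplus>\<^bsub>EE\<^esub> Y)"
  shows "P X"
  using TP.tensor_induct[of X P] assms by (simp only: EE_T ep_pt)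

lemma EE_module: "Module.module KK EE"
proof (rule Module.moduleI)
  show "cring KK" by (rule cring_type_ring)
  show "abelian_group EE" by (rule EE.abelian_group_axioms)
  fix f g X assume X: "X \<in> carrier EE"
  note [simp] = amap_closed[OF amap_EE_smult] amap_add[OF amap_EE_smult]
  show "f \<odot>\<^bsub>EE\<^esub> X \<in> carrier EE" using X by simp
  show "(f \<oplus>\<^bsub>KK\<^esub> g) \<odot>\<^bsub>EE\<^esub> X = f \<odot>\<^bsub>EE\<^esub> X \<oplus>\<^bsub>EE\<^esub> g \<odot>\<^bsub>EE\<^esub> X"
    using X by (induction rule: EE_induct) (simp_all add: ep_smult ep_add_left distrib_right EE.a_ac)
  show "(f \<otimes>\<^bsub>KK\<^esub> g) \<odot>\<^bsub>EE\<^esub> X = f \<odot>\<^bsub>EE\<^esub> (g \<odot>\<^bsub>EE\<^esub> X)"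
    using X by (induction rule: EE_induct) (simp_all add: ep_smult mult.assoc)
  show "\<one>\<^bsub>KK\<^esub> \<odot>\<^bsub>EE\<^esub> X = X"
    using X by (induction rule: EE_induct) (simp_all add: ep_smult)
  show "f \<odot>\<^bsub>EE\<^esub> (X \<oplus>\<^bsub>EE\<^esub> Y) = f \<odot>\<^bsub>EE\<^esub> X \<oplus>\<^bsub>EE\<^esub> f \<odot>\<^bsub>EE\<^esub> Y" if "Y \<in> carrier EE" for Y
    using X that by simp
qed

sublocale EEm: Module.module KK EE by (rule EE_module)

lemma EE_smult_closed [simp]: "X \<in> carrier EE \<Longrightarrow> f \<odot>\<^bsub>EE\<^esub> X \<in> carrier EE"
  using EEm.smult_closed by simp

lemma EE_lift:
  assumes A: "abelian_group A"
    and 1: "\<And>f. amap DG A (\<lambda>w. \<phi> (f, w))"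
    and 2: "\<And>w. w \<in> carrier DG \<Longrightarrow> amap KK A (\<lambda>f. \<phi> (f, w))"
    and 3: "\<And>f c w. w \<in> carrier DG \<Longrightarrow> \<phi> (f * fls_const c, w) = \<phi> (f, c \<odot>\<^bsub>DG\<^esub> w)"
  shows "amap EE A (tensor_lift A \<phi>)" "w \<in> carrier DG \<Longrightarrow> tensor_lift A \<phi> (ep f w) = \<phi> (f, w)"
proof -
  have b: "TP.balanced A \<phi>" unfolding TP.balanced_def using 1 2 3 by simp
  show "amap EE A (tensor_lift A \<phi>)"
    using TP.amap_tensor_lift[OF A b] by (simp add: amap_def EE_T)
  show "w \<in> carrier DG \<Longrightarrow> tensor_lift A \<phi> (ep f w) = \<phi> (f, w)"
    unfolding ep_pt by (rule TP.tensor_lift_pt[OF A b]) auto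
qed

section \<open>Laurent polynomials over this space, with the central line\<close>

abbreviation CH where "CH \<equiv> check_module G"

lemma CH_simps:
  "carrier CH = {u. (\<forall>n. u n \<in> carrier EE) \<and> finite {n. u n \<noteq> \<zero>\<^bsub>EE\<^esub>}} \<times> UNIV"
  "\<zero>\<^bsub>CH\<^esub> = ((\<lambda>n. \<zero>\<^bsub>EE\<^esub>), 0)"
  "(u, h) \<oplus>\<^bsub>CH\<^esub> (v, k) = ((\<lambda>n. u n \<oplus>\<^bsub>EE\<^esub> v n), h + k)"
  "f \<odot>\<^bsub>CH\<^esub> (u, h) = ((\<lambda>n. f \<odot>\<^bsub>EE\<^esub> u n), f * h)"
  by (simp_all add: check_module_def Let_def)

lemma CH_add_closed: "x \<in> carrier CH \<Longrightarrow> y \<in> carrier CH \<Longrightarrow> x \<oplus>\<^bsub>CH\<^esub> y \<in> carrier CH"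
proof -
  assume "x \<in> carrier CH" "y \<in> carrier CH"
  then obtain u h v k where *: "x = (u, h)" "y = (v, k)" "\<And>n. u n \<in> carrier EE" "\<And>n. v n \<in> carrier EE"
     "finite {n. u n \<noteq> \<zero>\<^bsub>EE\<^esub>}" "finite {n. v n \<noteq> \<zero>\<^bsub>EE\<^esub>}"
    by (cases x; cases y) (auto simp: CH_simps)
  have "finite {n. u n \<oplus>\<^bsub>EE\<^esub> v n \<noteq> \<zero>\<^bsub>EE\<^esub>}"
    by (rule finite_subset[OF _ finite_UnI[OF *(5,6)]], rule subsetI, rule ccontr) simp
  then show ?thesis using * by (simp add: CH_simps)
qed

lemma CH_smult_closed [simp]: "x \<in> carrier CH \<Longrightarrow> f \<odot>\<^bsub>CH\<^esub> x \<in> carrier CH"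
proof -
  assume "x \<in> carrier CH"
  then obtain u h where *: "x = (u, h)" "\<And>n. u n \<in> carrier EE" "finite {n. u n \<noteq> \<zero>\<^bsub>EE\<^esub>}"
    by (cases x) (auto simp: CH_simps)
  have "finite {n. f \<odot>\<^bsub>EE\<^esub> u n \<noteq> \<zero>\<^bsub>EE\<^esub>}"
    by (rule finite_subset[OF _ *(3)], rule Collect_mono, rule impI, erule contrapos_nn)
       (simp add: EEm.smult_r_null)
  then show ?thesis using * by (simp add: CH_simps)
qed

lemma CH_module: "Module.module KK CH"
proof (rule Module.moduleI)
  show "cring KK" by (rule cring_type_ring)
  show "abelian_group CH"
  proof (rule abelian_groupI)
    show "x \<oplus>\<^bsub>CH\<^esub> y \<in> carrier CH" if "x \<in> carrier CH" "y \<in> carrier CH" for x y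
      using that by (rule CH_add_closed)
    fix x assume x: "x \<in> carrier CH"
    then obtain u h where u: "x = (u, h)" "\<And>n. u n \<in> carrier EE" by (cases x) (auto simp: CH_simps)
    have "(-1) \<odot>\<^bsub>EE\<^esub> u n \<oplus>\<^bsub>EE\<^esub> u n = \<zero>\<^bsub>EE\<^esub>" for n
      using EEm.smult_l_distr[of "-1" 1 "u n"] EEm.smult_one[of "u n"] EEm.smult_l_null[of "u n"] u(2) by simp
    then have "(-1) \<odot>\<^bsub>CH\<^esub> x \<oplus>\<^bsub>CH\<^esub> x = \<zero>\<^bsub>CH\<^esub>"
      by (simp add: u CH_simps)
    then show "\<exists>y\<in>carrier CH. y \<oplus>\<^bsub>CH\<^esub> x = \<zero>\<^bsub>CH\<^esub>" using CH_smult_closed[OF x] by blast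
  qed (auto simp: CH_simps EE.a_ac)
  show "f \<odot>\<^bsub>CH\<^esub> x \<in> carrier CH" if "x \<in> carrier CH" for f x using that by (rule CH_smult_closed)
qed (use EEm.smult_l_distr EEm.smult_r_distr EEm.smult_assoc1 EEm.smult_one in
    \<open>auto simp: CH_simps algebra_simps\<close>)

sublocale CH: Module.module KK CH by (rule CH_module)

definition mono :: "'g ext \<Rightarrow> int \<Rightarrow> 'g chk" where
  "mono X n = ((\<lambda>r. if r = n then X else \<zero>\<^bsub>EE\<^esub>), 0)"

definition cen :: "complex fls \<Rightarrow> 'g chk" where
  "cen h = ((\<lambda>r. \<zero>\<^bsub>EE\<^esub>), h)"

lemma check_mode_mono: "check_mode G w n = mono (ep 1 w) n"
  by (simp add: check_mode_def mono_def)

lemma mono_closed [simp]: "X \<in> carrier EE \<Longrightarrow> mono X n \<in> carrier CH"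
  by (auto simp: mono_def CH_simps)

lemma cen_closed [simp]: "cen h \<in> carrier CH"
  by (auto simp: cen_def CH_simps)

lemma amap_mono: "amap EE CH (\<lambda>X. mono X n)"
  by (rule amapI) (auto simp: mono_def CH_simps fun_eq_iff)

lemma amap_cen: "amap KK CH cen"
  by (rule amapI) (auto simp: cen_def CH_simps fun_eq_iff)

lemma smult_mono: "X \<in> carrier EE \<Longrightarrow> f \<odot>\<^bsub>CH\<^esub> mono X n = mono (f \<odot>\<^bsub>EE\<^esub> X) n"
  by (simp add: mono_def CH_simps fun_eq_iff)

lemma smult_cen: "f \<odot>\<^bsub>CH\<^esub> cen h = cen (f * h)"
  by (simp add: cen_def CH_simps fun_eq_iff)

text \<open>\<open>I\<close> bounds the exponents that occur in the monomials: \<open>UNIV\<close>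
  for the whole algebra, the nonnegative integers for elements of
  \<open>check_borel\<close>.\<close>

lemma CH_induct [consumes 2, case_names cen mono add]:
  assumes x: "x \<in> carrier CH" and supp: "\<And>n. n \<notin> I \<Longrightarrow> fst x n = \<zero>\<^bsub>EE\<^esub>"
    and cen: "\<And>h. P (cen h)"
    and mono: "\<And>f w n. w \<in> carrier DG \<Longrightarrow> n \<in> I \<Longrightarrow> P (mono (ep f w) n)"
    and add: "\<And>x y. x \<in> carrier CH \<Longrightarrow> y \<in> carrier CH \<Longrightarrow> P x \<Longrightarrow> P y \<Longrightarrow> P (x \<oplus>\<^bsub>CH\<^esub> y)"
  shows "P x"
proof -
  have mono': "P (mono X n)" if "X \<in> carrier EE" "n \<in> I" for X n
    using that by (induction rule: EE_induct) (auto simp: amap_add[OF amap_mono] intro: add mono)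
  obtain u h where u: "x = (u, h)" "\<And>n. u n \<in> carrier EE" "finite {n. u n \<noteq> \<zero>\<^bsub>EE\<^esub>}"
    "\<And>n. n \<notin> I \<Longrightarrow> u n = \<zero>\<^bsub>EE\<^esub>"
    using x supp by (cases x) (auto simp: CH_simps)
  have "P ((\<lambda>r. if r \<in> F then u r else \<zero>\<^bsub>EE\<^esub>), h) \<and>
      ((\<lambda>r. if r \<in> F then u r else \<zero>\<^bsub>EE\<^esub>), h) \<in> carrier CH" if "finite F" "F \<subseteq> I" for F
    using that
  proof (induction F rule: finite_induct)
    case empty
    then show ?case using cen[of h] cen_closed[of h] by (simp add: cen_def)
  next
    case (insert n F)
    have "((\<lambda>r. if r \<in> insert n F then u r else \<zero>\<^bsub>EE\<^esub>), h)
        = mono (u n) n \<oplus>\<^bsub>CH\<^esub> ((\<lambda>r. if r \<in> F then u r else \<zero>\<^bsub>EE\<^esub>), h)"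
      using insert.hyps u(2) by (auto simp: mono_def CH_simps fun_eq_iff)
    then show ?case using insert u(2) by (auto intro!: add mono' CH_add_closed)
  qed
  from this[of "{n. u n \<noteq> \<zero>\<^bsub>EE\<^esub>}"] u(3,4)
  have "P ((\<lambda>r. if r \<in> {n. u n \<noteq> \<zero>\<^bsub>EE\<^esub>} then u r else \<zero>\<^bsub>EE\<^esub>), h)" by blast
  moreover have "(\<lambda>r. if r \<in> {n. u n \<noteq> \<zero>\<^bsub>EE\<^esub>} then u r else \<zero>\<^bsub>EE\<^esub>) = u" by (rule ext) simp
  ultimately show ?thesis using u(1) by simp
qed

text \<open>With (a, a') read as a + a' e and e^2 = 0, this is the bracket of g over the dual
  numbers; it yields the part of the bracket of modes at exponent m + n. \<open>W1\<close> yields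
  the part that is multiplied by p(z + t).\<close>

fun W0 :: "'g \<times> 'g \<Rightarrow> 'g \<times> 'g \<Rightarrow> 'g \<times> 'g" where
  "W0 (a, a') (b, b') = (lie_bracket G a b, lie_bracket G a b' \<oplus>\<^bsub>G\<^esub> lie_bracket G a' b)"

fun W1 :: "'g \<times> 'g \<Rightarrow> 'g \<times> 'g \<Rightarrow> 'g \<times> 'g" where
  "W1 (a, a') (b, b') = (lie_bracket G a' b', \<zero>\<^bsub>G\<^esub>)"

fun c0 :: "'g \<times> 'g \<Rightarrow> 'g \<times> 'g \<Rightarrow> complex" where "c0 (a, a') (b, b') = B a b"

fun c1 :: "'g \<times> 'g \<Rightarrow> 'g \<times> 'g \<Rightarrow> complex" where "c1 (a, a') (b, b') = B a' b'"

lemma form_add':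
  assumes "x \<in> carrier G" "y \<in> carrier G" "w \<in> carrier G"
  shows "B (x \<oplus>\<^bsub>G\<^esub> y) w = B x w + B y w" "B w (x \<oplus>\<^bsub>G\<^esub> y) = B w x + B w y"
  using form_add[of x y w] assms form_sym[of w "x \<oplus>\<^bsub>G\<^esub> y"] form_sym[of w x] form_sym[of w y] by simp_all

lemma form_smult':
  assumes "x \<in> carrier G" "y \<in> carrier G"
  shows "B (c \<odot>\<^bsub>G\<^esub> x) y = c * B x y" "B x (c \<odot>\<^bsub>G\<^esub> y) = c * B x y"
  using form_smult[of c x y] form_smult[of c y x] assms form_sym[of x "c \<odot>\<^bsub>G\<^esub> y"] form_sym[of x y]
  by simp_all

lemma bracket_zero [simp]:
  "x \<in> carrier G \<Longrightarrow> lie_bracket G x \<zero>\<^bsub>G\<^esub> = \<zero>\<^bsub>G\<^esub>" "x \<in> carrier G \<Longrightarrow> lie_bracket G \<zero>\<^bsub>G\<^esub> x = \<zero>\<^bsub>G\<^esub>"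
  using amap_zero[OF M.abelian_group_axioms M.abelian_group_axioms, of "\<lambda>y. lie_bracket G x y"]
    amap_zero[OF M.abelian_group_axioms M.abelian_group_axioms, of "\<lambda>y. lie_bracket G y x"]
  by (simp_all add: amap_def bracket_closed bracket_add_left bracket_add_right)

lemma W_closed [simp]:
  assumes "w \<in> carrier DG" "w' \<in> carrier DG"
  shows "W0 w w' \<in> carrier DG" "W1 w w' \<in> carrier DG"
  using assms by (cases w; cases w'; auto simp: bracket_closed)+

lemma bracket_smult:
  assumes "x \<in> carrier G" "y \<in> carrier G"
  shows "lie_bracket G (c \<odot>\<^bsub>G\<^esub> x) y = c \<odot>\<^bsub>G\<^esub> lie_bracket G x y" "lie_bracket G x (c \<odot>\<^bsub>G\<^esub> y) = c \<odot>\<^bsub>G\<^esub> lie_bracket G x y"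
  using assms bracket_smult_left[of c x y] bracket_smult_right[of c x y] by simp_all

lemma G_smult_zero [simp]: "c \<odot>\<^bsub>G\<^esub> \<zero>\<^bsub>G\<^esub> = \<zero>\<^bsub>G\<^esub>"
  using smult_r_null by simp

lemma W_bilinear:
  assumes "w1 \<in> carrier DG" "w2 \<in> carrier DG" "w \<in> carrier DG"
  shows "W0 (w1 \<oplus>\<^bsub>DG\<^esub> w2) w = W0 w1 w \<oplus>\<^bsub>DG\<^esub> W0 w2 w" "W0 w (w1 \<oplus>\<^bsub>DG\<^esub> w2) = W0 w w1 \<oplus>\<^bsub>DG\<^esub> W0 w w2"
    "W1 (w1 \<oplus>\<^bsub>DG\<^esub> w2) w = W1 w1 w \<oplus>\<^bsub>DG\<^esub> W1 w2 w" "W1 w (w1 \<oplus>\<^bsub>DG\<^esub> w2) = W1 w w1 \<oplus>\<^bsub>DG\<^esub> W1 w w2"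
    "W0 (c \<odot>\<^bsub>DG\<^esub> w1) w = c \<odot>\<^bsub>DG\<^esub> W0 w1 w" "W0 w (c \<odot>\<^bsub>DG\<^esub> w1) = c \<odot>\<^bsub>DG\<^esub> W0 w w1"
    "W1 (c \<odot>\<^bsub>DG\<^esub> w1) w = c \<odot>\<^bsub>DG\<^esub> W1 w1 w" "W1 w (c \<odot>\<^bsub>DG\<^esub> w1) = c \<odot>\<^bsub>DG\<^esub> W1 w w1"
  using assms smult_r_distr
  by (cases w1; cases w2; cases w;
      simp add: bracket_add_left bracket_add_right bracket_smult bracket_closed M.a_ac)+

lemma c_bilinear:
  assumes "w1 \<in> carrier DG" "w2 \<in> carrier DG" "w \<in> carrier DG"
  shows "c0 (w1 \<oplus>\<^bsub>DG\<^esub> w2) w = c0 w1 w + c0 w2 w" "c0 w (w1 \<oplus>\<^bsub>DG\<^esub> w2) = c0 w w1 + c0 w w2"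
    "c1 (w1 \<oplus>\<^bsub>DG\<^esub> w2) w = c1 w1 w + c1 w2 w" "c1 w (w1 \<oplus>\<^bsub>DG\<^esub> w2) = c1 w w1 + c1 w w2"
    "c0 (c \<odot>\<^bsub>DG\<^esub> w1) w = c * c0 w1 w" "c0 w (c \<odot>\<^bsub>DG\<^esub> w1) = c * c0 w w1"
    "c1 (c \<odot>\<^bsub>DG\<^esub> w1) w = c * c1 w1 w" "c1 w (c \<odot>\<^bsub>DG\<^esub> w1) = c * c1 w w1"
  using assms by (cases w1; cases w2; cases w; simp add: form_add' form_smult')+

section \<open>The bracket: bilinearity and extension from pure tensors\<close>

abbreviation PP where "PP \<equiv> shift_coeff (fls_of_poly p)"

definition cc :: "int \<Rightarrow> int \<Rightarrow> 'g \<times> 'g \<Rightarrow> 'g \<times> 'g \<Rightarrow> complex fls" where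
  "cc m n w w' = of_int m * fls_const (c0 w w') * (if m + n = 0 then 1 else 0)
     + fls_const (1/2) * fls_const (c1 w w') * shift_coeff (fls_of_poly (pderiv p)) (- m - n - 1)
     + of_int m * fls_const (c1 w w') * PP (- m - n)"

abbreviation cbp where "cbp \<equiv> check_bracket_pure G B p"

lemma cbp_eq:
  "cbp m (f, w) n (g, w') = ((\<lambda>r. (if r = m + n then ep (f * g) (W0 w w') else \<zero>\<^bsub>EE\<^esub>)
       \<oplus>\<^bsub>EE\<^esub> ep (f * g * PP (r - m - n)) (W1 w w')), f * g * cc m n w w')"
proof -
  obtain a a' b b' where "w = (a, a')" "w' = (b, b')" by (cases w; cases w')
  then show ?thesis by (simp add: Let_def cc_def cong: if_cong)
qed

lemma ep_zero [simp]: "w \<in> carrier DG \<Longrightarrow> ep 0 w = \<zero>\<^bsub>EE\<^esub>"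
  using ep_add_left[of w 0 0] ep_closed[of w 0] EE.add.l_cancel_one by auto

text \<open>Only exponents r with 0 <= r - m - n <= degree p contribute, because p(z + x) has no
  other powers of x.\<close>

lemma cbp_closed:
  assumes "w \<in> carrier DG" "w' \<in> carrier DG"
  shows "cbp m (f, w) n (g, w') \<in> carrier CH"
proof -
  have "finite {r. (if r = m + n then ep (f * g) (W0 w w') else \<zero>\<^bsub>EE\<^esub>)
       \<oplus>\<^bsub>EE\<^esub> ep (f * g * PP (r - m - n)) (W1 w w') \<noteq> \<zero>\<^bsub>EE\<^esub>}"
  proof (rule finite_subset)
    show "{r. (if r = m + n then ep (f * g) (W0 w w') else \<zero>\<^bsub>EE\<^esub>)
       \<oplus>\<^bsub>EE\<^esub> ep (f * g * PP (r - m - n)) (W1 w w') \<noteq> \<zero>\<^bsub>EE\<^esub>} \<subseteq> {m + n .. m + n + int (degree p)}"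
    proof
      fix r assume r: "r \<in> {r. (if r = m + n then ep (f * g) (W0 w w') else \<zero>\<^bsub>EE\<^esub>)
         \<oplus>\<^bsub>EE\<^esub> ep (f * g * PP (r - m - n)) (W1 w w') \<noteq> \<zero>\<^bsub>EE\<^esub>}"
      show "r \<in> {m + n .. m + n + int (degree p)}"
      proof (rule ccontr)
        assume *: "r \<notin> {m + n .. m + n + int (degree p)}"
        then have "PP (r - m - n) = 0"
          by (cases "r - m - n < 0") (auto intro: shift_coeff_poly_large)
        moreover have "r \<noteq> m + n" using * by auto
        ultimately show False using r assms by (simp del: DG_simps)
      qed
    qed
  qed simp
  then show ?thesis using assms by (auto simp: cbp_eq CH_simps simp del: DG_simps)
qed

lemma cbp_add_f: "w \<in> carrier DG \<Longrightarrow> w' \<in> carrier DG \<Longrightarrow>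
   cbp m (f + f', w) n (g, w') = cbp m (f, w) n (g, w') \<oplus>\<^bsub>CH\<^esub> cbp m (f', w) n (g, w')"
  by (simp add: fun_eq_iff cbp_eq CH_simps ep_add_left distrib_right EE.a_ac del: DG_simps)

lemma cbp_add_g: "w \<in> carrier DG \<Longrightarrow> w' \<in> carrier DG \<Longrightarrow>
   cbp m (f, w) n (g + g', w') = cbp m (f, w) n (g, w') \<oplus>\<^bsub>CH\<^esub> cbp m (f, w) n (g', w')"
  by (simp add: fun_eq_iff cbp_eq CH_simps ep_add_left distrib_right distrib_left EE.a_ac del: DG_simps)

lemma cc_add:
  assumes "w1 \<in> carrier DG" "w2 \<in> carrier DG" "w \<in> carrier DG"
  shows "cc m n (w1 \<oplus>\<^bsub>DG\<^esub> w2) w = cc m n w1 w + cc m n w2 w" "cc m n w (w1 \<oplus>\<^bsub>DG\<^esub> w2) = cc m n w w1 + cc m n w w2"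
    "cc m n (c \<odot>\<^bsub>DG\<^esub> w1) w = fls_const c * cc m n w1 w" "cc m n w (c \<odot>\<^bsub>DG\<^esub> w1) = fls_const c * cc m n w w1"
  unfolding cc_def c_bilinear[OF assms]
  by (simp_all add: algebra_simps flip: fls_plus_const fls_const_mult_const)

lemma cbp_add_w: "w1 \<in> carrier DG \<Longrightarrow> w2 \<in> carrier DG \<Longrightarrow> w' \<in> carrier DG \<Longrightarrow>
   cbp m (f, w1 \<oplus>\<^bsub>DG\<^esub> w2) n (g, w') = cbp m (f, w1) n (g, w') \<oplus>\<^bsub>CH\<^esub> cbp m (f, w2) n (g, w')"
  by (simp add: fun_eq_iff cbp_eq CH_simps W_bilinear cc_add ep_add_right distrib_left EE.a_ac del: DG_simps)

lemma cbp_add_w': "w1 \<in> carrier DG \<Longrightarrow> w2 \<in> carrier DG \<Longrightarrow> w \<in> carrier DG \<Longrightarrow>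
   cbp m (f, w) n (g, w1 \<oplus>\<^bsub>DG\<^esub> w2) = cbp m (f, w) n (g, w1) \<oplus>\<^bsub>CH\<^esub> cbp m (f, w) n (g, w2)"
  by (simp add: fun_eq_iff cbp_eq CH_simps W_bilinear cc_add ep_add_right distrib_left EE.a_ac del: DG_simps)

lemma cbp_balanced: "w \<in> carrier DG \<Longrightarrow> w' \<in> carrier DG \<Longrightarrow>
   cbp m (f * fls_const c, w) n (g, w') = cbp m (f, c \<odot>\<^bsub>DG\<^esub> w) n (g, w')"
  "w \<in> carrier DG \<Longrightarrow> w' \<in> carrier DG \<Longrightarrow>
   cbp m (f, w) n (g * fls_const c, w') = cbp m (f, w) n (g, c \<odot>\<^bsub>DG\<^esub> w')"
  by (auto simp: cbp_eq W_bilinear cc_add ep_balanced algebra_simps fun_eq_iff simp del: DG_simps)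

definition brk :: "int \<Rightarrow> int \<Rightarrow> 'g ext \<Rightarrow> 'g ext \<Rightarrow> 'g chk" where
  "brk m n X Y = tensor_lift CH (\<lambda>i. tensor_lift CH (\<lambda>j. cbp m i n j) Y) X"

lemma inner_lift:
  assumes w: "w \<in> carrier DG"
  shows "amap EE CH (tensor_lift CH (\<lambda>j. cbp m (f, w) n j))"
    "w' \<in> carrier DG \<Longrightarrow> tensor_lift CH (\<lambda>j. cbp m (f, w) n j) (ep g w') = cbp m (f, w) n (g, w')"
proof -
  note * = EE_lift[OF CH.abelian_group_axioms, of "\<lambda>j. cbp m (f, w) n j"]
  show "amap EE CH (tensor_lift CH (\<lambda>j. cbp m (f, w) n j))"
    by (rule *) (use w in \<open>auto simp del: DG_simps check_bracket_pure.simps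
        simp: cbp_closed cbp_add_w' cbp_add_g cbp_balanced intro!: amapI\<close>)
  show "w' \<in> carrier DG \<Longrightarrow> tensor_lift CH (\<lambda>j. cbp m (f, w) n j) (ep g w') = cbp m (f, w) n (g, w')"
    by (rule *) (use w in \<open>auto simp del: DG_simps check_bracket_pure.simps
        simp: cbp_closed cbp_add_w' cbp_add_g cbp_balanced intro!: amapI\<close>)
qed

text \<open>The inner lift is explicit only when its argument \<open>Y\<close> is a pure tensor, so
  its dependence on the outer pair is established by induction on \<open>Y\<close>, starting from
  the formula for \<open>cbp\<close>.\<close>

lemma inner_props:
  assumes Y: "Y \<in> carrier EE"
  shows "amap DG CH (\<lambda>w. tensor_lift CH (\<lambda>j. cbp m (f, w) n j) Y)"
    "w \<in> carrier DG \<Longrightarrow> amap KK CH (\<lambda>f. tensor_lift CH (\<lambda>j. cbp m (f, w) n j) Y)"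
    "w \<in> carrier DG \<Longrightarrow> tensor_lift CH (\<lambda>j. cbp m (f * fls_const c, w) n j) Y = tensor_lift CH (\<lambda>j. cbp m (f, c \<odot>\<^bsub>DG\<^esub> w) n j) Y"
proof -
  let ?L = "\<lambda>f w. tensor_lift CH (\<lambda>j. cbp m (f, w) n j)"
  interpret D: Module.module CC DG by (rule DG_module)
  have cl: "?L f w Y \<in> carrier CH" if "w \<in> carrier DG" "Y \<in> carrier EE" for f w Y
    by (rule amap_closed[OF inner_lift(1)[OF that(1)] that(2)])
  have Dadd: "w \<oplus>\<^bsub>DG\<^esub> w' \<in> carrier DG" if "w \<in> carrier DG" "w' \<in> carrier DG" for w w'
    using that by (rule TP.N.a_closed)
  have Dsm: "c \<odot>\<^bsub>DG\<^esub> w \<in> carrier DG" if "w \<in> carrier DG" for w c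
    using that D.smult_closed[of c w] by simp
  have 1: "?L f (w1 \<oplus>\<^bsub>DG\<^esub> w2) Y = ?L f w1 Y \<oplus>\<^bsub>CH\<^esub> ?L f w2 Y" if "w1 \<in> carrier DG" "w2 \<in> carrier DG" for w1 w2
    using Y
  proof (induction rule: EE_induct)
    case (pure g w)
    then show ?case using that by (simp add: inner_lift(2) Dadd cbp_add_w del: DG_simps)
  next
    case (add X Y)
    then show ?case using that
      by (simp add: amap_add[OF inner_lift(1)] Dadd cl CH.a_ac del: DG_simps)
  qed
  have 2: "?L (f + f') w Y = ?L f w Y \<oplus>\<^bsub>CH\<^esub> ?L f' w Y" if "w \<in> carrier DG" for f f' w
    using Y
  proof (induction rule: EE_induct)
    case (pure g w)
    then show ?case using that by (simp add: inner_lift(2) cbp_add_f del: DG_simps)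
  next
    case (add X Y)
    then show ?case using that
      by (simp add: amap_add[OF inner_lift(1)] cl CH.a_ac del: DG_simps)
  qed
  show "amap DG CH (\<lambda>w. ?L f w Y)"
    by (rule amapI) (simp_all add: 1 cl Y del: DG_simps)
  show "w \<in> carrier DG \<Longrightarrow> amap KK CH (\<lambda>f. ?L f w Y)"
    by (rule amapI) (simp_all add: 2 cl Y del: DG_simps)
  show "?L (f * fls_const c) w Y = ?L f (c \<odot>\<^bsub>DG\<^esub> w) Y" if "w \<in> carrier DG"
    using Y
  proof (induction rule: EE_induct)
    case (pure g w)
    then show ?case using that by (simp add: inner_lift(2) Dsm cbp_balanced del: DG_simps)
  next
    case (add X Y)
    then show ?case using that
      by (simp add: amap_add[OF inner_lift(1)] Dsm del: DG_simps)
  qed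
qed

lemma amap_brk1: "Y \<in> carrier EE \<Longrightarrow> amap EE CH (\<lambda>X. brk m n X Y)"
  unfolding brk_def by (rule EE_lift[OF CH.abelian_group_axioms]) (auto intro: inner_props simp del: DG_simps)

lemma brk_ep_left: "Y \<in> carrier EE \<Longrightarrow> w \<in> carrier DG \<Longrightarrow>
    brk m n (ep f w) Y = tensor_lift CH (\<lambda>j. cbp m (f, w) n j) Y"
  unfolding brk_def by (rule EE_lift[OF CH.abelian_group_axioms]) (auto intro: inner_props simp del: DG_simps)

lemma brk_ep: "w \<in> carrier DG \<Longrightarrow> w' \<in> carrier DG \<Longrightarrow> brk m n (ep f w) (ep g w') = cbp m (f, w) n (g, w')"
  by (subst brk_ep_left) (auto simp: inner_lift simp del: DG_simps check_bracket_pure.simps)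

lemma brk_closed [simp]: "X \<in> carrier EE \<Longrightarrow> Y \<in> carrier EE \<Longrightarrow> brk m n X Y \<in> carrier CH"
  by (rule amap_closed[OF amap_brk1])

lemma amap_brk2: "X \<in> carrier EE \<Longrightarrow> amap EE CH (\<lambda>Y. brk m n X Y)"
proof (rule amapI)
  fix Y Y' assume X: "X \<in> carrier EE" and Y: "Y \<in> carrier EE" "Y' \<in> carrier EE"
  from X show "brk m n X (Y \<oplus>\<^bsub>EE\<^esub> Y') = brk m n X Y \<oplus>\<^bsub>CH\<^esub> brk m n X Y'"
  proof (induction rule: EE_induct)
    case (pure f w)
    then show ?case using Y by (simp add: brk_ep_left amap_add[OF inner_lift(1)] del: DG_simps)
  next
    case (add X X')
    then show ?case using Y by (simp add: amap_add[OF amap_brk1] CH.a_ac)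
  qed
qed simp

abbreviation LL where "LL \<equiv> check_alg G B p"
abbreviation br where "br \<equiv> check_bracket G B p"

lemma LL_simps: "carrier LL = carrier CH" "add LL = add CH" "\<zero>\<^bsub>LL\<^esub> = \<zero>\<^bsub>CH\<^esub>" "module.smult LL = module.smult CH"
  "lie_bracket LL = br"
  by (simp_all add: check_alg_def module.defs lie_alg.defs)

lemma brk_zero [simp]: "X \<in> carrier EE \<Longrightarrow> brk m n X \<zero>\<^bsub>EE\<^esub> = \<zero>\<^bsub>CH\<^esub>"
   "Y \<in> carrier EE \<Longrightarrow> brk m n \<zero>\<^bsub>EE\<^esub> Y = \<zero>\<^bsub>CH\<^esub>"
  using amap_zero[OF EE.abelian_group_axioms CH.abelian_group_axioms amap_brk2]
    amap_zero[OF EE.abelian_group_axioms CH.abelian_group_axioms amap_brk1] by auto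

text \<open>A common finite index set for several elements turns additivity of the bracket into a
  termwise statement.\<close>

lemma br_superset:
  assumes xy: "x \<in> carrier CH" "y \<in> carrier CH"
    and "finite M" "finite N" "{n. fst x n \<noteq> \<zero>\<^bsub>EE\<^esub>} \<subseteq> M" "{n. fst y n \<noteq> \<zero>\<^bsub>EE\<^esub>} \<subseteq> N"
  shows "br x y = (\<Oplus>\<^bsub>CH\<^esub> m\<in>M. \<Oplus>\<^bsub>CH\<^esub> n\<in>N. brk m n (fst x m) (fst y n))"
proof -
  have c: "fst x m \<in> carrier EE" "fst y m \<in> carrier EE" for m using xy by (auto simp: CH_simps)
  have inner: "(\<Oplus>\<^bsub>CH\<^esub> n\<in>{n. fst y n \<noteq> \<zero>\<^bsub>EE\<^esub>}. brk m n (fst x m) (fst y n))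
      = (\<Oplus>\<^bsub>CH\<^esub> n\<in>N. brk m n (fst x m) (fst y n))" for m
    by (rule CH.add.finprod_mono_neutral_cong_left) (use assms c in auto)
  have "br x y = (\<Oplus>\<^bsub>CH\<^esub> m\<in>{m. fst x m \<noteq> \<zero>\<^bsub>EE\<^esub>}. \<Oplus>\<^bsub>CH\<^esub> n\<in>{n. fst y n \<noteq> \<zero>\<^bsub>EE\<^esub>}. brk m n (fst x m) (fst y n))"
    by (simp add: check_bracket_def Let_def brk_def)
  also have "\<dots> = (\<Oplus>\<^bsub>CH\<^esub> m\<in>M. \<Oplus>\<^bsub>CH\<^esub> n\<in>N. brk m n (fst x m) (fst y n))"
    unfolding inner
    by (rule CH.add.finprod_mono_neutral_cong_left) (use assms c in \<open>auto intro!: CH.finsum_closed\<close>)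
  finally show ?thesis .
qed

lemma br_closed [simp]:
  assumes "x \<in> carrier CH" "y \<in> carrier CH" shows "br x y \<in> carrier CH"
proof -
  have "finite {n. fst x n \<noteq> \<zero>\<^bsub>EE\<^esub>}" "finite {n. fst y n \<noteq> \<zero>\<^bsub>EE\<^esub>}"
    "\<And>n. fst x n \<in> carrier EE" "\<And>n. fst y n \<in> carrier EE"
    using assms by (auto simp: CH_simps)
  then show ?thesis
    using br_superset[OF assms] by (auto intro!: CH.finsum_closed)
qed

lemma fst_add: "x \<in> carrier CH \<Longrightarrow> y \<in> carrier CH \<Longrightarrow> fst (x \<oplus>\<^bsub>CH\<^esub> y) n = fst x n \<oplus>\<^bsub>EE\<^esub> fst y n"
  by (cases x; cases y) (simp add: CH_simps)

lemma br_add: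
  assumes "x \<in> carrier CH" "x' \<in> carrier CH" "y \<in> carrier CH"
  shows "br (x \<oplus>\<^bsub>CH\<^esub> x') y = br x y \<oplus>\<^bsub>CH\<^esub> br x' y" "br y (x \<oplus>\<^bsub>CH\<^esub> x') = br y x \<oplus>\<^bsub>CH\<^esub> br y x'"
proof -
  define M where "M = {n. fst x n \<noteq> \<zero>\<^bsub>EE\<^esub>} \<union> {n. fst x' n \<noteq> \<zero>\<^bsub>EE\<^esub>} \<union> {n. fst y n \<noteq> \<zero>\<^bsub>EE\<^esub>}"
  have c: "fst x m \<in> carrier EE" "fst x' m \<in> carrier EE" "fst y m \<in> carrier EE" for m
    using assms by (auto simp: CH_simps)
  have M: "finite M" using assms by (auto simp: CH_simps M_def)
  have s: "{n. fst x n \<noteq> \<zero>\<^bsub>EE\<^esub>} \<subseteq> M" "{n. fst x' n \<noteq> \<zero>\<^bsub>EE\<^esub>} \<subseteq> M" "{n. fst y n \<noteq> \<zero>\<^bsub>EE\<^esub>} \<subseteq> M"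
    "{n. fst (x \<oplus>\<^bsub>CH\<^esub> x') n \<noteq> \<zero>\<^bsub>EE\<^esub>} \<subseteq> M"
    using assms by (auto simp: M_def fst_add)
  have a: "x \<oplus>\<^bsub>CH\<^esub> x' \<in> carrier CH" using assms by simp
  show "br (x \<oplus>\<^bsub>CH\<^esub> x') y = br x y \<oplus>\<^bsub>CH\<^esub> br x' y"
    unfolding br_superset[OF a assms(3) M M s(4,3)] br_superset[OF assms(1,3) M M s(1,3)]
      br_superset[OF assms(2,3) M M s(2,3)]
    using c by (simp add: fst_add assms amap_add[OF amap_brk1] CH.finsum_addf CH.finsum_closed Pi_def)
  show "br y (x \<oplus>\<^bsub>CH\<^esub> x') = br y x \<oplus>\<^bsub>CH\<^esub> br y x'"
    unfolding br_superset[OF assms(3) a M M s(3,4)] br_superset[OF assms(3,1) M M s(3,1)]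
      br_superset[OF assms(3,2) M M s(3,2)]
    using c by (simp add: fst_add assms amap_add[OF amap_brk2] CH.finsum_addf CH.finsum_closed Pi_def)
qed

lemma br_cen [simp]: "y \<in> carrier CH \<Longrightarrow> br (cen h) y = \<zero>\<^bsub>CH\<^esub>" "x \<in> carrier CH \<Longrightarrow> br x (cen h) = \<zero>\<^bsub>CH\<^esub>"
proof -
  assume y: "y \<in> carrier CH"
  have "finite {n. fst y n \<noteq> \<zero>\<^bsub>EE\<^esub>}" using y by (auto simp: CH_simps)
  then show "br (cen h) y = \<zero>\<^bsub>CH\<^esub>"
    using br_superset[OF cen_closed[of h] y finite.emptyI] by (simp add: cen_def)
next
  assume x: "x \<in> carrier CH"
  have "finite {n. fst x n \<noteq> \<zero>\<^bsub>EE\<^esub>}" using x by (auto simp: CH_simps)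
  then show "br x (cen h) = \<zero>\<^bsub>CH\<^esub>"
    using br_superset[OF x cen_closed[of h] _ finite.emptyI] by (simp add: cen_def)
qed

lemma br_mono: "X \<in> carrier EE \<Longrightarrow> Y \<in> carrier EE \<Longrightarrow> br (mono X m) (mono Y n) = brk m n X Y"
proof -
  assume XY: "X \<in> carrier EE" "Y \<in> carrier EE"
  have s: "{r. fst (mono X m) r \<noteq> \<zero>\<^bsub>EE\<^esub>} \<subseteq> {m}" for X m
    by (rule subsetI, rule ccontr) (simp add: mono_def)
  have "br (mono X m) (mono Y n) = (\<Oplus>\<^bsub>CH\<^esub> i\<in>{m}. \<Oplus>\<^bsub>CH\<^esub> j\<in>{n}. brk i j (fst (mono X m) i) (fst (mono Y n) j))"
    by (rule br_superset[OF _ _ _ _ s s]) (simp_all add: XY)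
  then show ?thesis using XY by (simp add: mono_def)
qed

lemma br_mono_ep: "w \<in> carrier DG \<Longrightarrow> w' \<in> carrier DG \<Longrightarrow>
   br (mono (ep f w) m) (mono (ep g w') n) = cbp m (f, w) n (g, w')"
  by (simp add: br_mono brk_ep del: DG_simps check_bracket_pure.simps)

text \<open>If m = n = 0, the factor m and the index -1 at p' remove the central term; otherwise m +
  n > 0, the delta is 0 and all indices at p and p' are negative. So nonnegative exponents span,
  with the central line, a subalgebra whose brackets have no central part.\<close>

lemma cbp_nonneg:
  assumes "0 \<le> m" "0 \<le> n" "w \<in> carrier DG" "w' \<in> carrier DG"
  shows "r < 0 \<Longrightarrow> fst (cbp m (f, w) n (g, w')) r = \<zero>\<^bsub>EE\<^esub>" "snd (cbp m (f, w) n (g, w')) = 0"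
proof -
  have "m = 0 \<and> n = 0 \<or> - m - n < 0" using assms by linarith
  then show "snd (cbp m (f, w) n (g, w')) = 0"
    by (elim disjE) (simp_all add: cbp_eq cc_def del: DG_simps check_bracket_pure.simps)
  show "r < 0 \<Longrightarrow> fst (cbp m (f, w) n (g, w')) r = \<zero>\<^bsub>EE\<^esub>"
    using assms by (simp add: cbp_eq del: DG_simps check_bracket_pure.simps)
qed

lemma br_borel:
  assumes x: "x \<in> carrier CH" "\<And>n. n < 0 \<Longrightarrow> fst x n = \<zero>\<^bsub>EE\<^esub>"
    and y: "y \<in> carrier CH" "\<And>n. n < 0 \<Longrightarrow> fst y n = \<zero>\<^bsub>EE\<^esub>"
  shows "(\<forall>r<0. fst (br x y) r = \<zero>\<^bsub>EE\<^esub>) \<and> snd (br x y) = 0"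
proof -
  have snd_add: "snd (a \<oplus>\<^bsub>CH\<^esub> b) = snd a + snd b" for a b by (cases a; cases b) (simp add: CH_simps)
  have 0: "fst \<zero>\<^bsub>CH\<^esub> r = \<zero>\<^bsub>EE\<^esub>" "snd \<zero>\<^bsub>CH\<^esub> = 0" for r by (simp_all add: CH_simps)
  show ?thesis
  proof (rule CH_induct[of x "{0..}"])
    show "n \<notin> {0..} \<Longrightarrow> fst x n = \<zero>\<^bsub>EE\<^esub>" for n using x(2) by simp
    show "(\<forall>r<0. fst (br (cen h) y) r = \<zero>\<^bsub>EE\<^esub>) \<and> snd (br (cen h) y) = 0" for h
      using y by (simp add: 0)
    fix f w m assume w: "w \<in> carrier DG" "m \<in> {0::int..}"
    show "(\<forall>r<0. fst (br (mono (ep f w) m) y) r = \<zero>\<^bsub>EE\<^esub>) \<and> snd (br (mono (ep f w) m) y) = 0"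
    proof (rule CH_induct[of y "{0..}"])
      show "n \<notin> {0..} \<Longrightarrow> fst y n = \<zero>\<^bsub>EE\<^esub>" for n using y(2) by simp
      show "(\<forall>r<0. fst (br (mono (ep f w) m) (cen h)) r = \<zero>\<^bsub>EE\<^esub>) \<and> snd (br (mono (ep f w) m) (cen h)) = 0" for h
        using w by (simp add: 0 del: DG_simps)
      show "(\<forall>r<0. fst (br (mono (ep f w) m) (mono (ep g w') n)) r = \<zero>\<^bsub>EE\<^esub>) \<and>
         snd (br (mono (ep f w) m) (mono (ep g w') n)) = 0" if "w' \<in> carrier DG" "n \<in> {0..}" for g w' n
        using w that by (simp add: br_mono_ep cbp_nonneg del: DG_simps check_bracket_pure.simps)
    qed (use w y in \<open>auto simp: br_add fst_add snd_add simp del: DG_simps\<close>)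
  qed (use x y in \<open>auto simp: br_add fst_add snd_add\<close>)
qed

section \<open>The derivation d/dz - d/dt of the Lie algebra\<close>

definition dE :: "'g ext \<Rightarrow> 'g ext" where
  "dE = tensor_lift EE (\<lambda>(f, w). ep (fls_deriv f) w)"

lemma dE: "amap EE EE dE" "w \<in> carrier DG \<Longrightarrow> dE (ep f w) = ep (fls_deriv f) w"
  unfolding dE_def
  by (rule EE_lift[OF EE.abelian_group_axioms, of "\<lambda>(f, w). ep (fls_deriv f) w", unfolded prod.case];
      auto intro!: amapI simp: ep_add_left ep_add_right ep_balanced simp del: DG_simps)+

text \<open>The term -n t^(n-1) lands at exponent r = n - 1, hence the factor -(r + 1) and the
  coefficient at r + 1. On the central line the map is d/dz.\<close>

definition dC :: "'g chk \<Rightarrow> 'g chk" where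
  "dC x = ((\<lambda>r. dE (fst x r) \<oplus>\<^bsub>EE\<^esub> (- of_int (r + 1)) \<odot>\<^bsub>EE\<^esub> fst x (r + 1)), fls_deriv (snd x))"

lemma dE_zero [simp]: "dE \<zero>\<^bsub>EE\<^esub> = \<zero>\<^bsub>EE\<^esub>"
  by (rule amap_zero[OF EE.abelian_group_axioms EE.abelian_group_axioms dE(1)])

lemma dE_closed [simp]: "X \<in> carrier EE \<Longrightarrow> dE X \<in> carrier EE"
  by (rule amap_closed[OF dE(1)])

lemma amap_dC: "amap CH CH dC"
proof (rule amapI)
  fix x assume x: "x \<in> carrier CH"
  then have c: "\<And>n. fst x n \<in> carrier EE" and f: "finite {n. fst x n \<noteq> \<zero>\<^bsub>EE\<^esub>}" by (auto simp: CH_simps)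
  have "finite {r. dE (fst x r) \<oplus>\<^bsub>EE\<^esub> (- of_int (r + 1)) \<odot>\<^bsub>EE\<^esub> fst x (r + 1) \<noteq> \<zero>\<^bsub>EE\<^esub>}"
  proof (rule finite_subset)
    show "finite ({n. fst x n \<noteq> \<zero>\<^bsub>EE\<^esub>} \<union> (\<lambda>n. n - 1) ` {n. fst x n \<noteq> \<zero>\<^bsub>EE\<^esub>})" using f by simp
    show "{r. dE (fst x r) \<oplus>\<^bsub>EE\<^esub> (- of_int (r + 1)) \<odot>\<^bsub>EE\<^esub> fst x (r + 1) \<noteq> \<zero>\<^bsub>EE\<^esub>}
        \<subseteq> {n. fst x n \<noteq> \<zero>\<^bsub>EE\<^esub>} \<union> (\<lambda>n. n - 1) ` {n. fst x n \<noteq> \<zero>\<^bsub>EE\<^esub>}"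
    proof
      fix r assume r: "r \<in> {r. dE (fst x r) \<oplus>\<^bsub>EE\<^esub> (- of_int (r + 1)) \<odot>\<^bsub>EE\<^esub> fst x (r + 1) \<noteq> \<zero>\<^bsub>EE\<^esub>}"
      show "r \<in> {n. fst x n \<noteq> \<zero>\<^bsub>EE\<^esub>} \<union> (\<lambda>n. n - 1) ` {n. fst x n \<noteq> \<zero>\<^bsub>EE\<^esub>}"
      proof (cases "fst x (r + 1) = \<zero>\<^bsub>EE\<^esub>")
        case True
        then show ?thesis using r by auto
      next
        case False
        then have "r + 1 - 1 \<in> (\<lambda>n. n - 1) ` {n. fst x n \<noteq> \<zero>\<^bsub>EE\<^esub>}" by (intro imageI) simp
        then show ?thesis by simp
      qed
    qed
  qed
  then show "dC x \<in> carrier CH" using c by (simp add: dC_def CH_simps)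
next
  fix x y assume xy: "x \<in> carrier CH" "y \<in> carrier CH"
  then have c: "\<And>n. fst x n \<in> carrier EE" "\<And>n. fst y n \<in> carrier EE" by (auto simp: CH_simps)
  obtain u h v k where e: "x = (u, h)" "y = (v, k)" by (cases x; cases y)
  show "dC (x \<oplus>\<^bsub>CH\<^esub> y) = dC x \<oplus>\<^bsub>CH\<^esub> dC y"
    using c by (simp add: e dC_def CH_simps amap_add[OF dE(1)] amap_add[OF amap_EE_smult] EE.a_ac)
qed

lemma dC_closed [simp]: "x \<in> carrier CH \<Longrightarrow> dC x \<in> carrier CH"
  by (rule amap_closed[OF amap_dC])

lemma dC_cen: "dC (cen h) = cen (fls_deriv h)"
  by (simp add: dC_def cen_def fun_eq_iff)

lemma dC_mono_ep: "w \<in> carrier DG \<Longrightarrow>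
    dC (mono (ep f w) n) = mono (ep (fls_deriv f) w) n \<oplus>\<^bsub>CH\<^esub> mono (ep (- of_int n * f) w) (n - 1)"
  by (auto simp: dC_def mono_def CH_simps dE ep_smult fun_eq_iff simp del: DG_simps)

lemma dC_smult: "x \<in> carrier CH \<Longrightarrow> dC (f \<odot>\<^bsub>CH\<^esub> x) = fls_deriv f \<odot>\<^bsub>CH\<^esub> x \<oplus>\<^bsub>CH\<^esub> f \<odot>\<^bsub>CH\<^esub> dC x"
proof (rule CH_induct[of x UNIV])
  show "dC (f \<odot>\<^bsub>CH\<^esub> cen h) = fls_deriv f \<odot>\<^bsub>CH\<^esub> cen h \<oplus>\<^bsub>CH\<^esub> f \<odot>\<^bsub>CH\<^esub> dC (cen h)" for h
    by (simp add: smult_cen dC_cen amap_add[OF amap_cen, symmetric, simplified] add.commute)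
  show "dC (f \<odot>\<^bsub>CH\<^esub> mono (ep g w) n) = fls_deriv f \<odot>\<^bsub>CH\<^esub> mono (ep g w) n \<oplus>\<^bsub>CH\<^esub> f \<odot>\<^bsub>CH\<^esub> dC (mono (ep g w) n)"
    if "w \<in> carrier DG" for g w n
    using that by (simp add: smult_mono dC_mono_ep ep_smult CH.smult_r_distr ep_add_left amap_add[OF amap_mono]
        CH.a_ac mult.left_commute add.commute del: DG_simps)
qed (auto simp: amap_add[OF amap_dC] CH.smult_r_distr CH.a_ac)

lemma cbp_fst:
  "w \<in> carrier DG \<Longrightarrow> w' \<in> carrier DG \<Longrightarrow> fst (cbp m (f, w) n (g, w')) r =
    ep (if r = m + n then f * g else 0) (W0 w w') \<oplus>\<^bsub>EE\<^esub> ep (f * g * PP (r - m - n)) (W1 w w')"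
  by (simp add: cbp_eq del: DG_simps)

lemma ep_pair_add:
  assumes "w \<in> carrier DG" "w' \<in> carrier DG"
  shows "(ep a w \<oplus>\<^bsub>EE\<^esub> ep b w') \<oplus>\<^bsub>EE\<^esub> (ep c w \<oplus>\<^bsub>EE\<^esub> ep d w') = ep (a + c) w \<oplus>\<^bsub>EE\<^esub> ep (b + d) w'"
  using assms by (simp add: ep_add_left EE.a_ac del: DG_simps)

text \<open>The three summands of \<open>cc\<close> are compatible with the derivation separately:
  those with p' and p by \<open>shift_coeff_deriv\<close>, the one with the delta because its two
  contributions both sit at m + n = 1 and cancel there (\<open>z\<close>).\<close>

lemma fls_deriv_cc: "fls_deriv (cc m n w w') = - of_int m * cc (m - 1) n w w' - of_int n * cc m (n - 1) w w'"
proof -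
  let ?Q = "shift_coeff (fls_of_poly (pderiv p))"
  have d: "fls_deriv (of_int m * fls_const c * (if m + n = 0 then 1 else 0)) = 0" for c :: complex
    by simp
  have Q: "fls_deriv (?Q (- m - n - 1)) = of_int (- m - n) * ?Q (- m - n)"
    using shift_coeff_deriv[of _ "- m - n - 1"] by simp
  have P: "fls_deriv (PP (- m - n)) = of_int (1 - m - n) * PP (1 - m - n)"
    using shift_coeff_deriv[of _ "- m - n"] by (simp add: algebra_simps)
  have z: "of_int m * (of_int (m - 1) * x * (if m - 1 + n = 0 then 1 else 0))
     + of_int n * (of_int m * x * (if m + (n - 1) = 0 then 1 else 0)) = (0 :: complex fls)" for x
  proof (cases "m - 1 + n = 0")
    case True
    then have "n = 1 - m" by simp
    show ?thesis unfolding \<open>n = 1 - m\<close> by (simp add: algebra_simps)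
  next
    case False
    then have "m + (n - 1) \<noteq> 0" by simp
    then show ?thesis using False by simp
  qed
  have i: "- (m - 1) - n - 1 = - m - n" "- m - (n - 1) - 1 = - m - n"
    "- (m - 1) - n = 1 - m - n" "- m - (n - 1) = 1 - m - n" "1 - m - n - 1 = - m - n" by simp_all
  define C0 C1 q P1 d1 d2 :: "complex fls" where "C0 = fls_const (c0 w w')" and "C1 = fls_const (c1 w w')"
    and "q = ?Q (- m - n)" and "P1 = PP (1 - m - n)"
    and "d1 = (if m - 1 + n = 0 then 1 else 0)" and "d2 = (if m + (n - 1) = 0 then 1 else 0)"
  note C = C0_def[symmetric] C1_def[symmetric] q_def[symmetric] P1_def[symmetric] d1_def[symmetric] d2_def[symmetric]
  have "fls_deriv (cc m n w w') = fls_const (1/2) * fls_const (c1 w w') * (of_int (- m - n) * ?Q (- m - n))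
      + of_int m * fls_const (c1 w w') * (of_int (1 - m - n) * PP (1 - m - n))"
    unfolding cc_def by (simp only: fls_deriv_add d fls_deriv_mult Q P fls_deriv_const fls_deriv_of_int) simp
  moreover have "- of_int m * cc (m - 1) n w w' - of_int n * cc m (n - 1) w w'
     = fls_const (1/2) * fls_const (c1 w w') * (of_int (- m - n) * ?Q (- m - n))
      + of_int m * fls_const (c1 w w') * (of_int (1 - m - n) * PP (1 - m - n))
      - (of_int m * (of_int (m - 1) * fls_const (c0 w w') * (if m - 1 + n = 0 then 1 else 0))
     + of_int n * (of_int m * fls_const (c0 w w') * (if m + (n - 1) = 0 then 1 else 0)))"
    unfolding cc_def by (simp only: i C) (simp add: algebra_simps)
  ultimately show ?thesis by (simp only: z diff_zero)
qed

text \<open>The parts along \<open>W0\<close>, along \<open>W1\<close> and along the central element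
  are compared separately. Along \<open>W1\<close>, differentiating the coefficient of p(z + x)
  produces the factor r + 1 - m - n, which with -(r + 1) leaves -m - n: the invariance of p(z + t)
  under d/dz - d/dt.\<close>

lemma dC_br_pure:
  assumes w: "w \<in> carrier DG" "w' \<in> carrier DG"
  shows "dC (cbp m (f, w) n (g, w')) =
    (cbp m (fls_deriv f, w) n (g, w') \<oplus>\<^bsub>CH\<^esub> cbp (m - 1) (- of_int m * f, w) n (g, w'))
    \<oplus>\<^bsub>CH\<^esub> (cbp m (f, w) n (fls_deriv g, w') \<oplus>\<^bsub>CH\<^esub> cbp m (f, w) (n - 1) (- of_int n * g, w'))"
  (is "dC ?x = ?y")
proof (rule prod_eqI)
  have snd_add: "snd (a \<oplus>\<^bsub>CH\<^esub> b) = snd a + snd b" for a b by (cases a; cases b) (simp add: CH_simps)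
  have s: "snd (cbp m (f, w) n (g, w')) = f * g * cc m n w w'" for f g m n by (simp add: cbp_eq)
  show "snd (dC ?x) = snd ?y"
    by (simp add: dC_def snd_add s fls_deriv_cc algebra_simps del: check_bracket_pure.simps)
  show "fst (dC ?x) = fst ?y"
  proof
    fix r
    note [simp] = W_closed[OF w]
    have "fst (dC ?x) r = (ep (fls_deriv (if r = m + n then f * g else 0)) (W0 w w') \<oplus>\<^bsub>EE\<^esub> ep (fls_deriv (f * g * PP (r - m - n))) (W1 w w'))
       \<oplus>\<^bsub>EE\<^esub> (ep (- of_int (r + 1) * (if r + 1 = m + n then f * g else 0)) (W0 w w')
         \<oplus>\<^bsub>EE\<^esub> ep (- of_int (r + 1) * (f * g * PP (r + 1 - m - n))) (W1 w w'))"
      using w by (simp only: dC_def fst_conv cbp_fst amap_add[OF dE(1)] ep_closed W_closed dE(2)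
          amap_add[OF amap_EE_smult] ep_smult)
    also have "\<dots> = ep (fls_deriv (if r = m + n then f * g else 0) + - of_int (r + 1) * (if r + 1 = m + n then f * g else 0)) (W0 w w')
        \<oplus>\<^bsub>EE\<^esub> ep (fls_deriv (f * g * PP (r - m - n)) + - of_int (r + 1) * (f * g * PP (r + 1 - m - n))) (W1 w w')"
      by (rule ep_pair_add[OF W_closed[OF w]])
    also have "fls_deriv (if r = m + n then f * g else 0) + - of_int (r + 1) * (if r + 1 = m + n then f * g else 0)
      = ((if r = m + n then fls_deriv f * g else 0) + (if r = m - 1 + n then - of_int m * f * g else 0))
        + ((if r = m + n then f * fls_deriv g else 0) + (if r = m + (n - 1) then f * (- of_int n * g) else 0))"
    proof -
      consider "r = m + n" | "r = m + n - 1" | "r \<noteq> m + n" "r \<noteq> m + n - 1" by blast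
      then show ?thesis by cases (auto simp: algebra_simps)
    qed
    also have "fls_deriv (f * g * PP (r - m - n)) + - of_int (r + 1) * (f * g * PP (r + 1 - m - n))
      = (fls_deriv f * g * PP (r - m - n) + - of_int m * f * g * PP (r - (m - 1) - n))
        + (f * fls_deriv g * PP (r - m - n) + f * (- of_int n * g) * PP (r - m - (n - 1)))"
    proof -
      have i: "r - (m - 1) - n = r + 1 - m - n" "r - m - (n - 1) = r + 1 - m - n" by simp_all
      have d: "fls_deriv (PP (r - m - n)) = of_int (r + 1 - m - n) * PP (r + 1 - m - n)"
        using shift_coeff_deriv[of _ "r - m - n"] by (simp add: algebra_simps)
      show ?thesis unfolding fls_deriv_mult d i of_int_diff of_int_add of_int_1 by (simp add: algebra_simps)
    qed
    also have "ep (((if r = m + n then fls_deriv f * g else 0) + (if r = m - 1 + n then - of_int m * f * g else 0))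
        + ((if r = m + n then f * fls_deriv g else 0) + (if r = m + (n - 1) then f * (- of_int n * g) else 0))) (W0 w w')
        \<oplus>\<^bsub>EE\<^esub> ep ((fls_deriv f * g * PP (r - m - n) + - of_int m * f * g * PP (r - (m - 1) - n))
        + (f * fls_deriv g * PP (r - m - n) + f * (- of_int n * g) * PP (r - m - (n - 1)))) (W1 w w') = fst ?y r"
      using w by (simp only: fst_add cbp_closed CH_add_closed cbp_fst ep_pair_add W_closed)
    finally show "fst (dC ?x) r = fst ?y r" .
  qed
qed

lemma dC_br:
  assumes x: "x \<in> carrier CH" and y: "y \<in> carrier CH"
  shows "dC (br x y) = br (dC x) y \<oplus>\<^bsub>CH\<^esub> br x (dC y)"
proof (rule CH_induct[of x UNIV])
  have z: "dC \<zero>\<^bsub>CH\<^esub> = \<zero>\<^bsub>CH\<^esub>"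
    by (rule amap_zero[OF CH.abelian_group_axioms CH.abelian_group_axioms amap_dC])
  show "dC (br (cen h) y) = br (dC (cen h)) y \<oplus>\<^bsub>CH\<^esub> br (cen h) (dC y)" for h
    using y by (simp add: dC_cen z)
  fix f w m assume w: "w \<in> carrier DG"
  show "dC (br (mono (ep f w) m) y) = br (dC (mono (ep f w) m)) y \<oplus>\<^bsub>CH\<^esub> br (mono (ep f w) m) (dC y)"
  proof (rule CH_induct[of y UNIV])
    show "dC (br (mono (ep f w) m) (cen h)) =
        br (dC (mono (ep f w) m)) (cen h) \<oplus>\<^bsub>CH\<^esub> br (mono (ep f w) m) (dC (cen h))" for h
      using w by (simp add: dC_cen z del: DG_simps)
    show "dC (br (mono (ep f w) m) (mono (ep g w') n)) =
        br (dC (mono (ep f w) m)) (mono (ep g w') n) \<oplus>\<^bsub>CH\<^esub> br (mono (ep f w) m) (dC (mono (ep g w') n))"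
      if "w' \<in> carrier DG" for g w' n
      using w that by (simp add: br_mono_ep br_add dC_mono_ep dC_br_pure del: DG_simps check_bracket_pure.simps)
  qed (use w y in \<open>auto simp: br_add amap_add[OF amap_dC] CH.a_ac simp del: DG_simps\<close>)
qed (use x y in \<open>auto simp: br_add amap_add[OF amap_dC] CH.a_ac\<close>)

end

section \<open>Free algebras and enveloping algebras\<close>

abbreviation FA :: "'b set \<Rightarrow> ('b list \<Rightarrow> 'k::comm_ring_1) ring" where
  "FA A \<equiv> free_algebra type_ring A"

lemma FA_simps:
  "x \<in> carrier (FA A) \<longleftrightarrow> finite {w. x w \<noteq> 0} \<and> (\<forall>w. x w \<noteq> 0 \<longrightarrow> set w \<subseteq> A)"
  "x \<otimes>\<^bsub>FA A\<^esub> y = (\<lambda>w. \<Sum>i\<le>length w. x (take i w) * y (drop i w))"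
  "\<one>\<^bsub>FA A\<^esub> = (\<lambda>w. if w = [] then 1 else 0)"
  "\<zero>\<^bsub>FA A\<^esub> = (\<lambda>w. 0)"
  "x \<oplus>\<^bsub>FA A\<^esub> y = (\<lambda>w. x w + y w)"
  by (simp_all add: free_algebra_def cong: if_cong)

lemma FA_mult_supp:
  assumes "x \<in> carrier (FA A)" "y \<in> carrier (FA A)"
  shows "x \<otimes>\<^bsub>FA A\<^esub> y \<in> carrier (FA A)"
proof -
  have s: "\<exists>u v. w = u @ v \<and> x u \<noteq> 0 \<and> y v \<noteq> 0" if nz: "(x \<otimes>\<^bsub>FA A\<^esub> y) w \<noteq> 0" for w
  proof -
    have "(\<Sum>i\<le>length w. x (take i w) * y (drop i w)) \<noteq> 0" using nz by (simp add: FA_simps)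
    then obtain i where "x (take i w) * y (drop i w) \<noteq> 0" by (meson sum.not_neutral_contains_not_neutral)
    then have "x (take i w) \<noteq> 0" "y (drop i w) \<noteq> 0" by auto
    then show ?thesis by (metis append_take_drop_id)
  qed
  have "{w. (x \<otimes>\<^bsub>FA A\<^esub> y) w \<noteq> 0} \<subseteq> (\<lambda>(u, v). u @ v) ` ({w. x w \<noteq> 0} \<times> {w. y w \<noteq> 0})"
    using s by fastforce
  then have "finite {w. (x \<otimes>\<^bsub>FA A\<^esub> y) w \<noteq> 0}"
    by (rule finite_subset) (use assms in \<open>simp add: FA_simps(1)\<close>)
  moreover have "set w \<subseteq> A" if nz: "(x \<otimes>\<^bsub>FA A\<^esub> y) w \<noteq> 0" for w
  proof -
    obtain u v where "w = u @ v" "x u \<noteq> 0" "y v \<noteq> 0" using s[OF nz] by blast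
    then show ?thesis using assms by (simp add: FA_simps(1))
  qed
  ultimately show ?thesis by (simp only: FA_simps(1)) blast
qed

lemma FA_add_supp:
  assumes "x \<in> carrier (FA A)" "y \<in> carrier (FA A)"
  shows "(\<lambda>w. x w + y w) \<in> carrier (FA A)"
proof -
  have "finite {w. x w + y w \<noteq> 0}"
    by (rule finite_subset[of _ "{w. x w \<noteq> 0} \<union> {w. y w \<noteq> 0}"]) (use assms in \<open>auto simp: FA_simps(1)\<close>)
  moreover have "set w \<subseteq> A" if "x w + y w \<noteq> 0" for w
  proof -
    have "x w \<noteq> 0 \<or> y w \<noteq> 0" using that by auto
    then show ?thesis using assms by (auto simp: FA_simps(1))
  qed
  ultimately show ?thesis by (simp add: FA_simps(1))
qed

text \<open>Both sides sum over the ways to cut \<open>w\<close> into three consecutive pieces,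
  whose lengths are the arguments of \<open>?f\<close>; the reindexing is the one for products of
  power series.\<close>

lemma FA_mult_assoc:
  "(x \<otimes>\<^bsub>FA A\<^esub> y) \<otimes>\<^bsub>FA A\<^esub> z = x \<otimes>\<^bsub>FA A\<^esub> (y \<otimes>\<^bsub>FA A\<^esub> z)"
proof
  fix w :: "'a list"
  let ?f = "\<lambda>a b c. x (take a w) * y (take b (drop a w)) * z (drop (length w - c) w)"
  have "((x \<otimes>\<^bsub>FA A\<^esub> y) \<otimes>\<^bsub>FA A\<^esub> z) w
      = (\<Sum>j=0..length w. \<Sum>i=0..j. ?f i (j - i) (length w - j))"
    unfolding FA_simps atLeast0AtMost sum_distrib_right
    by (intro sum.cong refl) (auto simp: min_def drop_take)
  also have "\<dots> = (\<Sum>j=0..length w. \<Sum>i=0..length w - j. ?f j i (length w - j - i))"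
    by (rule fps_mult_assoc_lemma)
  also have "\<dots> = (x \<otimes>\<^bsub>FA A\<^esub> (y \<otimes>\<^bsub>FA A\<^esub> z)) w"
    unfolding FA_simps atLeast0AtMost sum_distrib_left
    by (intro sum.cong refl) (auto simp: mult.assoc add.commute)
  finally show "((x \<otimes>\<^bsub>FA A\<^esub> y) \<otimes>\<^bsub>FA A\<^esub> z) w = (x \<otimes>\<^bsub>FA A\<^esub> (y \<otimes>\<^bsub>FA A\<^esub> z)) w" .
qed

lemma FA_one_mult: "\<one>\<^bsub>FA A\<^esub> \<otimes>\<^bsub>FA A\<^esub> x = x" "x \<otimes>\<^bsub>FA A\<^esub> \<one>\<^bsub>FA A\<^esub> = x"
proof -
  show "\<one>\<^bsub>FA A\<^esub> \<otimes>\<^bsub>FA A\<^esub> x = x"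
  proof
    fix w :: "'a list"
    have "(\<one>\<^bsub>FA A\<^esub> \<otimes>\<^bsub>FA A\<^esub> x) w = (\<Sum>i\<le>length w. if i = 0 then x (drop i w) else 0)"
      unfolding FA_simps by (intro sum.cong) auto
    then show "(\<one>\<^bsub>FA A\<^esub> \<otimes>\<^bsub>FA A\<^esub> x) w = x w" by simp
  qed
  show "x \<otimes>\<^bsub>FA A\<^esub> \<one>\<^bsub>FA A\<^esub> = x"
  proof
    fix w :: "'a list"
    have "(x \<otimes>\<^bsub>FA A\<^esub> \<one>\<^bsub>FA A\<^esub>) w = (\<Sum>i\<le>length w. if i = length w then x (take i w) else 0)"
      unfolding FA_simps by (intro sum.cong) auto
    then show "(x \<otimes>\<^bsub>FA A\<^esub> \<one>\<^bsub>FA A\<^esub>) w = x w" by simp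
  qed
qed

lemma FA_ring: "ring (FA A :: ('b list \<Rightarrow> 'k::comm_ring_1) ring)"
proof (rule ringI)
  let ?F = "FA A :: ('b list \<Rightarrow> 'k) ring"
  show "abelian_group ?F"
  proof (rule abelian_groupI)
    fix x :: "'b list \<Rightarrow> 'k" assume "x \<in> carrier ?F"
    then have "(\<lambda>w. - x w) \<in> carrier ?F" by (simp add: FA_simps(1))
    moreover have "(\<lambda>w. - x w) \<oplus>\<^bsub>?F\<^esub> x = \<zero>\<^bsub>?F\<^esub>" by (simp add: FA_simps)
    ultimately show "\<exists>y\<in>carrier ?F. y \<oplus>\<^bsub>?F\<^esub> x = \<zero>\<^bsub>?F\<^esub>" by blast
  next
    show "\<zero>\<^bsub>?F\<^esub> \<in> carrier ?F" by (simp add: FA_simps(1,4))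
    show "x \<oplus>\<^bsub>?F\<^esub> y \<in> carrier ?F" if "x \<in> carrier ?F" "y \<in> carrier ?F" for x y
      unfolding FA_simps(5) using that by (rule FA_add_supp)
  qed (simp_all add: FA_simps(4,5) ac_simps)
  show "Group.monoid ?F"
    by (rule monoidI) (auto simp: FA_mult_supp FA_mult_assoc FA_one_mult, simp add: FA_simps(1,3))
qed (simp_all add: FA_simps sum.distrib distrib_left distrib_right)

lemma FA_uminus: "x \<in> carrier (FA A) \<Longrightarrow> \<ominus>\<^bsub>FA A\<^esub> x = (\<lambda>w. - x w)"
proof -
  interpret ring "FA A :: ('a list \<Rightarrow> 'b) ring" by (rule FA_ring)
  assume "x \<in> carrier (FA A)"
  then show ?thesis by (intro minus_equality) (auto simp: FA_simps)
qed

lemma FA_minus: "y \<in> carrier (FA A) \<Longrightarrow> x \<ominus>\<^bsub>FA A\<^esub> y = (\<lambda>w. x w - y w)"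
  by (simp add: a_minus_def FA_uminus FA_simps(5))

abbreviation wm :: "'k::comm_ring_1 \<Rightarrow> 'b list \<Rightarrow> 'b list \<Rightarrow> 'k" where
  "wm \<equiv> word_monom type_ring"

lemma wm_eq: "wm c v = (\<lambda>w. if w = v then c else 0)"
  by (simp add: word_monom_def cong: if_cong)

lemma wm_closed: "set v \<subseteq> A \<Longrightarrow> wm c v \<in> carrier (FA A)"
  by (auto simp: wm_eq FA_simps(1) intro: finite_subset[of _ "{v}"])

lemma wm_mult: "wm c u \<otimes>\<^bsub>FA A\<^esub> wm d v = wm (c * d) (u @ v)"
proof
  fix w
  have "(wm c u \<otimes>\<^bsub>FA A\<^esub> wm d v) w
      = (\<Sum>i\<le>length w. if i = length u then (if w = u @ v then c * d else 0) else 0)"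
    unfolding FA_simps
  proof (intro sum.cong refl)
    fix i assume i: "i \<in> {..length w}"
    show "wm c u (take i w) * wm d v (drop i w)
       = (if i = length u then (if w = u @ v then c * d else 0) else 0)"
    proof (cases "i = length u")
      case True
      then have "take i w = u \<and> drop i w = v \<longleftrightarrow> w = u @ v"
        by (metis append_eq_conv_conj append_take_drop_id)
      then show ?thesis using True by (auto simp: wm_eq)
    next
      case False
      then have "length (take i w) \<noteq> length u" using i by simp
      then have "take i w \<noteq> u" by blast
      then show ?thesis using False by (simp add: wm_eq)
    qed
  qed
  also have "\<dots> = wm (c * d) (u @ v) w" by (auto simp: wm_eq)
  finally show "(wm c u \<otimes>\<^bsub>FA A\<^esub> wm d v) w = wm (c * d) (u @ v) w" .
qed

lemma one_wm: "\<one>\<^bsub>FA A\<^esub> = wm 1 []"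
  by (auto simp: FA_simps wm_eq)

lemma FA_induct:
  assumes "x \<in> carrier (FA A)"
    and wm: "\<And>c w. set w \<subseteq> A \<Longrightarrow> P (wm c w)"
    and add: "\<And>x y. x \<in> carrier (FA A) \<Longrightarrow> y \<in> carrier (FA A) \<Longrightarrow> P x \<Longrightarrow> P y \<Longrightarrow> P (\<lambda>w. x w + y w)"
  shows "P x"
proof -
  have x: "finite {w. x w \<noteq> 0}" "\<And>w. x w \<noteq> 0 \<Longrightarrow> set w \<subseteq> A" using assms(1) by (auto simp: FA_simps(1))
  have "P (\<lambda>w. if w \<in> S then x w else 0) \<and> (\<lambda>w. if w \<in> S then x w else 0) \<in> carrier (FA A)"
    if "finite S" "S \<subseteq> {w. x w \<noteq> 0}" for S
    using that
  proof (induction S rule: finite_induct)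
    case empty
    then show ?case using wm[of "[]" 0] wm_closed[of "[]" A 0] by (simp add: wm_eq)
  next
    case (insert v S)
    then have "(\<lambda>w. if w \<in> insert v S then x w else 0) = (\<lambda>w. wm (x v) v w + (if w \<in> S then x w else 0))"
      by (auto simp: wm_eq)
    moreover have "set v \<subseteq> A" using insert x by auto
    ultimately show ?case using insert wm wm_closed[of v A "x v"] by (auto intro!: add FA_add_supp)
  qed
  from this[OF x(1) order.refl] have "P (\<lambda>w. if w \<in> {w. x w \<noteq> 0} then x w else 0)" by blast
  moreover have "(\<lambda>w. if w \<in> {w. x w \<noteq> 0} then x w else 0) = x" by auto
  ultimately show ?thesis by simp
qed

definition klin :: "('k \<Rightarrow> 'm::ab_group_add \<Rightarrow> 'm) \<Rightarrow> ('m \<Rightarrow> 'm) \<Rightarrow> bool" where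
  "klin sc f \<longleftrightarrow> (\<forall>x y. f (x + y) = f x + f y) \<and> (\<forall>c x. f (sc c x) = sc c (f x))"

definition lie_rep ::
  "('k::field, 'b, 'n) lie_alg_scheme \<Rightarrow> ('k \<Rightarrow> 'm::ab_group_add \<Rightarrow> 'm) \<Rightarrow> ('b \<Rightarrow> 'm \<Rightarrow> 'm) \<Rightarrow> bool" where
  "lie_rep L sc \<rho> \<longleftrightarrow> (\<forall>x\<in>carrier L. klin sc (\<rho> x)) \<and>
     (\<forall>x\<in>carrier L. \<forall>y\<in>carrier L. \<forall>m. \<rho> (x \<oplus>\<^bsub>L\<^esub> y) m = \<rho> x m + \<rho> y m) \<and>
     (\<forall>c. \<forall>x\<in>carrier L. \<forall>m. \<rho> (c \<odot>\<^bsub>L\<^esub> x) m = sc c (\<rho> x m)) \<and>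
     (\<forall>x\<in>carrier L. \<forall>y\<in>carrier L. \<forall>m. \<rho> (lie_bracket L x y) m = \<rho> x (\<rho> y m) - \<rho> y (\<rho> x m))"

text \<open>The first letter of a word acts last, so that concatenation of words becomes composition
  of operators.\<close>

definition word_act :: "('k::zero \<Rightarrow> 'm::comm_monoid_add \<Rightarrow> 'm) \<Rightarrow> ('b \<Rightarrow> 'm \<Rightarrow> 'm) \<Rightarrow> ('b list \<Rightarrow> 'k) \<Rightarrow> 'm \<Rightarrow> 'm" where
  "word_act sc \<rho> x m = (\<Sum>w | x w \<noteq> 0. sc (x w) (foldr \<rho> w m))"

context vector_space
begin

lemma klin_zero: "klin scale f \<Longrightarrow> f 0 = 0"
  by (metis klin_def scale_zero_left)

lemma klin_foldr: "(\<And>b. b \<in> set w \<Longrightarrow> klin scale (\<rho> b)) \<Longrightarrow> klin scale (foldr \<rho> w)"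
  by (induction w) (auto simp: klin_def)

lemma word_act_superset:
  assumes "finite S" "{w. x w \<noteq> 0} \<subseteq> S"
  shows "word_act scale \<rho> x m = (\<Sum>w\<in>S. scale (x w) (foldr \<rho> w m))"
  unfolding word_act_def by (rule sum.mono_neutral_left) (use assms in auto)

lemma word_act_add:
  assumes "x \<in> carrier (FA A)" "y \<in> carrier (FA A)"
  shows "word_act scale \<rho> (\<lambda>w. x w + y w) m = word_act scale \<rho> x m + word_act scale \<rho> y m"
proof -
  let ?S = "{w. x w \<noteq> 0} \<union> {w. y w \<noteq> 0}"
  have S: "finite ?S" using assms by (simp add: FA_simps(1))
  have "{w. x w \<noteq> 0} \<subseteq> ?S" "{w. y w \<noteq> 0} \<subseteq> ?S" "{w. x w + y w \<noteq> 0} \<subseteq> ?S" by auto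
  then show ?thesis
    using S by (simp add: word_act_superset[of ?S] scale_left_distrib sum.distrib del: Un_iff)
qed

lemma word_act_wm: "word_act scale \<rho> (wm c w) m = scale c (foldr \<rho> w m)"
  by (subst word_act_superset[of "{w}"]) (auto simp: wm_eq)

lemma klin_word_act:
  assumes "x \<in> carrier (FA A)" "\<And>b. b \<in> A \<Longrightarrow> klin scale (\<rho> b)"
  shows "klin scale (word_act scale \<rho> x)"
proof -
  have "klin scale (foldr \<rho> w)" if "x w \<noteq> 0" for w
    by (rule klin_foldr) (use assms that in \<open>auto simp: FA_simps(1)\<close>)
  then show ?thesis
    unfolding klin_def word_act_def
    by (simp add: scale_right_distrib sum.distrib scale_sum_right mult.commute)
qed

lemma word_act_mult:
  assumes x: "x \<in> carrier (FA A)" and y: "y \<in> carrier (FA A)" and \<rho>: "\<And>b. b \<in> A \<Longrightarrow> klin scale (\<rho> b)"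
  shows "word_act scale \<rho> (x \<otimes>\<^bsub>FA A\<^esub> y) m = word_act scale \<rho> x (word_act scale \<rho> y m)"
proof -
  interpret F: ring "FA A :: ('c list \<Rightarrow> 'a) ring" by (rule FA_ring)
  show ?thesis
  proof (rule FA_induct[where P = "\<lambda>x. word_act scale \<rho> (x \<otimes>\<^bsub>FA A\<^esub> y) m = word_act scale \<rho> x (word_act scale \<rho> y m)", OF x])
    fix c :: 'a and u :: "'c list" assume u: "set u \<subseteq> A"
    have cu: "wm c u \<in> carrier (FA A)" using u by (rule wm_closed)
    show "word_act scale \<rho> (wm c u \<otimes>\<^bsub>FA A\<^esub> y) m = word_act scale \<rho> (wm c u) (word_act scale \<rho> y m)"
    proof (rule FA_induct[where P = "\<lambda>y. word_act scale \<rho> (wm c u \<otimes>\<^bsub>FA A\<^esub> y) m = word_act scale \<rho> (wm c u) (word_act scale \<rho> y m)", OF y])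
      fix d :: 'a and v :: "'c list" assume "set v \<subseteq> A"
      have "klin scale (foldr \<rho> u)" by (rule klin_foldr) (use u \<rho> in auto)
      then show "word_act scale \<rho> (wm c u \<otimes>\<^bsub>FA A\<^esub> wm d v) m = word_act scale \<rho> (wm c u) (word_act scale \<rho> (wm d v) m)"
        by (simp add: wm_mult word_act_wm klin_def)
    next
      fix y z :: "'c list \<Rightarrow> 'a" assume yz: "y \<in> carrier (FA A)" "z \<in> carrier (FA A)"
        and IH: "word_act scale \<rho> (wm c u \<otimes>\<^bsub>FA A\<^esub> y) m = word_act scale \<rho> (wm c u) (word_act scale \<rho> y m)"
          "word_act scale \<rho> (wm c u \<otimes>\<^bsub>FA A\<^esub> z) m = word_act scale \<rho> (wm c u) (word_act scale \<rho> z m)"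
      have "wm c u \<otimes>\<^bsub>FA A\<^esub> (\<lambda>w. y w + z w) = (\<lambda>w. (wm c u \<otimes>\<^bsub>FA A\<^esub> y) w + (wm c u \<otimes>\<^bsub>FA A\<^esub> z) w)"
        using F.r_distr[OF yz cu] by (simp add: FA_simps(5))
      then show "word_act scale \<rho> (wm c u \<otimes>\<^bsub>FA A\<^esub> (\<lambda>w. y w + z w)) m
          = word_act scale \<rho> (wm c u) (word_act scale \<rho> (\<lambda>w. y w + z w) m)"
        using klin_word_act[OF cu \<rho>] IH yz
        by (simp add: word_act_add[OF F.m_closed[OF cu yz(1)] F.m_closed[OF cu yz(2)]] word_act_add[OF yz] klin_def)
    qed
  next
    fix x z :: "'c list \<Rightarrow> 'a" assume xz: "x \<in> carrier (FA A)" "z \<in> carrier (FA A)"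
      and IH: "word_act scale \<rho> (x \<otimes>\<^bsub>FA A\<^esub> y) m = word_act scale \<rho> x (word_act scale \<rho> y m)"
          "word_act scale \<rho> (z \<otimes>\<^bsub>FA A\<^esub> y) m = word_act scale \<rho> z (word_act scale \<rho> y m)"
    have "(\<lambda>w. x w + z w) \<otimes>\<^bsub>FA A\<^esub> y = (\<lambda>w. (x \<otimes>\<^bsub>FA A\<^esub> y) w + (z \<otimes>\<^bsub>FA A\<^esub> y) w)"
      using F.l_distr[OF xz y] by (simp add: FA_simps(5))
    then show "word_act scale \<rho> ((\<lambda>w. x w + z w) \<otimes>\<^bsub>FA A\<^esub> y) m = word_act scale \<rho> (\<lambda>w. x w + z w) (word_act scale \<rho> y m)"
      using IH by (simp add: word_act_add[OF F.m_closed[OF xz(1) y] F.m_closed[OF xz(2) y]] word_act_add[OF xz])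
  qed
qed

lemma word_act_diff:
  assumes "x \<in> carrier (FA A)" "y \<in> carrier (FA A)"
  shows "word_act scale \<rho> (x \<ominus>\<^bsub>FA A\<^esub> y) m = word_act scale \<rho> x m - word_act scale \<rho> y m"
proof -
  interpret F: ring "FA A :: ('c list \<Rightarrow> 'a) ring" by (rule FA_ring)
  have "word_act scale \<rho> (\<lambda>w. (x \<ominus>\<^bsub>FA A\<^esub> y) w + y w) m
      = word_act scale \<rho> (x \<ominus>\<^bsub>FA A\<^esub> y) m + word_act scale \<rho> y m"
    by (rule word_act_add) (use assms in auto)
  then show ?thesis using assms(2) by (simp add: FA_minus)
qed

end

section \<open>Enveloping algebras and their action on representations\<close>

locale env_alg =
  fixes L :: "('k::field, 'b, 'n) lie_alg_scheme"
  assumes L_add: "x \<in> carrier L \<Longrightarrow> y \<in> carrier L \<Longrightarrow> x \<oplus>\<^bsub>L\<^esub> y \<in> carrier L"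
    and L_smult: "x \<in> carrier L \<Longrightarrow> c \<odot>\<^bsub>L\<^esub> x \<in> carrier L"
    and L_bracket: "x \<in> carrier L \<Longrightarrow> y \<in> carrier L \<Longrightarrow> lie_bracket L x y \<in> carrier L"
begin

abbreviation F where "F \<equiv> FA (carrier L) :: ('b list \<Rightarrow> 'k) ring"
abbreviation rel where "rel \<equiv> env_relations (type_ring :: 'k ring) L"
abbreviation I where "I \<equiv> env_ideal (type_ring :: 'k ring) L"
abbreviation U where "U \<equiv> env (type_ring :: 'k ring) L"
abbreviation em where "em b \<equiv> wm (1 :: 'k) [b]"

sublocale F: ring F by (rule FA_ring)

lemma em_closed: "b \<in> carrier L \<Longrightarrow> em b \<in> carrier F"
  by (rule wm_closed) simp

lemma rel_eq: "rel =
   {em (x \<oplus>\<^bsub>L\<^esub> y) \<ominus>\<^bsub>F\<^esub> (em x \<oplus>\<^bsub>F\<^esub> em y) | x y. x \<in> carrier L \<and> y \<in> carrier L} \<union>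
   {em (c \<odot>\<^bsub>L\<^esub> x) \<ominus>\<^bsub>F\<^esub> wm c [x] | c x. x \<in> carrier L} \<union>
   {(em x \<otimes>\<^bsub>F\<^esub> em y \<ominus>\<^bsub>F\<^esub> em y \<otimes>\<^bsub>F\<^esub> em x) \<ominus>\<^bsub>F\<^esub> em (lie_bracket L x y) | x y. x \<in> carrier L \<and> y \<in> carrier L}"
  by (simp add: env_relations_def Let_def)

lemma rel_closed: "rel \<subseteq> carrier F"
  unfolding rel_eq
  by (auto intro!: F.minus_closed F.a_closed F.m_closed em_closed L_add L_smult L_bracket wm_closed)

lemma I_ideal: "ideal I F"
  unfolding env_ideal_def by (rule F.genideal_ideal[OF rel_closed])

sublocale I: ideal I F by (rule I_ideal)

lemma rel_I: "rel \<subseteq> I"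
  unfolding env_ideal_def by (rule F.genideal_self[OF rel_closed])

abbreviation cs where "cs x \<equiv> I +>\<^bsub>F\<^esub> x"

sublocale U: ring U
  unfolding env_def by (rule I.quotient_is_ring)

lemma cs_hom: "cs \<in> ring_hom F U"
  unfolding env_def by (rule I.rcos_ring_hom)

lemmas cs_closed = ring_hom_closed[OF cs_hom]
  and cs_mult = ring_hom_mult[OF cs_hom]
  and cs_add = ring_hom_add[OF cs_hom]
  and cs_one = ring_hom_one[OF cs_hom]

lemma cs_surj: "X \<in> carrier U \<Longrightarrow> \<exists>x\<in>carrier F. X = cs x"
  by (auto simp: env_def FactRing_def A_RCOSETS_def RCOSETS_def a_r_coset_def)

lemma cs_eq: "x \<in> carrier F \<Longrightarrow> y \<in> carrier F \<Longrightarrow> x \<ominus>\<^bsub>F\<^esub> y \<in> I \<Longrightarrow> cs x = cs y"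
  using F.quotient_eq_iff_same_a_r_cos[OF I_ideal] by blast

lemma cs_mem: "x \<in> carrier F \<Longrightarrow> y \<in> cs x \<Longrightarrow> y \<in> carrier F \<and> y \<ominus>\<^bsub>F\<^esub> x \<in> I"
proof -
  assume x: "x \<in> carrier F" and "y \<in> cs x"
  then obtain i where i: "i \<in> I" "y = i \<oplus>\<^bsub>F\<^esub> x" by (auto simp: a_r_coset_def')
  then have "i \<in> carrier F" using I.Icarr by blast
  then have "y \<ominus>\<^bsub>F\<^esub> x = i" using i x by (simp add: FA_minus) (simp add: FA_simps)
  then show ?thesis using i x \<open>i \<in> carrier F\<close> by simp
qed

lemma cs_em_add: "x \<in> carrier L \<Longrightarrow> y \<in> carrier L \<Longrightarrow> cs (em (x \<oplus>\<^bsub>L\<^esub> y)) = cs (em x) \<oplus>\<^bsub>U\<^esub> cs (em y)"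
proof -
  assume x: "x \<in> carrier L" "y \<in> carrier L"
  note c = em_closed[OF x(1)] em_closed[OF x(2)] em_closed[OF L_add[OF x]]
  have "em (x \<oplus>\<^bsub>L\<^esub> y) \<ominus>\<^bsub>F\<^esub> (em x \<oplus>\<^bsub>F\<^esub> em y) \<in> I"
    using x by (intro rel_I[THEN subsetD]) (unfold rel_eq, blast)
  from cs_eq[OF c(3) F.a_closed[OF c(1,2)] this] show ?thesis by (simp add: cs_add c)
qed

lemma cs_em_smult: "x \<in> carrier L \<Longrightarrow> cs (em (c \<odot>\<^bsub>L\<^esub> x)) = cs (wm c [])  \<otimes>\<^bsub>U\<^esub> cs (em x)"
proof -
  assume x: "x \<in> carrier L"
  have "cs (em (c \<odot>\<^bsub>L\<^esub> x)) = cs (wm c [x])"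
  proof (rule cs_eq)
    show "em (c \<odot>\<^bsub>L\<^esub> x) \<ominus>\<^bsub>F\<^esub> wm c [x] \<in> I"
      using x by (intro rel_I[THEN subsetD]) (unfold rel_eq, blast)
  qed (use x in \<open>auto intro: em_closed L_smult wm_closed\<close>)
  also have "wm c [x] = wm c [] \<otimes>\<^bsub>F\<^esub> em x" by (simp add: wm_mult)
  finally show ?thesis using x by (simp add: cs_mult wm_closed em_closed)
qed

lemma cs_em_bracket: "x \<in> carrier L \<Longrightarrow> y \<in> carrier L \<Longrightarrow>
   cs (em x) \<otimes>\<^bsub>U\<^esub> cs (em y) = cs (em (lie_bracket L x y)) \<oplus>\<^bsub>U\<^esub> cs (em y) \<otimes>\<^bsub>U\<^esub> cs (em x)"
proof -
  assume x: "x \<in> carrier L" "y \<in> carrier L"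
  note c = em_closed[OF x(1)] em_closed[OF x(2)] em_closed[OF L_bracket[OF x]]
  have "(em x \<otimes>\<^bsub>F\<^esub> em y) \<ominus>\<^bsub>F\<^esub> (em (lie_bracket L x y) \<oplus>\<^bsub>F\<^esub> em y \<otimes>\<^bsub>F\<^esub> em x)
      = (em x \<otimes>\<^bsub>F\<^esub> em y \<ominus>\<^bsub>F\<^esub> em y \<otimes>\<^bsub>F\<^esub> em x) \<ominus>\<^bsub>F\<^esub> em (lie_bracket L x y)"
    using c by (simp add: FA_minus F.m_closed F.a_closed) (simp add: FA_simps(5) algebra_simps)
  moreover have "\<dots> \<in> I" using x by (intro rel_I[THEN subsetD]) (unfold rel_eq, blast)
  ultimately have "cs (em x \<otimes>\<^bsub>F\<^esub> em y) = cs (em (lie_bracket L x y) \<oplus>\<^bsub>F\<^esub> em y \<otimes>\<^bsub>F\<^esub> em x)"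
    by (intro cs_eq) (use c in auto)
  then show ?thesis using c by (simp add: cs_mult cs_add)
qed

lemma cs_scalar_commute: "x \<in> carrier L \<Longrightarrow> cs (em x) \<otimes>\<^bsub>U\<^esub> cs (wm c []) = cs (wm c []) \<otimes>\<^bsub>U\<^esub> cs (em x)"
  by (simp add: cs_mult[symmetric] wm_closed em_closed wm_mult)

lemma env_of_cs: "env_of type_ring L x = cs (em x)" and env_scalar_cs: "env_scalar type_ring L c = cs (wm c [])"
  by (simp_all add: env_of_def env_scalar_def)

context
  fixes sc :: "'k \<Rightarrow> 'm::ab_group_add \<Rightarrow> 'm" and \<rho> :: "'b \<Rightarrow> 'm \<Rightarrow> 'm"
  assumes vs: "vector_space sc" and rep: "lie_rep L sc \<rho>"
begin

interpretation V: vector_space sc by (rule vs)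

lemma rho_klin: "x \<in> carrier L \<Longrightarrow> klin sc (\<rho> x)"
  using rep by (simp add: lie_rep_def)

lemma word_act_F_mult:
  assumes "x \<in> carrier F" "y \<in> carrier F"
  shows "word_act sc \<rho> (x \<otimes>\<^bsub>F\<^esub> y) m = word_act sc \<rho> x (word_act sc \<rho> y m)"
  using assms by (rule V.word_act_mult) (rule rho_klin)

lemma klin_word_act_F: "x \<in> carrier F \<Longrightarrow> klin sc (word_act sc \<rho> x)"
  by (rule V.klin_word_act) (auto intro: rho_klin)

text \<open>The elements acting as 0 on the whole space form a two-sided ideal, because the action
  is multiplicative; the three families of relations belong to it by the additivity, the homogeneity
  and the commutator rule of a representation.\<close>

lemma word_act_I: "x \<in> I \<Longrightarrow> word_act sc \<rho> x m = 0"
proof -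
  define Z where "Z = {x \<in> carrier F. \<forall>m. word_act sc \<rho> x m = 0}"
  have "ideal Z F"
  proof (rule idealI)
    show "ring F" by (rule FA_ring)
    show "subgroup Z (add_monoid F)"
    proof (rule F.add.subgroupI)
      show "Z \<noteq> {}" using F.zero_closed by (auto simp: Z_def word_act_def FA_simps(4) intro!: exI[of _ "\<zero>\<^bsub>F\<^esub>"])
    next
      fix a assume a: "a \<in> Z"
      have "word_act sc \<rho> (\<zero>\<^bsub>F\<^esub> \<ominus>\<^bsub>F\<^esub> a) m = 0" for m
        using a V.word_act_diff[of "\<zero>\<^bsub>F\<^esub>" "carrier L" a \<rho> m] by (simp add: Z_def) (simp add: word_act_def FA_simps(4))
      then show "\<ominus>\<^bsub>F\<^esub> a \<in> Z"
        using a by (simp add: Z_def a_minus_def)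
    next
      fix a b assume "a \<in> Z" "b \<in> Z"
      then show "a \<oplus>\<^bsub>F\<^esub> b \<in> Z" using V.word_act_add[of a "carrier L" b \<rho>] F.a_closed[of a b]
        by (simp add: Z_def) (simp add: FA_simps(5))
    qed (auto simp: Z_def)
    fix a x assume a: "a \<in> Z" and x: "x \<in> carrier F"
    show "x \<otimes>\<^bsub>F\<^esub> a \<in> Z" "a \<otimes>\<^bsub>F\<^esub> x \<in> Z"
      using a x V.klin_zero[OF klin_word_act_F[OF x]] by (auto simp: Z_def word_act_F_mult)
  qed
  moreover have "r \<in> Z" if "r \<in> rel" for r
  proof -
    have "r \<in> carrier F" using that rel_closed by (rule set_mp[rotated])
    moreover have "word_act sc \<rho> r m = 0" for m
      using that unfolding rel_eq
    proof (elim UnE CollectE exE conjE)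
      fix x y assume *: "r = em (x \<oplus>\<^bsub>L\<^esub> y) \<ominus>\<^bsub>F\<^esub> (em x \<oplus>\<^bsub>F\<^esub> em y)" and xy: "x \<in> carrier L" "y \<in> carrier L"
      note c = em_closed[OF xy(1)] em_closed[OF xy(2)] em_closed[OF L_add[OF xy]]
      have "word_act sc \<rho> r m = \<rho> (x \<oplus>\<^bsub>L\<^esub> y) m - (\<rho> x m + \<rho> y m)"
        unfolding * V.word_act_diff[OF c(3) F.a_closed[OF c(1,2)]]
        using V.word_act_add[OF c(1,2)] by (simp add: FA_simps(5) V.word_act_wm)
      then show ?thesis using rep xy by (simp add: lie_rep_def)
    next
      fix d x assume *: "r = em (d \<odot>\<^bsub>L\<^esub> x) \<ominus>\<^bsub>F\<^esub> wm d [x]" and x: "x \<in> carrier L"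
      have "wm d [x] \<in> carrier F" using x by (intro wm_closed) simp
      then have "word_act sc \<rho> r m = \<rho> (d \<odot>\<^bsub>L\<^esub> x) m - sc d (\<rho> x m)"
        unfolding * using V.word_act_diff[OF em_closed[OF L_smult[OF x]]] by (simp add: V.word_act_wm)
      then show ?thesis using rep x by (simp add: lie_rep_def)
    next
      fix x y assume *: "r = (em x \<otimes>\<^bsub>F\<^esub> em y \<ominus>\<^bsub>F\<^esub> em y \<otimes>\<^bsub>F\<^esub> em x) \<ominus>\<^bsub>F\<^esub> em (lie_bracket L x y)"
        and xy: "x \<in> carrier L" "y \<in> carrier L"
      note c = em_closed[OF xy(1)] em_closed[OF xy(2)] em_closed[OF L_bracket[OF xy]]
      note d = F.m_closed[OF c(1,2)] F.m_closed[OF c(2,1)]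
      have "word_act sc \<rho> r m = (\<rho> x (\<rho> y m) - \<rho> y (\<rho> x m)) - \<rho> (lie_bracket L x y) m"
        unfolding * V.word_act_diff[OF F.minus_closed[OF d] c(3)] V.word_act_diff[OF d]
          word_act_F_mult[OF c(1,2)] word_act_F_mult[OF c(2,1)]
        by (simp add: V.word_act_wm)
      then show ?thesis using rep xy by (simp add: lie_rep_def)
    qed
    ultimately show ?thesis by (simp add: Z_def)
  qed
  ultimately have "I \<subseteq> Z" unfolding env_ideal_def by (intro F.genideal_minimal) auto
  then show "x \<in> I \<Longrightarrow> word_act sc \<rho> x m = 0" by (auto simp: Z_def)
qed

text \<open>The representative is chosen exactly as in \<open>env_act\<close>, so the two agree for
  the inducing module up to the notation for sums (\<open>env_act_eq\<close>).\<close>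

definition env_map :: "('b list \<Rightarrow> 'k) set \<Rightarrow> 'm \<Rightarrow> 'm" where
  "env_map X m = word_act sc \<rho> (SOME x. x \<in> X) m"

lemma env_map_cs: "x \<in> carrier F \<Longrightarrow> env_map (cs x) m = word_act sc \<rho> x m"
proof -
  assume x: "x \<in> carrier F"
  have "(SOME y. y \<in> cs x) \<in> cs x" using someI[of "\<lambda>y. y \<in> cs x" x] I.a_rcos_self[OF x] by blast
  from cs_mem[OF x this] show ?thesis
    unfolding env_map_def using V.word_act_diff[OF _ x, of "SOME y. y \<in> cs x" \<rho> m] word_act_I by simp
qed

lemma env_map_add: "X \<in> carrier U \<Longrightarrow> Y \<in> carrier U \<Longrightarrow> env_map (X \<oplus>\<^bsub>U\<^esub> Y) m = env_map X m + env_map Y m"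
proof -
  assume "X \<in> carrier U" "Y \<in> carrier U"
  then obtain x y where "x \<in> carrier F" "X = cs x" "y \<in> carrier F" "Y = cs y" using cs_surj by meson
  then show ?thesis
    using V.word_act_add[of x "carrier L" y \<rho> m] F.a_closed[of x y]
    by (simp add: cs_add[symmetric] env_map_cs) (simp add: FA_simps(5))
qed

lemma env_map_mult: "X \<in> carrier U \<Longrightarrow> Y \<in> carrier U \<Longrightarrow> env_map (X \<otimes>\<^bsub>U\<^esub> Y) m = env_map X (env_map Y m)"
proof -
  assume "X \<in> carrier U" "Y \<in> carrier U"
  then obtain x y where "x \<in> carrier F" "X = cs x" "y \<in> carrier F" "Y = cs y" using cs_surj by meson
  then show ?thesis
    by (simp add: cs_mult[symmetric] env_map_cs word_act_F_mult)
qed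

lemma klin_env_map: "X \<in> carrier U \<Longrightarrow> klin sc (env_map X)"
proof -
  assume "X \<in> carrier U"
  then obtain x where x: "x \<in> carrier F" "X = cs x" using cs_surj by meson
  then have "env_map X = word_act sc \<rho> x" by (auto simp: env_map_cs)
  then show ?thesis using klin_word_act_F[OF x(1)] by simp
qed

lemma env_map_em: "x \<in> carrier L \<Longrightarrow> env_map (cs (em x)) m = \<rho> x m"
  by (simp add: env_map_cs em_closed V.word_act_wm)

lemma env_map_scalar: "env_map (cs (wm c [])) m = sc c m"
  by (simp add: env_map_cs wm_closed V.word_act_wm)

end

end

section \<open>Modules induced from a subalgebra\<close>

text \<open>The additive group of a type as a record, to serve as a target of
  \<open>tensor_lift\<close>.\<close>

definition add_rec :: "'m::ab_group_add ring" where
  "add_rec = \<lparr>carrier = UNIV, monoid.mult = undefined, one = undefined, zero = 0, add = (+)\<rparr>"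

lemma add_rec_simps [simp]: "carrier add_rec = UNIV" "\<zero>\<^bsub>add_rec\<^esub> = 0" "x \<oplus>\<^bsub>add_rec\<^esub> y = x + y"
  by (simp_all add: add_rec_def)

lemma add_rec_abelian: "abelian_group add_rec"
  by (rule abelian_groupI) (auto simp: ac_simps intro: exI[of _ "- x" for x])

lemma type_module_simps [simp]:
  "carrier type_module = UNIV" "\<zero>\<^bsub>type_module\<^esub> = 0" "x \<oplus>\<^bsub>type_module\<^esub> y = x + y"
  "x \<odot>\<^bsub>type_module\<^esub> y = x * y"
  by (simp_all add: type_module_def type_ring_def ring.defs module.defs)

lemma type_module_abelian: "abelian_group type_module"
  by (rule abelian_groupI) (auto simp: ac_simps intro: exI[of _ "- x" for x])

lemma finsum_type_module [simp]: "finsum type_module f A = sum f A"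
proof -
  interpret abelian_group type_module by (rule type_module_abelian)
  show ?thesis by (induction A rule: infinite_finite_induct) auto
qed

lemma vector_space_mult: "vector_space ((*) :: 'k::field \<Rightarrow> 'k \<Rightarrow> 'k)"
  by standard (auto simp: algebra_simps)

locale induced = L: env_alg L + L': env_alg L'
  for L L' :: "('k::field, 'b) lie_alg" +
  fixes \<rho>0 :: "'b \<Rightarrow> 'k \<Rightarrow> 'k"
  assumes sub: "carrier L' \<subseteq> carrier L"
    and same: "add L' = add L" "module.smult L' = module.smult L" "lie_bracket L' = lie_bracket L"
    and rep0: "lie_rep L' (*) \<rho>0"
begin

lemma env_act_eq: "x \<in> carrier L'.F \<Longrightarrow> env_act type_ring type_module \<rho>0 (L'.cs x) n = word_act (*) \<rho>0 x n"
  using L'.env_map_cs[OF vector_space_mult rep0, of x n]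
  by (simp add: env_act_def Let_def L'.env_map_def[OF vector_space_mult rep0] word_act_def)

lemma F_sub: "x \<in> carrier L'.F \<Longrightarrow> x \<in> carrier L.F"
  using sub by (auto simp: FA_simps(1))

lemma F_ops: "x \<oplus>\<^bsub>L'.F\<^esub> y = x \<oplus>\<^bsub>L.F\<^esub> y" "x \<otimes>\<^bsub>L'.F\<^esub> y = x \<otimes>\<^bsub>L.F\<^esub> y" "\<zero>\<^bsub>L'.F\<^esub> = \<zero>\<^bsub>L.F\<^esub>"
  "y \<in> carrier L'.F \<Longrightarrow> x \<ominus>\<^bsub>L'.F\<^esub> y = x \<ominus>\<^bsub>L.F\<^esub> y" "y \<in> carrier L'.F \<Longrightarrow> \<ominus>\<^bsub>L'.F\<^esub> y = \<ominus>\<^bsub>L.F\<^esub> y"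
proof -
  assume y: "y \<in> carrier L'.F"
  show "x \<ominus>\<^bsub>L'.F\<^esub> y = x \<ominus>\<^bsub>L.F\<^esub> y" "\<ominus>\<^bsub>L'.F\<^esub> y = \<ominus>\<^bsub>L.F\<^esub> y"
    by (simp_all only: FA_minus[OF y] FA_minus[OF F_sub[OF y]] FA_uminus[OF y] FA_uminus[OF F_sub[OF y]])
qed (simp_all add: FA_simps)

text \<open>The operations of \<open>L'\<close> are those of \<open>L\<close>, so its relations are
  relations of \<open>L\<close>; and an ideal of the larger free algebra meets the smaller one in an
  ideal. Consequently enlarging a coset of the smaller ideal gives a single coset of the larger
  one.\<close>

lemma I_sub: "L'.I \<subseteq> L.I"
proof -
  have "ideal (L.I \<inter> carrier L'.F) L'.F"
  proof (rule idealI)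
    show "ring L'.F" by (rule FA_ring)
    show "subgroup (L.I \<inter> carrier L'.F) (add_monoid L'.F)"
    proof (rule L'.F.add.subgroupI)
      have "\<zero>\<^bsub>L.F\<^esub> \<in> L.I" by (rule additive_subgroup.zero_closed[OF L.I.additive_subgroup_axioms])
      moreover have "\<zero>\<^bsub>L.F\<^esub> \<in> carrier L'.F" using L'.F.zero_closed by (simp only: F_ops(3))
      ultimately show "L.I \<inter> carrier L'.F \<noteq> {}" by blast
    next
      fix a assume a: "a \<in> L.I \<inter> carrier L'.F"
      then show "\<ominus>\<^bsub>L'.F\<^esub> a \<in> L.I \<inter> carrier L'.F"
        using a L.I.a_inv_closed[of a] L'.F.a_inv_closed[of a] by (simp add: F_ops)
    next
      fix a b assume "a \<in> L.I \<inter> carrier L'.F" "b \<in> L.I \<inter> carrier L'.F"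
      then show "a \<oplus>\<^bsub>L'.F\<^esub> b \<in> L.I \<inter> carrier L'.F"
        using L.I.a_closed[of a b] L'.F.a_closed[of a b] by (simp add: F_ops)
    qed auto
    fix a x assume "a \<in> L.I \<inter> carrier L'.F" "x \<in> carrier L'.F"
    then show "x \<otimes>\<^bsub>L'.F\<^esub> a \<in> L.I \<inter> carrier L'.F" "a \<otimes>\<^bsub>L'.F\<^esub> x \<in> L.I \<inter> carrier L'.F"
      using L.I.I_l_closed[of a x] L.I.I_r_closed[of a x] L'.F.m_closed[of a x] L'.F.m_closed[of x a] F_sub[of x]
      by (auto simp: F_ops)
  qed
  moreover have "L'.rel \<subseteq> L.rel"
  proof -
    have em: "L'.em b \<in> carrier L'.F" if "b \<in> carrier L'" for b by (rule L'.em_closed[OF that])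
    have "em1 \<in> L.rel" if "em1 \<in> L'.rel" for em1
      using that unfolding L'.rel_eq
    proof (elim UnE CollectE exE conjE)
      fix x y assume *: "em1 = L'.em (x \<oplus>\<^bsub>L'\<^esub> y) \<ominus>\<^bsub>L'.F\<^esub> (L'.em x \<oplus>\<^bsub>L'.F\<^esub> L'.em y)"
        and xy: "x \<in> carrier L'" "y \<in> carrier L'"
      then have "em1 = L.em (x \<oplus>\<^bsub>L\<^esub> y) \<ominus>\<^bsub>L.F\<^esub> (L.em x \<oplus>\<^bsub>L.F\<^esub> L.em y)"
        using F_ops(4)[OF L'.F.a_closed[OF em em]] by (simp add: F_ops(1) same)
      then show ?thesis unfolding L.rel_eq using xy sub by blast
    next
      fix c x assume *: "em1 = L'.em (c \<odot>\<^bsub>L'\<^esub> x) \<ominus>\<^bsub>L'.F\<^esub> wm c [x]" and x: "x \<in> carrier L'"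
      then have "em1 = L.em (c \<odot>\<^bsub>L\<^esub> x) \<ominus>\<^bsub>L.F\<^esub> wm c [x]"
        using F_ops(4)[of "wm c [x]"] wm_closed[of "[x]" "carrier L'" c] by (simp add: same)
      then show ?thesis unfolding L.rel_eq using x sub by blast
    next
      fix x y assume *: "em1 = (L'.em x \<otimes>\<^bsub>L'.F\<^esub> L'.em y \<ominus>\<^bsub>L'.F\<^esub> L'.em y \<otimes>\<^bsub>L'.F\<^esub> L'.em x) \<ominus>\<^bsub>L'.F\<^esub> L'.em (lie_bracket L' x y)"
        and xy: "x \<in> carrier L'" "y \<in> carrier L'"
      then have "em1 = (L.em x \<otimes>\<^bsub>L.F\<^esub> L.em y \<ominus>\<^bsub>L.F\<^esub> L.em y \<otimes>\<^bsub>L.F\<^esub> L.em x) \<ominus>\<^bsub>L.F\<^esub> L.em (lie_bracket L x y)"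
        using F_ops(4)[OF L'.F.m_closed[OF em em]] F_ops(4)[OF em[OF L'.L_bracket]] by (simp add: F_ops(2) same)
      then show ?thesis unfolding L.rel_eq using xy sub by blast
    qed
    then show ?thesis by blast
  qed
  ultimately have "Idl\<^bsub>L'.F\<^esub> L'.rel \<subseteq> L.I \<inter> carrier L'.F"
    using L.rel_I L'.rel_closed by (intro L'.F.genideal_minimal) auto
  then show ?thesis by (simp add: env_ideal_def)
qed

lemma env_inclusion_cs: "x \<in> carrier L'.F \<Longrightarrow> env_inclusion type_ring L (L'.cs x) = L.cs x"
proof -
  assume x: "x \<in> carrier L'.F"
  show ?thesis
  proof (rule Set.set_eqI)
    fix y
    show "y \<in> env_inclusion type_ring L (L'.cs x) \<longleftrightarrow> y \<in> L.cs x"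
    proof
      assume "y \<in> env_inclusion type_ring L (L'.cs x)"
      then obtain i j where ij: "i \<in> L.I" "j \<in> L'.I" "y = i \<oplus>\<^bsub>L.F\<^esub> (j \<oplus>\<^bsub>L'.F\<^esub> x)"
        by (auto simp: env_inclusion_def set_add_def' a_r_coset_def')
      have "j \<in> L.I" using ij(2) I_sub by blast
      then have "y = (i \<oplus>\<^bsub>L.F\<^esub> j) \<oplus>\<^bsub>L.F\<^esub> x" "i \<oplus>\<^bsub>L.F\<^esub> j \<in> L.I"
        using ij(1,3) L.I.a_closed by (simp_all add: FA_simps(5) add.assoc)
      then show "y \<in> L.cs x" by (auto simp: a_r_coset_def')
    next
      assume "y \<in> L.cs x"
      then obtain i where i: "i \<in> L.I" "y = i \<oplus>\<^bsub>L.F\<^esub> x" by (auto simp: a_r_coset_def')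
      then show "y \<in> env_inclusion type_ring L (L'.cs x)"
        unfolding env_inclusion_def set_add_def' using L'.I.a_rcos_self[OF x] by blast
    qed
  qed
qed

abbreviation ra where "ra \<equiv> \<lambda>u b. u \<otimes>\<^bsub>L.U\<^esub> env_inclusion type_ring L b"
abbreviation la where "la \<equiv> env_act type_ring type_module \<rho>0"

sublocale TP: tensor_prod L'.U L.U type_module ra la
proof (intro tensor_prod.intro tensor_prod_axioms.intro)
  show "abelian_group L.U" by (rule L.U.abelian_group_axioms)
  show "abelian_group type_module" by (rule type_module_abelian)
  show "ra m s \<in> carrier L.U" if "m \<in> carrier L.U" "s \<in> carrier L'.U" for m s
    using that L'.cs_surj[OF that(2)] by (auto simp: env_inclusion_cs L.cs_closed F_sub)
qed simp

lemma lm_amap: "r \<in> carrier L.U \<Longrightarrow> amap L.U L.U (\<lambda>v. r \<otimes>\<^bsub>L.U\<^esub> v)"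
  by (rule amapI) (auto simp: L.U.r_distr)

lemma lm_ra: "r \<in> carrier L.U \<Longrightarrow> m \<in> carrier L.U \<Longrightarrow> s \<in> carrier L'.U \<Longrightarrow>
    r \<otimes>\<^bsub>L.U\<^esub> ra m s = ra (r \<otimes>\<^bsub>L.U\<^esub> m) s"
  using L'.cs_surj[of s] by (auto simp: env_inclusion_cs L.cs_closed F_sub L.U.m_assoc)

abbreviation VE where "VE \<equiv> induced_module type_ring L L' type_module \<rho>0"
abbreviation pt where "pt \<equiv> induced_pure type_ring L L' type_module \<rho>0"

lemma VE_TM: "VE = TP.TM (\<lambda>u v. u \<otimes>\<^bsub>L.U\<^esub> v)"
  by (simp add: induced_module_def)

lemma pt_TP: "pt = TP.pt"
  by (simp add: induced_pure_def)

lemma VE_T: "carrier VE = carrier TP.T" "add VE = add TP.T" "\<zero>\<^bsub>VE\<^esub> = \<zero>\<^bsub>TP.T\<^esub>"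
  unfolding VE_TM by (rule TP.TM_simps[where R = "carrier L.U"]; simp add: lm_amap lm_ra)+

sublocale VE: abelian_group VE
  unfolding VE_TM by (rule TP.TM_abelian[where R = "carrier L.U"]) (simp_all add: lm_amap lm_ra)

lemma amap_VE_smult: "r \<in> carrier L.U \<Longrightarrow> amap VE VE (\<lambda>v. r \<odot>\<^bsub>VE\<^esub> v)"
proof -
  assume r: "r \<in> carrier L.U"
  have "amap TP.T TP.T (\<lambda>v. r \<odot>\<^bsub>VE\<^esub> v)"
    unfolding VE_TM by (rule TP.amap_TM_smult[where R = "carrier L.U"]) (simp_all add: lm_amap lm_ra r)
  then show ?thesis by (simp add: amap_def VE_T)
qed

lemma VE_smult_pt: "r \<in> carrier L.U \<Longrightarrow> u \<in> carrier L.U \<Longrightarrow> r \<odot>\<^bsub>VE\<^esub> pt u n = pt (r \<otimes>\<^bsub>L.U\<^esub> u) n"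
  unfolding pt_TP VE_TM by (rule TP.TM_smult_pt[where R = "carrier L.U"]) (simp_all add: lm_amap lm_ra)

lemma pt_closed [simp]: "u \<in> carrier L.U \<Longrightarrow> pt u n \<in> carrier VE"
  unfolding pt_TP VE_T by (rule TP.pt_closed) auto

lemma VE_smult_closed [simp]: "r \<in> carrier L.U \<Longrightarrow> v \<in> carrier VE \<Longrightarrow> r \<odot>\<^bsub>VE\<^esub> v \<in> carrier VE"
  by (rule amap_closed[OF amap_VE_smult])

lemma VE_induct [consumes 1, case_names pure add]:
  assumes "v \<in> carrier VE" "\<And>u n. u \<in> carrier L.U \<Longrightarrow> P (pt u n)"
    "\<And>x y. x \<in> carrier VE \<Longrightarrow> y \<in> carrier VE \<Longrightarrow> P x \<Longrightarrow> P y \<Longrightarrow> P (x \<oplus>\<^bsub>VE\<^esub> y)"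
  shows "P v"
  using TP.tensor_induct[of v P] assms by (simp only: VE_T pt_TP)

lemma VE_smult_add: "r \<in> carrier L.U \<Longrightarrow> s \<in> carrier L.U \<Longrightarrow> v \<in> carrier VE \<Longrightarrow>
    (r \<oplus>\<^bsub>L.U\<^esub> s) \<odot>\<^bsub>VE\<^esub> v = r \<odot>\<^bsub>VE\<^esub> v \<oplus>\<^bsub>VE\<^esub> s \<odot>\<^bsub>VE\<^esub> v"
proof -
  assume rs: "r \<in> carrier L.U" "s \<in> carrier L.U" and v: "v \<in> carrier VE"
  from v show ?thesis
  proof (induction rule: VE_induct)
    case (pure u n)
    then have "pt (r \<otimes>\<^bsub>L.U\<^esub> u \<oplus>\<^bsub>L.U\<^esub> s \<otimes>\<^bsub>L.U\<^esub> u) n = pt (r \<otimes>\<^bsub>L.U\<^esub> u) n \<oplus>\<^bsub>VE\<^esub> pt (s \<otimes>\<^bsub>L.U\<^esub> u) n"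
      unfolding pt_TP VE_T using rs by (intro TP.pt_add_left) auto
    then show ?case using rs pure by (simp add: VE_smult_pt L.U.l_distr)
  next
    case (add x y)
    then show ?case using rs by (simp add: amap_add[OF amap_VE_smult] VE.a_ac)
  qed
qed

lemma VE_smult_mult: "r \<in> carrier L.U \<Longrightarrow> s \<in> carrier L.U \<Longrightarrow> v \<in> carrier VE \<Longrightarrow>
    (r \<otimes>\<^bsub>L.U\<^esub> s) \<odot>\<^bsub>VE\<^esub> v = r \<odot>\<^bsub>VE\<^esub> (s \<odot>\<^bsub>VE\<^esub> v)"
proof -
  assume rs: "r \<in> carrier L.U" "s \<in> carrier L.U" and v: "v \<in> carrier VE"
  from v show ?thesis
  proof (induction rule: VE_induct)
    case (pure u n)
    then show ?case using rs by (simp add: VE_smult_pt L.U.m_assoc)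
  next
    case (add x y)
    then show ?case using rs by (simp add: amap_add[OF amap_VE_smult])
  qed
qed

lemma VE_smult_one: "v \<in> carrier VE \<Longrightarrow> \<one>\<^bsub>L.U\<^esub> \<odot>\<^bsub>VE\<^esub> v = v"
proof (induction rule: VE_induct)
  case (pure u n)
  then show ?case by (simp add: VE_smult_pt)
next
  case (add x y)
  then show ?case by (simp add: amap_add[OF amap_VE_smult])
qed

abbreviation vacv where "vacv \<equiv> pt \<one>\<^bsub>L.U\<^esub> 1"

definition op where "op x v = env_of type_ring L x \<odot>\<^bsub>VE\<^esub> v"

definition ks where "ks c v = env_scalar type_ring L c \<odot>\<^bsub>VE\<^esub> v"

lemmas cs_em [simp] = L.cs_closed[OF L.em_closed]

lemma cs_sc [simp]: "L.cs (wm c []) \<in> carrier L.U"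
  by (intro L.cs_closed wm_closed) simp

lemma vacv_closed [simp]: "vacv \<in> carrier VE"
  by simp

lemma amap_op: "x \<in> carrier L \<Longrightarrow> amap VE VE (op x)"
  unfolding op_def L.env_of_cs by (rule amap_VE_smult) simp

lemma amap_ks: "amap VE VE (ks c)"
  unfolding ks_def L.env_scalar_cs by (rule amap_VE_smult) simp

lemma op_closed [simp]: "x \<in> carrier L \<Longrightarrow> v \<in> carrier VE \<Longrightarrow> op x v \<in> carrier VE"
  by (rule amap_closed[OF amap_op])

lemma ks_closed [simp]: "v \<in> carrier VE \<Longrightarrow> ks c v \<in> carrier VE"
  by (rule amap_closed[OF amap_ks])

lemma op_add: "x \<in> carrier L \<Longrightarrow> y \<in> carrier L \<Longrightarrow> v \<in> carrier VE \<Longrightarrow>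
    op (x \<oplus>\<^bsub>L\<^esub> y) v = op x v \<oplus>\<^bsub>VE\<^esub> op y v"
  by (simp add: op_def L.env_of_cs L.cs_em_add VE_smult_add)

lemma op_smult: "x \<in> carrier L \<Longrightarrow> v \<in> carrier VE \<Longrightarrow> op (c \<odot>\<^bsub>L\<^esub> x) v = ks c (op x v)"
  by (simp add: op_def ks_def L.env_of_cs L.env_scalar_cs L.cs_em_smult VE_smult_mult)

lemma op_bracket: "x \<in> carrier L \<Longrightarrow> y \<in> carrier L \<Longrightarrow> v \<in> carrier VE \<Longrightarrow>
    op x (op y v) = op (lie_bracket L x y) v \<oplus>\<^bsub>VE\<^esub> op y (op x v)"
proof -
  assume *: "x \<in> carrier L" "y \<in> carrier L" "v \<in> carrier VE"
  have "op x (op y v) = (L.cs (L.em x) \<otimes>\<^bsub>L.U\<^esub> L.cs (L.em y)) \<odot>\<^bsub>VE\<^esub> v"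
    using * by (simp add: op_def L.env_of_cs VE_smult_mult)
  also have "\<dots> = op (lie_bracket L x y) v \<oplus>\<^bsub>VE\<^esub> op y (op x v)"
    unfolding L.cs_em_bracket[OF *(1,2)]
    using * by (simp add: op_def L.env_of_cs VE_smult_add VE_smult_mult L.L_bracket)
  finally show ?thesis .
qed

lemma op_ks: "x \<in> carrier L \<Longrightarrow> v \<in> carrier VE \<Longrightarrow> op x (ks c v) = ks c (op x v)"
proof -
  assume *: "x \<in> carrier L" "v \<in> carrier VE"
  have "op x (ks c v) = (L.cs (L.em x) \<otimes>\<^bsub>L.U\<^esub> L.cs (wm c [])) \<odot>\<^bsub>VE\<^esub> v"
    using * by (simp add: op_def ks_def L.env_of_cs L.env_scalar_cs VE_smult_mult)
  also have "\<dots> = ks c (op x v)"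
    unfolding L.cs_scalar_commute[OF *(1)]
    using * by (simp add: op_def ks_def L.env_of_cs L.env_scalar_cs VE_smult_mult)
  finally show ?thesis .
qed

lemma ks_add: "v \<in> carrier VE \<Longrightarrow> ks (c + d) v = ks c v \<oplus>\<^bsub>VE\<^esub> ks d v"
proof -
  assume v: "v \<in> carrier VE"
  have "wm (c + d) [] = wm c [] \<oplus>\<^bsub>L.F\<^esub> wm d []" by (auto simp: wm_eq FA_simps(5))
  then have "L.cs (wm (c + d) []) = L.cs (wm c []) \<oplus>\<^bsub>L.U\<^esub> L.cs (wm d [])"
    by (simp add: L.cs_add wm_closed)
  then show ?thesis using v by (simp add: ks_def L.env_scalar_cs VE_smult_add)
qed

lemma ks_mult: "v \<in> carrier VE \<Longrightarrow> ks (c * d) v = ks c (ks d v)"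
proof -
  assume v: "v \<in> carrier VE"
  have "wm (c * d) [] = wm c [] \<otimes>\<^bsub>L.F\<^esub> wm d []" by (simp add: wm_mult)
  then have "L.cs (wm (c * d) []) = L.cs (wm c []) \<otimes>\<^bsub>L.U\<^esub> L.cs (wm d [])"
    by (simp add: L.cs_mult wm_closed)
  then show ?thesis using v by (simp add: ks_def L.env_scalar_cs VE_smult_mult)
qed

lemma ks_one: "v \<in> carrier VE \<Longrightarrow> ks 1 v = v"
  using VE_smult_one[of v] L.cs_one by (simp add: ks_def L.env_scalar_cs one_wm)

lemma pt_balanced: "x \<in> carrier L'.F \<Longrightarrow> u \<in> carrier L.U \<Longrightarrow>
   pt (u \<otimes>\<^bsub>L.U\<^esub> L.cs x) n = pt u (word_act (*) \<rho>0 x n)"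
  using TP.pt_balanced[of u "L'.cs x" n] by (simp add: pt_TP env_inclusion_cs env_act_eq L'.cs_closed)

text \<open>The scalar \<open>n\<close> lies in the enveloping algebra of the subalgebra and may be
  moved across the tensor sign.\<close>

lemma pt_ks: "u \<in> carrier L.U \<Longrightarrow> pt u n = u \<odot>\<^bsub>VE\<^esub> ks n vacv"
proof -
  interpret K: vector_space "(*) :: 'k \<Rightarrow> 'k \<Rightarrow> 'k" by (rule vector_space_mult)
  assume u: "u \<in> carrier L.U"
  have "pt u n = pt u (word_act (*) \<rho>0 (wm n []) 1)" by (simp add: K.word_act_wm)
  also have "\<dots> = pt (u \<otimes>\<^bsub>L.U\<^esub> L.cs (wm n [])) 1"
    by (rule pt_balanced[symmetric]) (use u in \<open>auto intro: wm_closed\<close>)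
  also have "\<dots> = u \<odot>\<^bsub>VE\<^esub> ks n vacv"
    using u by (simp add: ks_def L.env_scalar_cs VE_smult_pt)
  finally show ?thesis .
qed

lemma op_sub_vac: "b \<in> carrier L' \<Longrightarrow> op b vacv = ks (\<rho>0 b 1) vacv"
proof -
  interpret K: vector_space "(*) :: 'k \<Rightarrow> 'k \<Rightarrow> 'k" by (rule vector_space_mult)
  assume b: "b \<in> carrier L'"
  then have bL: "b \<in> carrier L" using sub by blast
  have "op b vacv = pt (\<one>\<^bsub>L.U\<^esub> \<otimes>\<^bsub>L.U\<^esub> L.cs (L.em b)) 1"
    using bL by (simp add: op_def L.env_of_cs VE_smult_pt)
  also have "\<dots> = pt \<one>\<^bsub>L.U\<^esub> (\<rho>0 b 1)"
    using pt_balanced[OF L'.em_closed[OF b], of "\<one>\<^bsub>L.U\<^esub>" 1] by (simp add: K.word_act_wm)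
  also have "\<dots> = ks (\<rho>0 b 1) vacv" by (subst pt_ks) (simp_all add: VE_smult_one)
  finally show ?thesis .
qed

text \<open>Words in \<open>L\<close> span its enveloping algebra, and \<open>pt_ks\<close> turns
  the right tensor factor into a scalar applied to the vacuum.\<close>

lemma VE_generated:
  assumes "v \<in> carrier VE" and vac: "P vacv"
    and add: "\<And>x y. x \<in> carrier VE \<Longrightarrow> y \<in> carrier VE \<Longrightarrow> P x \<Longrightarrow> P y \<Longrightarrow> P (x \<oplus>\<^bsub>VE\<^esub> y)"
    and ks: "\<And>c x. x \<in> carrier VE \<Longrightarrow> P x \<Longrightarrow> P (ks c x)"
    and op: "\<And>b x. b \<in> carrier L \<Longrightarrow> x \<in> carrier VE \<Longrightarrow> P x \<Longrightarrow> P (op b x)"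
  shows "P v"
proof -
  have F: "P (L.cs x \<odot>\<^bsub>VE\<^esub> v)" if v: "v \<in> carrier VE" "P v" and x: "x \<in> carrier L.F" for x v
  proof (rule FA_induct[where P = "\<lambda>x. P (L.cs x \<odot>\<^bsub>VE\<^esub> v)", OF x])
    fix c :: 'k and w assume w: "set w \<subseteq> carrier L"
    have "P (L.cs (wm 1 w) \<odot>\<^bsub>VE\<^esub> v)" using w
    proof (induction w)
      case Nil
      then show ?case using v VE_smult_one[OF v(1)] L.cs_one by (simp add: one_wm)
    next
      case (Cons b w)
      have "wm 1 (b # w) = L.em b \<otimes>\<^bsub>L.F\<^esub> wm 1 w" by (simp add: wm_mult)
      then have "L.cs (wm 1 (b # w)) = L.cs (L.em b) \<otimes>\<^bsub>L.U\<^esub> L.cs (wm 1 w)"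
        using Cons.prems by (simp add: L.cs_mult L.em_closed wm_closed)
      then have "L.cs (wm 1 (b # w)) \<odot>\<^bsub>VE\<^esub> v = op b (L.cs (wm 1 w) \<odot>\<^bsub>VE\<^esub> v)"
        using Cons.prems v by (simp add: VE_smult_mult op_def L.env_of_cs L.cs_closed wm_closed)
      then show ?case using Cons v by (auto intro!: op VE_smult_closed L.cs_closed wm_closed)
    qed
    moreover have "L.cs (wm c w) \<odot>\<^bsub>VE\<^esub> v = ks c (L.cs (wm 1 w) \<odot>\<^bsub>VE\<^esub> v)"
    proof -
      have "wm c w = wm c [] \<otimes>\<^bsub>L.F\<^esub> wm 1 w" by (simp add: wm_mult)
      then have "L.cs (wm c w) = L.cs (wm c []) \<otimes>\<^bsub>L.U\<^esub> L.cs (wm 1 w)"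
        using w by (simp add: L.cs_mult wm_closed)
      then show ?thesis using w v by (simp add: VE_smult_mult ks_def L.env_scalar_cs L.cs_closed wm_closed)
    qed
    ultimately show "P (L.cs (wm c w) \<odot>\<^bsub>VE\<^esub> v)"
      using w v by (auto intro!: ks VE_smult_closed L.cs_closed wm_closed)
  next
    fix x y assume xy: "x \<in> carrier L.F" "y \<in> carrier L.F" "P (L.cs x \<odot>\<^bsub>VE\<^esub> v)" "P (L.cs y \<odot>\<^bsub>VE\<^esub> v)"
    have "(\<lambda>w. x w + y w) = x \<oplus>\<^bsub>L.F\<^esub> y" by (simp add: FA_simps(5))
    then have "L.cs (\<lambda>w. x w + y w) \<odot>\<^bsub>VE\<^esub> v = L.cs x \<odot>\<^bsub>VE\<^esub> v \<oplus>\<^bsub>VE\<^esub> L.cs y \<odot>\<^bsub>VE\<^esub> v"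
      using xy v by (simp add: L.cs_add VE_smult_add L.cs_closed)
    then show "P (L.cs (\<lambda>w. x w + y w) \<odot>\<^bsub>VE\<^esub> v)" using xy v by (simp add: add L.cs_closed)
  qed
  from assms(1) show ?thesis
  proof (induction rule: VE_induct)
    case (pure u n)
    obtain x where x: "x \<in> carrier L.F" "u = L.cs x" using L.cs_surj[OF pure] by blast
    have "P (L.cs x \<odot>\<^bsub>VE\<^esub> ks n vacv)"
      by (rule F[OF ks_closed[OF vacv_closed] ks[OF vacv_closed vac] x(1)])
    then show ?case using pt_ks[OF pure, of n] by (simp only: x(2))
  qed (rule add)
qed

text \<open>Frobenius reciprocity: a vector on which the subalgebra acts through the character b to
  \<open>\<rho>0 b 1\<close> determines the map sending the pure tensor of u and n to u (n m0). The
  target is a whole type, so that a twisted sum of two spaces can be inserted.\<close>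

theorem universal:
  fixes sc :: "'k \<Rightarrow> 'm::ab_group_add \<Rightarrow> 'm" and \<rho> :: "'b \<Rightarrow> 'm \<Rightarrow> 'm" and m0 :: 'm
  assumes vs: "vector_space sc" and rep: "lie_rep L sc \<rho>"
    and m0: "\<And>b. b \<in> carrier L' \<Longrightarrow> \<rho> b m0 = sc (\<rho>0 b 1) m0"
  obtains \<Phi> where "\<And>x y. x \<in> carrier VE \<Longrightarrow> y \<in> carrier VE \<Longrightarrow> \<Phi> (x \<oplus>\<^bsub>VE\<^esub> y) = \<Phi> x + \<Phi> y"
    "\<Phi> vacv = m0"
    "\<And>c v. v \<in> carrier VE \<Longrightarrow> \<Phi> (ks c v) = sc c (\<Phi> v)"
    "\<And>b v. b \<in> carrier L \<Longrightarrow> v \<in> carrier VE \<Longrightarrow> \<Phi> (op b v) = \<rho> b (\<Phi> v)"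
proof -
  interpret M: vector_space sc by (rule vs)
  interpret K: vector_space "(*) :: 'k \<Rightarrow> 'k \<Rightarrow> 'k" by (rule vector_space_mult)
  let ?E = "L.env_map sc \<rho>"
  note E_add = L.env_map_add[OF vs rep] and E_mult = L.env_map_mult[OF vs rep]
    and E_lin = L.klin_env_map[OF vs rep] and E_em = L.env_map_em[OF vs rep]
    and E_sc = L.env_map_scalar[OF vs rep] and E_cs = L.env_map_cs[OF vs rep]
  \<comment> \<open>This is the balance of the map: on the line through \<open>m0\<close> the
    subalgebra acts as on the inducing module, letter by letter for words and then for their
    sums.\<close>
  have key: "word_act sc \<rho> x (sc n m0) = sc (word_act (*) \<rho>0 x n) m0" if x: "x \<in> carrier L'.F" for x n
  proof (rule FA_induct[where P = "\<lambda>x. word_act sc \<rho> x (sc n m0) = sc (word_act (*) \<rho>0 x n) m0", OF x])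
    fix c :: 'k and w assume "set w \<subseteq> carrier L'"
    then have "foldr \<rho> w (sc n m0) = sc (foldr \<rho>0 w n) m0"
    proof (induction w)
      case (Cons b w)
      then have b: "b \<in> carrier L'" "b \<in> carrier L" using sub by auto
      have l: "klin sc (\<rho> b)" using rep b by (simp add: lie_rep_def)
      have l0: "klin (*) (\<rho>0 b)" using rep0 b by (simp add: lie_rep_def)
      then have "\<rho>0 b (foldr \<rho>0 w n * 1) = foldr \<rho>0 w n * \<rho>0 b 1" unfolding klin_def by blast
      then show ?case using Cons l b by (simp add: klin_def m0 mult.commute)
    qed simp
    then show "word_act sc \<rho> (wm c w) (sc n m0) = sc (word_act (*) \<rho>0 (wm c w) n) m0"
      by (simp add: M.word_act_wm K.word_act_wm)
  next
    fix x y :: "'b list \<Rightarrow> 'k"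
    assume xy: "x \<in> carrier L'.F" "y \<in> carrier L'.F"
      and "word_act sc \<rho> x (sc n m0) = sc (word_act (*) \<rho>0 x n) m0"
        "word_act sc \<rho> y (sc n m0) = sc (word_act (*) \<rho>0 y n) m0"
    then show "word_act sc \<rho> (\<lambda>w. x w + y w) (sc n m0) = sc (word_act (*) \<rho>0 (\<lambda>w. x w + y w) n) m0"
      by (simp add: M.word_act_add[OF xy] K.word_act_add[OF xy] M.scale_left_distrib)
  qed
  define \<phi> where "\<phi> = (\<lambda>(u, n). ?E u (sc n m0))"
  have bal: "TP.balanced add_rec \<phi>"
    unfolding TP.balanced_def
  proof (intro conjI ballI)
    show "amap type_module add_rec (\<lambda>n. \<phi> (u, n))" if "u \<in> carrier L.U" for u
      using E_lin[OF that] by (intro amapI) (simp_all add: \<phi>_def M.scale_left_distrib klin_def)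
    show "amap L.U add_rec (\<lambda>u. \<phi> (u, n))" for n
      by (rule amapI) (simp_all add: \<phi>_def E_add)
    show "\<phi> (ra u s, n) = \<phi> (u, la s n)" if u: "u \<in> carrier L.U" and s: "s \<in> carrier L'.U" for u s n
    proof -
      obtain x where x: "x \<in> carrier L'.F" "s = L'.cs x" using L'.cs_surj[OF s] by blast
      then show ?thesis
        using u by (simp add: \<phi>_def env_inclusion_cs env_act_eq E_mult L.cs_closed F_sub E_cs key)
    qed
  qed
  define \<Phi> where "\<Phi> = tensor_lift add_rec \<phi>"
  have \<Phi>_add: "\<Phi> (x \<oplus>\<^bsub>VE\<^esub> y) = \<Phi> x + \<Phi> y" if "x \<in> carrier VE" "y \<in> carrier VE" for x y
    using amap_add[OF TP.amap_tensor_lift[OF add_rec_abelian bal]] that by (simp add: \<Phi>_def VE_T)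
  have \<Phi>_pt: "\<Phi> (pt u n) = ?E u (sc n m0)" if "u \<in> carrier L.U" for u n
    using TP.tensor_lift_pt[OF add_rec_abelian bal that, of n] by (simp add: \<Phi>_def pt_TP \<phi>_def)
  have \<Phi>_U: "\<Phi> (r \<odot>\<^bsub>VE\<^esub> v) = ?E r (\<Phi> v)" if r: "r \<in> carrier L.U" and v: "v \<in> carrier VE" for r v
    using v
  proof (induction rule: VE_induct)
    case (pure u n)
    then show ?case using r by (simp add: VE_smult_pt \<Phi>_pt E_mult)
  next
    case (add x y)
    then show ?case using r E_lin[OF r] by (simp add: amap_add[OF amap_VE_smult] \<Phi>_add klin_def)
  qed
  show thesis
  proof (rule that[of \<Phi>])
    show "\<Phi> vacv = m0"
      using E_sc[of 1 m0] L.cs_one by (simp add: \<Phi>_pt one_wm)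
  qed (simp_all add: \<Phi>_add ks_def op_def L.env_of_cs L.env_scalar_cs \<Phi>_U E_sc E_em)
qed

end

section \<open>Modules as retracts of vector spaces of functions\<close>

definition pscale :: "'k::field \<Rightarrow> ('v \<Rightarrow>\<^sub>0 'k) \<Rightarrow> 'v \<Rightarrow>\<^sub>0 'k" where
  "pscale c x = Poly_Mapping.map ((*) c) x"

lemma lookup_pscale [simp]: "Poly_Mapping.lookup (pscale c x) v = c * Poly_Mapping.lookup x v"
  by (simp add: pscale_def Poly_Mapping.map.rep_eq when_def)

lemma vector_space_pscale: "vector_space (pscale :: 'k::field \<Rightarrow> ('v \<Rightarrow>\<^sub>0 'k) \<Rightarrow> _)"
  by standard (auto intro!: poly_mapping_eqI simp: lookup_add algebra_simps)

text \<open>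
  The calculus of fields above lives on a whole type; this realizes a module, which is only a
  carrier set, as a linear retract of one.
\<close>

lemma module_retract:
  fixes V :: "('k::field, 'v, 'n) module_scheme"
  assumes "Module.module (type_ring :: 'k ring) V"
  obtains \<Theta> :: "('v \<Rightarrow>\<^sub>0 'k) \<Rightarrow> 'v" and \<sigma> :: "'v \<Rightarrow> 'v \<Rightarrow>\<^sub>0 'k" where
    "\<And>x. \<Theta> x \<in> carrier V" "\<And>x y. \<Theta> (x + y) = \<Theta> x \<oplus>\<^bsub>V\<^esub> \<Theta> y" "\<And>c x. \<Theta> (pscale c x) = c \<odot>\<^bsub>V\<^esub> \<Theta> x"
    "\<And>v. v \<in> carrier V \<Longrightarrow> \<Theta> (\<sigma> v) = v"
    "\<And>v w. v \<in> carrier V \<Longrightarrow> w \<in> carrier V \<Longrightarrow> \<sigma> (v \<oplus>\<^bsub>V\<^esub> w) = \<sigma> v + \<sigma> w"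
    "\<And>c v. v \<in> carrier V \<Longrightarrow> \<sigma> (c \<odot>\<^bsub>V\<^esub> v) = pscale c (\<sigma> v)"
proof -
  interpret V: Module.module "type_ring :: 'k ring" V by fact
  interpret E: vector_space "pscale :: 'k \<Rightarrow> ('v \<Rightarrow>\<^sub>0 'k) \<Rightarrow> _" by (rule vector_space_pscale)
  interpret EE: vector_space_pair "pscale :: 'k \<Rightarrow> ('v \<Rightarrow>\<^sub>0 'k) \<Rightarrow> _" "pscale :: 'k \<Rightarrow> ('v \<Rightarrow>\<^sub>0 'k) \<Rightarrow> _" ..
  have sm: "c \<odot>\<^bsub>V\<^esub> v \<in> carrier V" if "v \<in> carrier V" for c v using V.smult_closed that by simp
  \<comment> \<open>Evaluates formal combinations of elements; symbols outside the carrier are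
    ignored, so every combination has a value in the module.\<close>
  define \<Theta> where "\<Theta> x = (\<Oplus>\<^bsub>V\<^esub> v \<in> Poly_Mapping.keys x \<inter> carrier V. Poly_Mapping.lookup x v \<odot>\<^bsub>V\<^esub> v)"
    for x :: "'v \<Rightarrow>\<^sub>0 'k"
  have sup: "\<Theta> x = (\<Oplus>\<^bsub>V\<^esub> v \<in> S. Poly_Mapping.lookup x v \<odot>\<^bsub>V\<^esub> v)"
    if "finite S" "Poly_Mapping.keys x \<inter> carrier V \<subseteq> S" "S \<subseteq> carrier V" for x S
    unfolding \<Theta>_def
  proof (rule V.add.finprod_mono_neutral_cong_left)
    fix v assume v: "v \<in> S - Poly_Mapping.keys x \<inter> carrier V"
    then have "Poly_Mapping.lookup x v = 0" "v \<in> carrier V" using that(3) by (auto simp: in_keys_iff)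
    then show "Poly_Mapping.lookup x v \<odot>\<^bsub>V\<^esub> v = \<zero>\<^bsub>V\<^esub>" using V.smult_l_null by simp
  qed (use that sm in auto)
  have cl: "\<Theta> x \<in> carrier V" for x
    unfolding \<Theta>_def by (rule V.finsum_closed) (auto intro: sm)
  have add: "\<Theta> (x + y) = \<Theta> x \<oplus>\<^bsub>V\<^esub> \<Theta> y" for x y
  proof -
    let ?S = "(Poly_Mapping.keys x \<union> Poly_Mapping.keys y) \<inter> carrier V"
    have S: "finite ?S" "?S \<subseteq> carrier V" by auto
    have "Poly_Mapping.keys (x + y) \<inter> carrier V \<subseteq> ?S" using keys_add[of x y] by blast
    then have "\<Theta> (x + y) = (\<Oplus>\<^bsub>V\<^esub> v \<in> ?S. Poly_Mapping.lookup (x + y) v \<odot>\<^bsub>V\<^esub> v)"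
      by (rule sup[OF S(1) _ S(2)])
    also have "\<dots> = (\<Oplus>\<^bsub>V\<^esub> v \<in> ?S. Poly_Mapping.lookup x v \<odot>\<^bsub>V\<^esub> v \<oplus>\<^bsub>V\<^esub> Poly_Mapping.lookup y v \<odot>\<^bsub>V\<^esub> v)"
      by (rule V.finsum_cong') (use V.smult_l_distr sm in \<open>auto simp: lookup_add\<close>)
    also have "\<dots> = \<Theta> x \<oplus>\<^bsub>V\<^esub> \<Theta> y"
      by (subst (1 2) sup[OF S(1) _ S(2)]) (auto intro!: V.finsum_addf sm)
    finally show ?thesis .
  qed
  have scale: "\<Theta> (pscale c x) = c \<odot>\<^bsub>V\<^esub> \<Theta> x" for c x
  proof -
    let ?S = "Poly_Mapping.keys x \<inter> carrier V"
    have S: "finite ?S" "?S \<subseteq> carrier V" by auto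
    have "Poly_Mapping.keys (pscale c x) \<inter> carrier V \<subseteq> ?S" by (auto simp: in_keys_iff)
    then have "\<Theta> (pscale c x) = (\<Oplus>\<^bsub>V\<^esub> v \<in> ?S. Poly_Mapping.lookup (pscale c x) v \<odot>\<^bsub>V\<^esub> v)"
      by (rule sup[OF S(1) _ S(2)])
    also have "\<dots> = (\<Oplus>\<^bsub>V\<^esub> v \<in> ?S. c \<odot>\<^bsub>V\<^esub> (Poly_Mapping.lookup x v \<odot>\<^bsub>V\<^esub> v))"
      by (rule V.finsum_cong') (use V.smult_assoc1 sm in auto)
    also have "\<dots> = c \<odot>\<^bsub>V\<^esub> \<Theta> x"
      unfolding \<Theta>_def using V.finsum_smult_ldistr[of ?S c "\<lambda>v. Poly_Mapping.lookup x v \<odot>\<^bsub>V\<^esub> v"] sm by auto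
    finally show ?thesis .
  qed
  have single: "\<Theta> (Poly_Mapping.single v 1) = v" if "v \<in> carrier V" for v
    using sup[of "{v}" "Poly_Mapping.single v 1"] that V.smult_one by simp
  define J where "J = {x. \<Theta> x = \<zero>\<^bsub>V\<^esub>}"
  have J: "E.subspace J"
  proof (rule E.subspaceI)
    show "0 \<in> J" by (simp add: J_def \<Theta>_def)
    show "x + y \<in> J" if "x \<in> J" "y \<in> J" for x y using that by (simp add: J_def add)
    show "pscale c x \<in> J" if "x \<in> J" for c x using that V.smult_r_null by (simp add: J_def scale)
  qed
  \<comment> \<open>\<open>g\<close> projects linearly onto the kernel \<open>J\<close> of
    \<open>\<Theta>\<close>; then x - g x depends only on \<open>\<Theta> x\<close> and provides the
    linear section \<open>\<sigma>\<close>.\<close>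
  obtain g where g: "range g \<subseteq> J" "Vector_Spaces.linear pscale pscale g" "\<And>x. x \<in> J \<Longrightarrow> g x = x"
    using EE.linear_exists_left_inverse_on[OF E.linear_id J] by auto
  interpret g: Vector_Spaces.linear pscale pscale g by (rule g(2))
  define \<sigma> where "\<sigma> v = (Poly_Mapping.single v 1) - g (Poly_Mapping.single v 1)" for v
  have \<sigma>: "x - g x = y - g y" if "\<Theta> x = \<Theta> y" for x y
  proof -
    have "\<Theta> (x - y) \<oplus>\<^bsub>V\<^esub> \<Theta> y = \<Theta> y" using add[of "x - y" y] that by simp
    then have "x - y \<in> J" using cl[of "x - y"] cl[of y] V.add.r_cancel_one[of "\<Theta> y" "\<Theta> (x - y)"] by (simp add: J_def)
    then have "g x - g y = x - y" using g(3)[of "x - y"] g.diff by simp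
    then show ?thesis by (simp add: algebra_simps)
  qed
  have \<Theta>_proj: "\<Theta> (x - g x) = \<Theta> x" for x
  proof -
    have "\<Theta> (g x) = \<zero>\<^bsub>V\<^esub>" using g(1) by (auto simp: J_def)
    then show ?thesis using add[of "x - g x" "g x"] cl by simp
  qed
  show thesis
  proof (rule that[of \<Theta> \<sigma>])
    show "\<Theta> (\<sigma> v) = v" if "v \<in> carrier V" for v unfolding \<sigma>_def \<Theta>_proj by (rule single[OF that])
    show "\<sigma> (v \<oplus>\<^bsub>V\<^esub> w) = \<sigma> v + \<sigma> w" if "v \<in> carrier V" "w \<in> carrier V" for v w
      using \<sigma>[of "Poly_Mapping.single (v \<oplus>\<^bsub>V\<^esub> w) 1" "Poly_Mapping.single v 1 + Poly_Mapping.single w 1"] that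
      by (simp add: single add \<sigma>_def g.add)
    show "\<sigma> (c \<odot>\<^bsub>V\<^esub> v) = pscale c (\<sigma> v)" if "v \<in> carrier V" for c v
      using \<sigma>[of "Poly_Mapping.single (c \<odot>\<^bsub>V\<^esub> v) 1" "pscale c (Poly_Mapping.single v 1)"] that sm
      by (simp add: single scale \<sigma>_def g.scale E.scale_right_diff_distrib)
  qed (rule cl add scale)+
qed

context vector_space_char_0
begin

text \<open>\<open>bor\<close> sums the two orders of the fields separately, the Jacobi identity of
  \<open>vertex_algebra\<close> in one sum; truncation on \<open>v\<close> bounds both by the same
  \<open>K\<close>.\<close>

lemma bor_eq_Sum_any:
  assumes "quantum_field A" "quantum_field B"
  shows "finite {i. binc l i *s (A (m + l - int i) (B (n + int i) v) - (-1) powi l *s B (n + l - int i) (A (m + int i) v)) \<noteq> 0}"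
    (is "finite {i. ?f i \<noteq> 0}")
    and "bor A B l m n v = Sum_any (\<lambda>i. binc l i *s (A (m + l - int i) (B (n + int i) v) - (-1) powi l *s B (n + l - int i) (A (m + int i) v)))"
proof -
  obtain M where M: "\<And>n. M \<le> n \<Longrightarrow> B n v = 0" using qf_trunc[OF assms(2)] by blast
  obtain N where N: "\<And>n. N \<le> n \<Longrightarrow> A n v = 0" using qf_trunc[OF assms(1)] by blast
  define K where "K = nat (max (M - n) (N - m))"
  have f0: "?f i = 0" if "K \<le> i" for i
  proof -
    have "M \<le> n + int i" "N \<le> m + int i" using that by (auto simp: K_def)
    then show ?thesis by (simp add: M N assms)
  qed
  have sub: "{i. ?f i \<noteq> 0} \<subseteq> {..<K}"
  proof
    fix i assume "i \<in> {i. ?f i \<noteq> 0}"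
    then show "i \<in> {..<K}" using f0[of i] by (cases "i < K") auto
  qed
  then show "finite {i. ?f i \<noteq> 0}" by (rule finite_subset) simp
  have "Sum_any ?f = (\<Sum>i<K. ?f i)" by (rule Sum_any.expand_superset[OF _ sub]) simp
  moreover have "ser (\<lambda>m n. A m (B n v)) l m n = (\<Sum>i<K. binc l i *s A (m + l - int i) (B (n + int i) v))"
    by (rule ser_eq_sum[of M]) (auto simp: M assms K_def)
  moreover have "ser (\<lambda>n m. B n (A m v)) l n m = (\<Sum>i<K. binc l i *s B (n + l - int i) (A (m + int i) v))"
    by (rule ser_eq_sum[of N]) (auto simp: N assms K_def)
  ultimately show "bor A B l m n v = Sum_any ?f"
    by (simp add: bor_def scale_right_diff_distrib sum_subtractf scale_sum_right mult.commute)
qed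

end

section \<open>The vacuum module\<close>

locale vacuum_mod = loop_algebra G B p
  for G :: "(complex, 'g) lie_alg" and B :: "'g \<Rightarrow> 'g \<Rightarrow> complex" and p :: "complex poly" +
  fixes lv :: complex
begin

abbreviation BB where "BB \<equiv> check_borel G B p"

lemma BB_simps: "x \<in> carrier BB \<longleftrightarrow> x \<in> carrier CH \<and> (\<forall>n<0. fst x n = \<zero>\<^bsub>EE\<^esub>)"
  "add BB = add CH" "module.smult BB = module.smult CH" "lie_bracket BB = br"
  by (cases x; auto simp: check_borel_def LL_simps)+

lemma env_alg_LL: "env_alg LL"
  by (rule env_alg.intro) (auto simp: LL_simps)

lemma fst_smult: "x \<in> carrier CH \<Longrightarrow> fst (f \<odot>\<^bsub>CH\<^esub> x) n = f \<odot>\<^bsub>EE\<^esub> fst x n"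
  by (cases x) (simp add: CH_simps)

lemma env_alg_BB: "env_alg BB"
  by (rule env_alg.intro) (auto simp: BB_simps fst_add fst_smult br_borel)

text \<open>On a module of rank one these operators commute, so brackets have to act as 0; they do,
  since by \<open>br_borel\<close> they have no central part and nothing else acts.\<close>

lemma rep_level: "lie_rep BB (*) (level_act lv)"
proof -
  have l: "level_act lv x f = fls_const lv * snd x * f" for x f
    by (cases x) (simp add: level_act_def)
  have "snd (x \<oplus>\<^bsub>CH\<^esub> y) = snd x + snd y" "snd (f \<odot>\<^bsub>CH\<^esub> x) = f * snd x" for f x y
    by (cases x; cases y; simp add: CH_simps)+
  then show ?thesis
    unfolding lie_rep_def using br_borel
    by (auto simp: l BB_simps klin_def algebra_simps)
qed

sublocale ind: induced LL BB "level_act lv"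
  by (intro induced.intro induced_axioms.intro env_alg_LL env_alg_BB rep_level)
     (auto simp: BB_simps LL_simps)

abbreviation VE where "VE \<equiv> ind.VE"
abbreviation VM where "VM \<equiv> vacuum_module G B p lv"
abbreviation vac where "vac \<equiv> ind.vacv"

lemma VM_simps: "carrier VM = carrier VE" "add VM = add VE" "\<zero>\<^bsub>VM\<^esub> = \<zero>\<^bsub>VE\<^esub>" "f \<odot>\<^bsub>VM\<^esub> v = ind.ks f v"
  by (simp_all add: vacuum_module_def vacuum_env_module_def Let_def ind.ks_def)

lemma vac_eq: "vacuum_vector G B p lv = vac"
  by (simp add: vacuum_vector_def)

definition mode where "mode w n v = ind.op (mono (ep 1 w) n) v"

lemma vacuum_op_eq: "vacuum_op G B p lv w n v = mode w n v"
  by (simp add: vacuum_op_def vacuum_env_module_def mode_def ind.op_def check_mode_mono)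

lemma VM_abelian: "abelian_group VM"
  by (rule abelian_groupI) (auto simp: VM_simps ind.VE.a_ac intro: bexI[of _ "\<ominus>\<^bsub>VE\<^esub> x" for x] ind.VE.l_neg)

lemma VM_module: "Module.module KK VM"
  by (rule Module.moduleI)
     (auto simp: cring_type_ring VM_abelian VM_simps ind.ks_add ind.ks_mult ind.ks_one amap_add[OF ind.amap_ks])

lemma mono_LL [simp]: "X \<in> carrier EE \<Longrightarrow> mono X n \<in> carrier LL" "cen h \<in> carrier LL"
  by (simp_all add: LL_simps)

lemma mode_closed [simp]: "w \<in> carrier DG \<Longrightarrow> v \<in> carrier VE \<Longrightarrow> mode w n v \<in> carrier VE"
  by (simp add: mode_def del: DG_simps)

lemma amap_mode: "w \<in> carrier DG \<Longrightarrow> amap VE VE (mode w n)"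
  using ind.amap_op[of "mono (ep 1 w) n"] by (simp add: mode_def[abs_def] del: DG_simps)

lemma mode_ks: "w \<in> carrier DG \<Longrightarrow> v \<in> carrier VE \<Longrightarrow> mode w n (ind.ks f v) = ind.ks f (mode w n v)"
  by (simp add: mode_def ind.op_ks del: DG_simps)

lemma ks_zero [simp]: "v \<in> carrier VE \<Longrightarrow> ind.ks 0 v = \<zero>\<^bsub>VE\<^esub>" "ind.ks f \<zero>\<^bsub>VE\<^esub> = \<zero>\<^bsub>VE\<^esub>"
proof -
  assume v: "v \<in> carrier VE"
  then have "ind.ks 0 v \<oplus>\<^bsub>VE\<^esub> ind.ks 0 v = ind.ks 0 v" using ind.ks_add[of v 0 0] by simp
  then show "ind.ks 0 v = \<zero>\<^bsub>VE\<^esub>" using v ind.VE.add.l_cancel_one by auto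
next
  show "ind.ks f \<zero>\<^bsub>VE\<^esub> = \<zero>\<^bsub>VE\<^esub>"
    by (rule amap_zero[OF ind.VE.abelian_group_axioms ind.VE.abelian_group_axioms ind.amap_ks])
qed

lemma op_zero [simp]: "x \<in> carrier LL \<Longrightarrow> ind.op x \<zero>\<^bsub>VE\<^esub> = \<zero>\<^bsub>VE\<^esub>"
  by (rule amap_zero[OF ind.VE.abelian_group_axioms ind.VE.abelian_group_axioms ind.amap_op])

lemma op_of_zero [simp]: "v \<in> carrier VE \<Longrightarrow> ind.op \<zero>\<^bsub>CH\<^esub> v = \<zero>\<^bsub>VE\<^esub>"
proof -
  assume v: "v \<in> carrier VE"
  have z: "\<zero>\<^bsub>CH\<^esub> \<in> carrier LL" by (simp add: LL_simps)
  then have "ind.op \<zero>\<^bsub>CH\<^esub> v \<oplus>\<^bsub>VE\<^esub> ind.op \<zero>\<^bsub>CH\<^esub> v = ind.op \<zero>\<^bsub>CH\<^esub> v"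
    using ind.op_add[OF z z v] by (simp add: LL_simps)
  then show ?thesis using v z ind.VE.add.l_cancel_one[of "ind.op \<zero>\<^bsub>CH\<^esub> v" "ind.op \<zero>\<^bsub>CH\<^esub> v"] by simp
qed

lemma op_mono: "w \<in> carrier DG \<Longrightarrow> v \<in> carrier VE \<Longrightarrow> ind.op (mono (ep f w) n) v = ind.ks f (mode w n v)"
proof -
  assume w: "w \<in> carrier DG" and v: "v \<in> carrier VE"
  have "mono (ep f w) n = f \<odot>\<^bsub>LL\<^esub> mono (ep 1 w) n"
    using w by (simp add: LL_simps smult_mono ep_smult del: DG_simps)
  then show ?thesis using w v by (simp add: ind.op_smult mode_def del: DG_simps)
qed

lemma level_act_snd: "level_act lv b f = fls_const lv * snd b * f"
  by (cases b) (simp add: level_act_def)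

text \<open>On the vacuum the central element acts by the level, and it commutes with the operators
  that generate the module from there.\<close>

lemma op_cen: "v \<in> carrier VE \<Longrightarrow> ind.op (cen h) v = ind.ks (fls_const lv * h) v"
proof (rule ind.VE_generated[of v])
  have "cen h \<in> carrier BB" by (simp add: BB_simps) (simp add: cen_def)
  from ind.op_sub_vac[OF this] show "ind.op (cen h) vac = ind.ks (fls_const lv * h) vac"
    by (simp add: level_act_snd cen_def)
next
  fix b x assume b: "b \<in> carrier LL" and x: "x \<in> carrier VE" "ind.op (cen h) x = ind.ks (fls_const lv * h) x"
  show "ind.op (cen h) (ind.op b x) = ind.ks (fls_const lv * h) (ind.op b x)"
    using b x ind.op_bracket[of "cen h" b x] by (simp add: LL_simps ind.op_ks)
qed (auto simp: amap_add[OF ind.amap_op] amap_add[OF ind.amap_ks] ind.op_ks ind.ks_mult[symmetric] mult.commute)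

text \<open>An element of the Lie algebra is a sum of C((z))-multiples of modes and a central
  element, and the latter acts as a scalar by \<open>op_cen\<close>.\<close>

lemma VE_generated_mode [consumes 1, case_names vac add ks mode]:
  assumes "v \<in> carrier VE" and vac: "P vac"
    and add: "\<And>x y. x \<in> carrier VE \<Longrightarrow> y \<in> carrier VE \<Longrightarrow> P x \<Longrightarrow> P y \<Longrightarrow> P (x \<oplus>\<^bsub>VE\<^esub> y)"
    and ks: "\<And>c x. x \<in> carrier VE \<Longrightarrow> P x \<Longrightarrow> P (ind.ks c x)"
    and mode: "\<And>w n x. w \<in> carrier DG \<Longrightarrow> x \<in> carrier VE \<Longrightarrow> P x \<Longrightarrow> P (mode w n x)"
  shows "P v"
proof (rule ind.VE_generated[OF assms(1-4)])
  fix b x assume b: "b \<in> carrier LL" and x: "x \<in> carrier VE" "P x"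
  show "P (ind.op b x)"
  proof (rule CH_induct[of b UNIV])
    show "b \<in> carrier CH" using b by (simp add: LL_simps)
    show "P (ind.op (cen h) x)" for h using x by (simp add: op_cen ks)
    show "P (ind.op (mono (ep f w) n) x)" if "w \<in> carrier DG" for f w n
      using x that by (simp add: op_mono ks mode del: DG_simps)
    show "P (ind.op (b \<oplus>\<^bsub>CH\<^esub> b') x)"
      if "b \<in> carrier CH" "b' \<in> carrier CH" "P (ind.op b x)" "P (ind.op b' x)" for b b'
      using ind.op_add[of b b' x] that x add[of "ind.op b x" "ind.op b' x"] by (simp add: LL_simps)
  qed auto
qed

lemma mode_vac: "w \<in> carrier DG \<Longrightarrow> 0 \<le> n \<Longrightarrow> mode w n vac = \<zero>\<^bsub>VE\<^esub>"
proof -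
  assume w: "w \<in> carrier DG" and n: "0 \<le> n"
  have "mono (ep 1 w) n \<in> carrier BB" using w n by (simp add: BB_simps del: DG_simps) (simp add: mono_def)
  from ind.op_sub_vac[OF this] show ?thesis by (simp add: mode_def level_act_snd mono_def)
qed

text \<open>The commutator of w(m) and w'(n) is of the form a(m + n) + m b(m + n), with
  \<open>comm_fun\<close> for a and \<open>comm_cen\<close> for the coefficient of the central
  element in b. In this form it is visibly killed by (x1 - x2)^2.\<close>

definition comm_fun :: "'g \<times> 'g \<Rightarrow> 'g \<times> 'g \<Rightarrow> int \<Rightarrow> 'g chk" where
  "comm_fun w w' k = ((\<lambda>r. (if r = k then ep 1 (W0 w w') else \<zero>\<^bsub>EE\<^esub>) \<oplus>\<^bsub>EE\<^esub> ep (PP (r - k)) (W1 w w')),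
     fls_const (1/2) * fls_const (c1 w w') * shift_coeff (fls_of_poly (pderiv p)) (- k - 1))"

definition comm_cen :: "'g \<times> 'g \<Rightarrow> 'g \<times> 'g \<Rightarrow> int \<Rightarrow> complex fls" where
  "comm_cen w w' k = fls_const (c0 w w') * (if k = 0 then 1 else 0) + fls_const (c1 w w') * PP (- k)"

lemma comm_fun_closed: "w \<in> carrier DG \<Longrightarrow> w' \<in> carrier DG \<Longrightarrow> comm_fun w w' k \<in> carrier CH"
  using cbp_closed[of w w' 0 1 k 1] by (simp add: cbp_eq comm_fun_def CH_simps cong: if_cong)

lemma cbp_comm_fun: "w \<in> carrier DG \<Longrightarrow> w' \<in> carrier DG \<Longrightarrow>
   cbp m (1, w) n (1, w') = comm_fun w w' (m + n) \<oplus>\<^bsub>CH\<^esub> of_int m \<odot>\<^bsub>CH\<^esub> cen (comm_cen w w' (m + n))"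
  unfolding smult_cen
  by (simp add: cbp_eq comm_fun_def cen_def CH_simps fun_eq_iff cc_def comm_cen_def algebra_simps del: DG_simps)

lemma mode_commutator:
  assumes w: "w \<in> carrier DG" "w' \<in> carrier DG" and v: "v \<in> carrier VE"
  shows "mode w m (mode w' n v) = (ind.op (comm_fun w w' (m + n)) v
     \<oplus>\<^bsub>VE\<^esub> ind.ks (of_int m) (ind.op (cen (comm_cen w w' (m + n))) v)) \<oplus>\<^bsub>VE\<^esub> mode w' n (mode w m v)"
proof -
  have c: "comm_fun w w' (m + n) \<in> carrier LL" "of_int m \<odot>\<^bsub>LL\<^esub> cen (comm_cen w w' (m + n)) \<in> carrier LL"
    using comm_fun_closed[OF w] by (auto simp: LL_simps)
  have "lie_bracket LL (mono (ep 1 w) m) (mono (ep 1 w') n)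
      = comm_fun w w' (m + n) \<oplus>\<^bsub>LL\<^esub> of_int m \<odot>\<^bsub>LL\<^esub> cen (comm_cen w w' (m + n))"
    using w by (simp add: LL_simps br_mono_ep cbp_comm_fun del: DG_simps check_bracket_pure.simps)
  then show ?thesis
    using ind.op_bracket[of "mono (ep 1 w) m" "mono (ep 1 w') n" v] w v c
    by (simp add: mode_def ind.op_add ind.op_smult del: DG_simps)
qed

text \<open>For k >= 0 the central entry is a coefficient of p'(z + x) at a negative power and
  vanishes; what remains is a finite C((z))-combination of modes of index at least
  \<open>k\<close>.\<close>

lemma op_comm_fun_zero:
  assumes w: "w \<in> carrier DG" "w' \<in> carrier DG" and v: "v \<in> carrier VE" and k: "0 \<le> k"
    and W0: "mode (W0 w w') k v = \<zero>\<^bsub>VE\<^esub>" and W1: "\<And>n. k \<le> n \<Longrightarrow> mode (W1 w w') n v = \<zero>\<^bsub>VE\<^esub>"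
  shows "ind.op (comm_fun w w' k) v = \<zero>\<^bsub>VE\<^esub>"
proof -
  \<comment> \<open>\<open>Z J\<close> collects the powers of x below \<open>J\<close> in p(z + x);
    with \<open>Suc (degree p)\<close> of them nothing is left out.\<close>
  define Z where "Z J = ((\<lambda>r. if r < k + int J then ep (PP (r - k)) (W1 w w') else \<zero>\<^bsub>EE\<^esub>), 0 :: complex fls)" for J
  note Wc = W_closed[OF w]
  have Z: "Z J \<in> carrier CH \<and> ind.op (Z J) v = \<zero>\<^bsub>VE\<^esub>" for J
  proof (induction J)
    case 0
    have "(\<lambda>r. if r < k then ep (PP (r - k)) (W1 w w') else \<zero>\<^bsub>EE\<^esub>) = (\<lambda>r. \<zero>\<^bsub>EE\<^esub>)"
      using Wc by (simp add: fun_eq_iff del: DG_simps)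
    then have "Z 0 = \<zero>\<^bsub>CH\<^esub>" by (simp add: Z_def CH_simps)
    then show ?case using v by simp
  next
    case (Suc J)
    have eq: "Z (Suc J) = Z J \<oplus>\<^bsub>CH\<^esub> mono (ep (PP (int J)) (W1 w w')) (k + int J)"
      using Wc by (simp add: Z_def mono_def CH_simps fun_eq_iff del: DG_simps)
    have "ind.op (mono (ep (PP (int J)) (W1 w w')) (k + int J)) v = \<zero>\<^bsub>VE\<^esub>"
      using Wc v W1 by (simp add: op_mono del: DG_simps)
    then show ?case
      unfolding eq using Suc v Wc ind.op_add[of "Z J" "mono (ep (PP (int J)) (W1 w w')) (k + int J)" v]
      by (simp add: LL_simps del: DG_simps)
  qed
  have P0: "PP (r - k) = 0" if "\<not> r < k + int (Suc (degree p))" for r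
    by (rule shift_coeff_poly_large) (use that in simp)
  have "comm_fun w w' k = mono (ep 1 (W0 w w')) k \<oplus>\<^bsub>CH\<^esub> Z (Suc (degree p))"
    using Wc k P0 by (simp add: comm_fun_def Z_def mono_def CH_simps fun_eq_iff del: DG_simps)
  then show ?thesis
    using Z[of "Suc (degree p)"] v Wc W0 ind.op_add[of "mono (ep 1 (W0 w w')) k" "Z (Suc (degree p))" v]
    by (simp add: LL_simps op_mono del: DG_simps)
qed

text \<open>The claim is carried for all \<open>w\<close> at once, since moving w(n) past w'(m)
  produces modes of \<open>W0 w w'\<close> and \<open>W1 w w'\<close> on the shorter vector.\<close>

lemma mode_trunc: "v \<in> carrier VE \<Longrightarrow> \<forall>w\<in>carrier DG. \<exists>N. \<forall>n\<ge>N. mode w n v = \<zero>\<^bsub>VE\<^esub>"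
proof (induction rule: VE_generated_mode)
  case vac
  then show ?case using mode_vac by blast
next
  case (add x y)
  show ?case
  proof
    fix w assume w: "w \<in> carrier DG"
    obtain M N where "\<And>n. M \<le> n \<Longrightarrow> mode w n x = \<zero>\<^bsub>VE\<^esub>" "\<And>n. N \<le> n \<Longrightarrow> mode w n y = \<zero>\<^bsub>VE\<^esub>"
      using add w by meson
    then show "\<exists>N. \<forall>n\<ge>N. mode w n (x \<oplus>\<^bsub>VE\<^esub> y) = \<zero>\<^bsub>VE\<^esub>"
      using add w by (intro exI[of _ "max M N"]) (simp add: amap_add[OF amap_mode] del: DG_simps)
  qed
next
  case (ks c x)
  show ?case
  proof
    fix w assume w: "w \<in> carrier DG"
    obtain M where "\<And>n. M \<le> n \<Longrightarrow> mode w n x = \<zero>\<^bsub>VE\<^esub>" using ks w by meson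
    then show "\<exists>N. \<forall>n\<ge>N. mode w n (ind.ks c x) = \<zero>\<^bsub>VE\<^esub>"
      using ks w by (intro exI[of _ M]) (simp add: mode_ks del: DG_simps)
  qed
next
  case (mode w' m x)
  show ?case
  proof
    fix w assume w: "w \<in> carrier DG"
    obtain M0 M1 M where M: "\<And>n. M0 \<le> n \<Longrightarrow> mode (W0 w w') n x = \<zero>\<^bsub>VE\<^esub>"
      "\<And>n. M1 \<le> n \<Longrightarrow> mode (W1 w w') n x = \<zero>\<^bsub>VE\<^esub>" "\<And>n. M \<le> n \<Longrightarrow> mode w n x = \<zero>\<^bsub>VE\<^esub>"
      using mode W_closed[OF w mode(1)] w by meson
    \<comment> \<open>The bound 1 - m makes n + m positive, so that the central contributions
      vanish; the other bound takes n past \<open>M\<close> and n + m past \<open>M0\<close> and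
      \<open>M1\<close>.\<close>
    have "mode w n (mode w' m x) = \<zero>\<^bsub>VE\<^esub>" if n: "max M (max M0 M1 + 1 - m) \<le> n" "1 - m \<le> n" for n
    proof -
      have k: "0 \<le> n + m" "M0 \<le> n + m" "M1 \<le> n + m" "n + m \<noteq> 0" "- (n + m) < 0" using n by auto
      have X: "ind.op (comm_fun w w' (n + m)) x = \<zero>\<^bsub>VE\<^esub>"
        by (rule op_comm_fun_zero[OF w mode(1,2) k(1)]) (use M k in auto)
      have "comm_cen w w' (n + m) = 0" using k by (simp add: comm_cen_def)
      moreover have "mode w' m \<zero>\<^bsub>VE\<^esub> = \<zero>\<^bsub>VE\<^esub>" using mode(1) by (simp add: mode_def del: DG_simps)
      ultimately show ?thesis
        using mode_commutator[OF w mode(1,2), of n m] X M(3)[of n] n mode(2) by (simp add: op_cen)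
    qed
    then show "\<exists>N. \<forall>n\<ge>N. mode w n (mode w' m x) = \<zero>\<^bsub>VE\<^esub>"
      by (intro exI[of _ "max (max M (max M0 M1 + 1 - m)) (1 - m)"]) auto
  qed
qed

end

text \<open>d/dt does not lead from t^0 to t^(-1): at n = -1 the coefficient carries the factor
  0.\<close>

lemma (in vacuum_mod) dC_borel:
  assumes "b \<in> carrier BB" shows "dC b \<in> carrier BB"
proof -
  have b: "b \<in> carrier CH" "\<And>n. n < 0 \<Longrightarrow> fst b n = \<zero>\<^bsub>EE\<^esub>" using assms by (auto simp: BB_simps)
  have "fst (dC b) n = \<zero>\<^bsub>EE\<^esub>" if "n < 0" for n
  proof (cases "n = -1")
    case True
    have "fst b 0 \<in> carrier EE" using b(1) by (auto simp: CH_simps)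
    then have "0 \<odot>\<^bsub>EE\<^esub> fst b 0 = \<zero>\<^bsub>EE\<^esub>" using EEm.smult_l_null by simp
    then show ?thesis using True b(2) by (simp add: dC_def)
  next
    case False
    then show ?thesis using that b(2)[of n] b(2)[of "n + 1"] EEm.smult_r_null by (simp add: dC_def)
  qed
  then show ?thesis using b(1) by (simp add: BB_simps)
qed

section \<open>The translation operator, with the module realized inside a vector space\<close>

locale vacuum_retract = vacuum_mod G B p lv
  for G :: "(complex, 'g) lie_alg" and B :: "'g \<Rightarrow> 'g \<Rightarrow> complex" and p :: "complex poly" and lv :: complex +
  fixes \<Theta> :: "('g vac \<Rightarrow>\<^sub>0 complex fls) \<Rightarrow> 'g vac" and \<sigma> :: "'g vac \<Rightarrow> 'g vac \<Rightarrow>\<^sub>0 complex fls"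
  assumes Th_closed [simp]: "\<Theta> x \<in> carrier VE"
    and Th_add: "\<Theta> (x + y) = \<Theta> x \<oplus>\<^bsub>VE\<^esub> \<Theta> y"
    and Th_scale: "\<Theta> (pscale c x) = ind.ks c (\<Theta> x)"
    and Th_sg [simp]: "v \<in> carrier VE \<Longrightarrow> \<Theta> (\<sigma> v) = v"
    and sg_add: "v \<in> carrier VE \<Longrightarrow> w \<in> carrier VE \<Longrightarrow> \<sigma> (v \<oplus>\<^bsub>VE\<^esub> w) = \<sigma> v + \<sigma> w"
    and sg_scale: "v \<in> carrier VE \<Longrightarrow> \<sigma> (ind.ks c v) = pscale c (\<sigma> v)"
begin

interpretation E: vector_space "pscale :: complex fls \<Rightarrow> ('g vac \<Rightarrow>\<^sub>0 complex fls) \<Rightarrow> _"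
  by (rule vector_space_pscale)

lemma sg_zero [simp]: "\<sigma> \<zero>\<^bsub>VE\<^esub> = 0"
  using sg_add[of "\<zero>\<^bsub>VE\<^esub>" "\<zero>\<^bsub>VE\<^esub>"] by simp

lemma Th_zero [simp]: "\<Theta> 0 = \<zero>\<^bsub>VE\<^esub>"
  using Th_add[of 0 0] Th_closed[of 0] ind.VE.add.l_cancel_one[of "\<Theta> 0" "\<Theta> 0"] by simp

lemma Th_minus: "\<Theta> (x - y) = \<Theta> x \<ominus>\<^bsub>VE\<^esub> \<Theta> y"
proof -
  have "\<Theta> (x - y) \<oplus>\<^bsub>VE\<^esub> \<Theta> y = \<Theta> x" using Th_add[of "x - y" y] by simp
  then show ?thesis
    by (metis Th_closed ind.VE.a_inv_closed ind.VE.a_assoc ind.VE.r_neg ind.VE.r_zero a_minus_def)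
qed

text \<open>The twisted action of \<open>\<complex>((z))\<close> for which a linear map \<open>v \<mapsto> (v, D v)\<close> is a derivation over \<open>d/dz\<close>.\<close>

definition tsc :: "complex fls \<Rightarrow> ('g vac \<Rightarrow>\<^sub>0 complex fls) \<times> ('g vac \<Rightarrow>\<^sub>0 complex fls)
    \<Rightarrow> ('g vac \<Rightarrow>\<^sub>0 complex fls) \<times> ('g vac \<Rightarrow>\<^sub>0 complex fls)" where
  "tsc f = (\<lambda>(x, y). (pscale f x, pscale f y + pscale (fls_deriv f) x))"

definition hat :: "'g chk \<Rightarrow> ('g vac \<Rightarrow>\<^sub>0 complex fls) \<Rightarrow> 'g vac \<Rightarrow>\<^sub>0 complex fls" where
  "hat b x = \<sigma> (ind.op b (\<Theta> x))"

text \<open>With (x, y) read as x + e y and e^2 = 0, \<open>b\<close> acts as b + e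
  \<open>dC b\<close>, and \<open>tsc f\<close> is multiplication by f + e f'. Since
  \<open>dC\<close> is a derivation over d/dz, both assignments respect sums, scalars and
  brackets.\<close>

definition trho :: "'g chk \<Rightarrow> ('g vac \<Rightarrow>\<^sub>0 complex fls) \<times> ('g vac \<Rightarrow>\<^sub>0 complex fls)
    \<Rightarrow> ('g vac \<Rightarrow>\<^sub>0 complex fls) \<times> ('g vac \<Rightarrow>\<^sub>0 complex fls)" where
  "trho b = (\<lambda>(x, y). (hat b x, hat b y + hat (dC b) x))"

lemma dC_LL [simp]: "b \<in> carrier LL \<Longrightarrow> dC b \<in> carrier LL"
  by (simp add: LL_simps)

lemma hat_props:
  assumes b: "b \<in> carrier LL" "b' \<in> carrier LL"
  shows "hat b (x + y) = hat b x + hat b y" "hat b (pscale f x) = pscale f (hat b x)"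
    "hat (b \<oplus>\<^bsub>LL\<^esub> b') x = hat b x + hat b' x" "hat (f \<odot>\<^bsub>LL\<^esub> b) x = pscale f (hat b x)"
    "hat (lie_bracket LL b b') x = hat b (hat b' x) - hat b' (hat b x)" "hat b 0 = 0"
proof -
  have cl: "lie_bracket LL b b' \<in> carrier LL" using b by (simp add: LL_simps)
  show "hat (lie_bracket LL b b') x = hat b (hat b' x) - hat b' (hat b x)"
    using ind.op_bracket[OF b, of "\<Theta> x"] b cl by (simp add: hat_def sg_add)
qed (use b in \<open>simp_all add: hat_def Th_add Th_scale amap_add[OF ind.amap_op] ind.op_ks ind.op_add ind.op_smult sg_add sg_scale\<close>)

lemma vector_space_tsc: "vector_space tsc"
  by standard (auto simp: tsc_def E.scale_right_distrib E.scale_left_distrib algebra_simps)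

lemma lie_rep_trho: "lie_rep LL tsc trho"
proof -
  have d: "dC (b \<oplus>\<^bsub>LL\<^esub> b') = dC b \<oplus>\<^bsub>LL\<^esub> dC b'" "dC (f \<odot>\<^bsub>LL\<^esub> b) = fls_deriv f \<odot>\<^bsub>LL\<^esub> b \<oplus>\<^bsub>LL\<^esub> f \<odot>\<^bsub>LL\<^esub> dC b"
    "dC (lie_bracket LL b b') = lie_bracket LL (dC b) b' \<oplus>\<^bsub>LL\<^esub> lie_bracket LL b (dC b')"
    "f \<odot>\<^bsub>LL\<^esub> b \<in> carrier LL" "b \<oplus>\<^bsub>LL\<^esub> b' \<in> carrier LL" "lie_bracket LL b b' \<in> carrier LL"
    if "b \<in> carrier LL" "b' \<in> carrier LL" for f b b'
    using that by (auto simp: LL_simps amap_add[OF amap_dC] dC_smult dC_br)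
  show ?thesis
    unfolding lie_rep_def klin_def
  proof (intro conjI ballI allI)
    fix b assume b: "b \<in> carrier LL"
    show "trho b (u + v) = trho b u + trho b v" for u v
      using b by (cases u; cases v) (simp add: trho_def hat_props)
    show "trho b (tsc c u) = tsc c (trho b u)" for c u
      using b by (cases u) (simp add: trho_def tsc_def hat_props E.scale_right_distrib ac_simps)
    show "trho (c \<odot>\<^bsub>LL\<^esub> b) u = tsc c (trho b u)" for c u
      using b by (cases u) (simp add: trho_def tsc_def hat_props d E.scale_right_distrib ac_simps)
    fix b' assume b': "b' \<in> carrier LL"
    show "trho (b \<oplus>\<^bsub>LL\<^esub> b') u = trho b u + trho b' u" for u
      using b b' by (cases u) (simp add: trho_def hat_props d ac_simps)
    show "trho (lie_bracket LL b b') u = trho b (trho b' u) - trho b' (trho b u)" for u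
      using b b' by (cases u) (simp add: trho_def hat_props d algebra_simps)
  qed
qed

text \<open>The vector (\<sigma> vac, 0) is admissible because on the subalgebra the character of
  \<open>dC b\<close> is the derivative of the character of \<open>b\<close>. By generation the
  first component of the resulting map is \<open>\<sigma>\<close>; the second component is the
  desired operator.\<close>

lemma derivation_exists:
  "\<exists>D. amap VE VE D \<and> D vac = \<zero>\<^bsub>VE\<^esub> \<and>
     (\<forall>f. \<forall>v\<in>carrier VE. D (ind.ks f v) = ind.ks f (D v) \<oplus>\<^bsub>VE\<^esub> ind.ks (fls_deriv f) v) \<and>
     (\<forall>b\<in>carrier LL. \<forall>v\<in>carrier VE. D (ind.op b v) = ind.op b (D v) \<oplus>\<^bsub>VE\<^esub> ind.op (dC b) v)"
proof -
  have m0: "trho b (\<sigma> vac, 0) = tsc (level_act lv b 1) (\<sigma> vac, 0)" if b: "b \<in> carrier BB" for b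
  proof -
    have bL: "b \<in> carrier LL" using b by (simp add: BB_simps LL_simps)
    have "level_act lv (dC b) 1 = fls_deriv (level_act lv b 1)"
      by (simp add: level_act_snd dC_def)
    then show ?thesis
      using ind.op_sub_vac[OF b] ind.op_sub_vac[OF dC_borel[OF b]] bL
      by (simp add: trho_def tsc_def hat_def sg_scale)
  qed
  obtain \<Phi> where \<Phi>: "\<And>x y. x \<in> carrier VE \<Longrightarrow> y \<in> carrier VE \<Longrightarrow> \<Phi> (x \<oplus>\<^bsub>VE\<^esub> y) = \<Phi> x + \<Phi> y"
    "\<Phi> vac = (\<sigma> vac, 0)"
    "\<And>c v. v \<in> carrier VE \<Longrightarrow> \<Phi> (ind.ks c v) = tsc c (\<Phi> v)"
    "\<And>b v. b \<in> carrier LL \<Longrightarrow> v \<in> carrier VE \<Longrightarrow> \<Phi> (ind.op b v) = trho b (\<Phi> v)"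
    by (rule ind.universal[OF vector_space_tsc lie_rep_trho m0], assumption, rule that)
  have fst: "fst (\<Phi> v) = \<sigma> v" if "v \<in> carrier VE" for v
    using that
  proof (rule ind.VE_generated)
    show "fst (\<Phi> vac) = \<sigma> vac" by (simp add: \<Phi>)
    show "fst (\<Phi> (x \<oplus>\<^bsub>VE\<^esub> y)) = \<sigma> (x \<oplus>\<^bsub>VE\<^esub> y)"
      if "x \<in> carrier VE" "y \<in> carrier VE" "fst (\<Phi> x) = \<sigma> x" "fst (\<Phi> y) = \<sigma> y" for x y
      using that by (simp add: \<Phi> sg_add)
    show "fst (\<Phi> (ind.ks c x)) = \<sigma> (ind.ks c x)" if "x \<in> carrier VE" "fst (\<Phi> x) = \<sigma> x" for c x
      using that by (simp add: \<Phi> sg_scale tsc_def split_beta)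
    show "fst (\<Phi> (ind.op b x)) = \<sigma> (ind.op b x)" if "b \<in> carrier LL" "x \<in> carrier VE" "fst (\<Phi> x) = \<sigma> x" for b x
      using that by (simp add: \<Phi> trho_def hat_def split_beta)
  qed
  define D where "D v = \<Theta> (snd (\<Phi> v))" for v
  have "amap VE VE D" by (rule amapI) (simp_all add: D_def \<Phi> Th_add)
  moreover have "D vac = \<zero>\<^bsub>VE\<^esub>" by (simp add: D_def \<Phi>)
  moreover have "D (ind.ks f v) = ind.ks f (D v) \<oplus>\<^bsub>VE\<^esub> ind.ks (fls_deriv f) v" if "v \<in> carrier VE" for f v
    using that by (simp add: D_def \<Phi> tsc_def split_beta Th_add Th_scale fst)
  moreover have "D (ind.op b v) = ind.op b (D v) \<oplus>\<^bsub>VE\<^esub> ind.op (dC b) v" if "b \<in> carrier LL" "v \<in> carrier VE" for b v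
    using that by (simp add: D_def \<Phi> trho_def hat_def split_beta Th_add fst)
  ultimately show ?thesis by blast
qed

definition transl :: "'g vac \<Rightarrow> 'g vac" where
  "transl = (SOME D. amap VE VE D \<and> D vac = \<zero>\<^bsub>VE\<^esub> \<and>
     (\<forall>f. \<forall>v\<in>carrier VE. D (ind.ks f v) = ind.ks f (D v) \<oplus>\<^bsub>VE\<^esub> ind.ks (fls_deriv f) v) \<and>
     (\<forall>b\<in>carrier LL. \<forall>v\<in>carrier VE. D (ind.op b v) = ind.op b (D v) \<oplus>\<^bsub>VE\<^esub> ind.op (dC b) v))"

lemma transl:
  "amap VE VE transl" "transl vac = \<zero>\<^bsub>VE\<^esub>"
  "v \<in> carrier VE \<Longrightarrow> transl (ind.ks f v) = ind.ks f (transl v) \<oplus>\<^bsub>VE\<^esub> ind.ks (fls_deriv f) v"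
  "b \<in> carrier LL \<Longrightarrow> v \<in> carrier VE \<Longrightarrow> transl (ind.op b v) = ind.op b (transl v) \<oplus>\<^bsub>VE\<^esub> ind.op (dC b) v"
  using someI_ex[OF derivation_exists] unfolding transl_def[symmetric] by auto

lemma transl_closed [simp]: "v \<in> carrier VE \<Longrightarrow> transl v \<in> carrier VE"
  by (rule amap_closed[OF transl(1)])

text \<open>The coefficient of w is the constant 1, whose derivative is 0, so \<open>dC\<close>
  merely lowers the exponent: [D, w(x)] = w'(x).\<close>

lemma transl_mode: "w \<in> carrier DG \<Longrightarrow> v \<in> carrier VE \<Longrightarrow>
    transl (mode w n v) = mode w n (transl v) \<oplus>\<^bsub>VE\<^esub> ind.ks (- of_int n) (mode w (n - 1) v)"
proof -
  assume w: "w \<in> carrier DG" and v: "v \<in> carrier VE"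
  have "dC (mono (ep 1 w) n) = mono (ep 0 w) n \<oplus>\<^bsub>LL\<^esub> mono (ep (- of_int n) w) (n - 1)"
    using w by (simp add: dC_mono_ep LL_simps del: DG_simps ep_zero)
  then have "transl (mode w n v) = mode w n (transl v)
      \<oplus>\<^bsub>VE\<^esub> (ind.op (mono (ep 0 w) n) v \<oplus>\<^bsub>VE\<^esub> ind.op (mono (ep (- of_int n) w) (n - 1)) v)"
    using w v by (simp add: mode_def transl(4) ind.op_add del: DG_simps ep_zero)
  then show ?thesis
    using w v by (simp add: op_mono del: DG_simps ep_zero)
qed

text \<open>Scalars are restricted to C because \<open>transl\<close> satisfies a Leibniz rule over
  C((z)) and is linear over C.\<close>

abbreviation csc :: "complex \<Rightarrow> ('g vac \<Rightarrow>\<^sub>0 complex fls) \<Rightarrow> 'g vac \<Rightarrow>\<^sub>0 complex fls" where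
  "csc c \<equiv> pscale (fls_const c)"

section \<open>The generating fields and their locality\<close>

definition lift_op :: "('g vac \<Rightarrow> 'g vac) \<Rightarrow> ('g vac \<Rightarrow>\<^sub>0 complex fls) \<Rightarrow> 'g vac \<Rightarrow>\<^sub>0 complex fls" where
  "lift_op T x = \<sigma> (T (\<Theta> x))"

definition u_field :: "'g \<times> 'g \<Rightarrow> int \<Rightarrow> ('g vac \<Rightarrow>\<^sub>0 complex fls) \<Rightarrow> 'g vac \<Rightarrow>\<^sub>0 complex fls" where
  "u_field w n = lift_op (mode w n)"

text \<open>The modes of \<open>f(z + x)\<close>, the field of the state \<open>f(z) 1\<close>.\<close>

definition f_field :: "complex fls \<Rightarrow> int \<Rightarrow> ('g vac \<Rightarrow>\<^sub>0 complex fls) \<Rightarrow> 'g vac \<Rightarrow>\<^sub>0 complex fls" where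
  "f_field f n = lift_op (ind.ks (shift_coeff f (- 1 - n)))"

definition gens where "gens = u_field ` carrier DG \<union> range f_field"

lemma vector_space_csc: "vector_space csc"
  by standard (auto simp: E.scale_right_distrib E.scale_left_distrib simp flip: fls_plus_const)

interpretation C: vector_space_char_0 csc
  by (rule vector_space_char_0.intro) (rule vector_space_csc)

lemma lin_lift_op:
  assumes "amap VE VE T" "\<And>c v. v \<in> carrier VE \<Longrightarrow> T (ind.ks (fls_const c) v) = ind.ks (fls_const c) (T v)"
  shows "C.lin (lift_op T)"
  using amap_closed[OF assms(1)] amap_add[OF assms(1)] assms(2)
  by (simp add: C.lin_def lift_op_def Th_add Th_scale sg_add sg_scale)

lemma ks_commute: "v \<in> carrier VE \<Longrightarrow> ind.ks f (ind.ks g v) = ind.ks g (ind.ks f v)"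
  by (simp add: ind.ks_mult[symmetric] mult.commute)

lemma gen_qf: "g \<in> gens \<Longrightarrow> C.quantum_field g"
  unfolding gens_def C.quantum_field_def
proof (elim UnE imageE; intro conjI allI)
  fix w n assume *: "g = u_field w" "w \<in> carrier DG"
  show "C.lin (g n)"
    unfolding * u_field_def using *(2) by (intro lin_lift_op amap_mode) (auto simp: mode_ks simp del: DG_simps)
next
  fix w v assume *: "g = u_field w" "w \<in> carrier DG"
  obtain N where "\<And>n. N \<le> n \<Longrightarrow> mode w n (\<Theta> v) = \<zero>\<^bsub>VE\<^esub>" using bspec[OF mode_trunc[OF Th_closed, of v] *(2)] by blast
  then show "\<exists>N. \<forall>n\<ge>N. g n v = 0" by (intro exI[of _ N]) (simp add: * u_field_def lift_op_def)
next
  fix f n assume *: "g = f_field f"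
  show "C.lin (g n)" unfolding * f_field_def by (intro lin_lift_op ind.amap_ks) (rule ks_commute)
next
  fix f v assume *: "g = f_field f"
  show "\<exists>N. \<forall>n\<ge>N. g n v = 0" by (intro exI[of _ 0]) (simp add: * f_field_def lift_op_def)
qed

lemma f_field_commutes: "g \<in> gens \<Longrightarrow> f_field f m (g n v) = g n (f_field f m v)"
  unfolding gens_def
  by (elim UnE imageE) (auto simp: f_field_def u_field_def lift_op_def mode_ks ks_commute simp del: DG_simps)

text \<open>\<open>dif\<close> kills functions of m + n and turns m b(m + n) into b(m + n + 1), so
  two applications suffice.\<close>

lemma u_field_local: "w \<in> carrier DG \<Longrightarrow> w' \<in> carrier DG \<Longrightarrow> C.local (u_field w) (u_field w')"
proof -
  assume w: "w \<in> carrier DG" "w' \<in> carrier DG"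
  have "(dif ^^ 2) (\<lambda>m n. u_field w m (u_field w' n v) - u_field w' n (u_field w m v)) = 0" for v
  proof -
    let ?a = "\<lambda>k. \<sigma> (ind.op (comm_fun w w' k) (\<Theta> v))" and ?b = "\<lambda>k. \<sigma> (ind.op (cen (comm_cen w w' k)) (\<Theta> v))"
    have X: "ind.op (comm_fun w w' k) (\<Theta> v) \<in> carrier VE" for k using comm_fun_closed[OF w] by (simp add: LL_simps)
    have "(\<lambda>m n. u_field w m (u_field w' n v) - u_field w' n (u_field w m v)) = (\<lambda>m n. ?a (m + n) + pscale (of_int m) (?b (m + n)))"
      using w X by (simp add: fun_eq_iff u_field_def lift_op_def mode_commutator[OF w] sg_add sg_scale del: DG_simps)
    moreover have "pscale 2 x = x + x" for x :: "'g vac \<Rightarrow>\<^sub>0 complex fls"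
      using E.scale_left_distrib[of 1 1 x] by simp
    then have "dif (dif (\<lambda>m n. ?a (m + n) + pscale (of_int m) (?b (m + n)))) = 0"
      by (simp add: fun_eq_iff dif_def E.scale_left_distrib algebra_simps)
    ultimately show ?thesis by (simp add: numeral_2_eq_2)
  qed
  then show ?thesis unfolding C.local_def by blast
qed

lemma gen_local: "g \<in> gens \<Longrightarrow> h \<in> gens \<Longrightarrow> C.local g h"
proof -
  assume g: "g \<in> gens" and h: "h \<in> gens"
  have triv: "C.local A A'" if "\<And>m n v. A m (A' n v) = A' n (A m v)" for A A'
    unfolding C.local_def by (intro exI[of _ 0]) (simp add: that fun_eq_iff)
  consider f where "g = f_field f" | f where "h = f_field f"
    | w w' where "w \<in> carrier DG" "w' \<in> carrier DG" "g = u_field w" "h = u_field w'"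
    using g h unfolding gens_def by blast
  then show ?thesis
  proof cases
    case 1
    show ?thesis by (rule triv) (simp add: 1 f_field_commutes[OF h])
  next
    case 2
    show ?thesis by (rule triv) (simp add: 2 f_field_commutes[OF g])
  qed (simp add: u_field_local del: DG_simps)
qed

definition state_space where "state_space = \<sigma> ` carrier VE"

lemma state_space_Th: "x \<in> state_space \<Longrightarrow> \<sigma> (\<Theta> x) = x"
  by (auto simp: state_space_def)

lemma sg_state_space [simp]: "v \<in> carrier VE \<Longrightarrow> \<sigma> v \<in> state_space"
  by (simp add: state_space_def)

lemma fls_const_of_int: "fls_const (of_int n :: complex) = of_int n"
  by (simp add: fls_of_int)

sublocale FS: field_system csc gens state_space "\<sigma> vac" "lift_op transl" "range (\<lambda>f. lift_op (ind.ks f))"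
proof (rule field_system.intro[OF C.vector_space_char_0_axioms], rule field_system_axioms.intro)
  fix g assume g: "g \<in> gens"
  show "C.quantum_field g" by (rule gen_qf[OF g])
  show "C.local g h" if "h \<in> gens" for h by (rule gen_local[OF g that])
  show "g n (\<sigma> vac) = 0" if "0 \<le> n" for n
    using g that unfolding gens_def by (auto simp: u_field_def f_field_def lift_op_def mode_vac simp del: DG_simps)
  show "g n v \<in> state_space" for n v
    using g unfolding gens_def by (auto simp: u_field_def f_field_def lift_op_def state_space_def simp del: DG_simps)
  show "lift_op transl (g n v) = g n (lift_op transl v) - csc (of_int n) (g (n - 1) v)" for n v
    using g unfolding gens_def
  proof (elim UnE imageE)
    fix w assume w: "w \<in> carrier DG" "g = u_field w"
    then show ?thesis
      by (simp add: u_field_def lift_op_def transl_mode sg_add sg_scale fls_const_of_int del: DG_simps)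
  next
    fix f assume f: "g = f_field f"
    \<comment> \<open>d/dz equals d/dx on f(z + x), read off at the power x^(-1-n).\<close>
    have "fls_deriv (shift_coeff f (- 1 - n)) = - of_int n * shift_coeff f (- 1 - (n - 1))"
      using shift_coeff_deriv[of f "- 1 - n"] by simp
    then show ?thesis
      by (simp add: f f_field_def lift_op_def transl sg_add sg_scale fls_const_of_int Th_scale)
  qed
  show "f (g n v) = g n (f v)" if f: "f \<in> range (\<lambda>f. lift_op (ind.ks f))" for f n v
  proof -
    obtain h where "f = lift_op (ind.ks h)" using f by blast
    then show ?thesis using f_field_commutes[OF g, of h "-1" n v] by (simp add: f_field_def)
  qed
next
  show "C.subspace state_space"
    unfolding C.subspace_def state_space_def
  proof (intro conjI ballI allI)
    show "0 \<in> \<sigma> ` carrier VE" by (rule image_eqI[of _ _ "\<zero>\<^bsub>VE\<^esub>"]) simp_all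
    show "x + y \<in> \<sigma> ` carrier VE" if "x \<in> \<sigma> ` carrier VE" "y \<in> \<sigma> ` carrier VE" for x y
      using that by (auto simp: sg_add[symmetric])
    show "csc c x \<in> \<sigma> ` carrier VE" if "x \<in> \<sigma> ` carrier VE" for c x
      using that by (auto simp: sg_scale[symmetric])
  qed
  show "\<sigma> vac \<in> state_space" by simp
  show "C.lin (lift_op transl)"
    by (rule lin_lift_op[OF transl(1)]) (simp add: transl)
  show "lift_op transl (\<sigma> vac) = 0" by (simp add: lift_op_def transl)
  show "C.lin f" if "f \<in> range (\<lambda>f. lift_op (ind.ks f))" for f
    using that lin_lift_op[OF ind.amap_ks] by (auto simp: ks_commute)
next
  fix X assume X: "\<sigma> vac \<in> X" "\<And>x y. x \<in> X \<Longrightarrow> y \<in> X \<Longrightarrow> x + y \<in> X" "\<And>g n x. g \<in> gens \<Longrightarrow> x \<in> X \<Longrightarrow> g n x \<in> X"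
  have "\<sigma> v \<in> X" if "v \<in> carrier VE" for v
    using that
  proof (rule VE_generated_mode)
    show "\<sigma> vac \<in> X" by (rule X(1))
    show "\<sigma> (x \<oplus>\<^bsub>VE\<^esub> y) \<in> X" if "x \<in> carrier VE" "y \<in> carrier VE" "\<sigma> x \<in> X" "\<sigma> y \<in> X" for x y
      using that X(2) by (simp add: sg_add)
    \<comment> \<open>Multiplication by \<open>c\<close> is the mode of index -1 of c(z + x), its
      constant term in x; thus closure under generators includes closure under scalars.\<close>
    show "\<sigma> (ind.ks c x) \<in> X" if "x \<in> carrier VE" "\<sigma> x \<in> X" for c x
      using X(3)[of "f_field c" "\<sigma> x" "-1"] that by (simp add: gens_def f_field_def lift_op_def)
    show "\<sigma> (mode w n x) \<in> X" if "w \<in> carrier DG" "x \<in> carrier VE" "\<sigma> x \<in> X" for w n x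
      using X(3)[of "u_field w" "\<sigma> x" n] that by (simp add: gens_def u_field_def lift_op_def del: DG_simps)
  qed
  then show "state_space \<subseteq> X" by (auto simp: state_space_def)
qed

section \<open>The vertex operators on the module\<close>

definition vertex_op :: "'g vac \<Rightarrow> int \<Rightarrow> 'g vac \<Rightarrow> 'g vac" where
  "vertex_op u n v = \<Theta> (FS.state_field (\<sigma> u) n (\<sigma> v))"

lemma vertex_op_closed [simp]: "vertex_op u n v \<in> carrier VE"
  by (simp add: vertex_op_def)

lemma sg_vertex_op: "u \<in> carrier VE \<Longrightarrow> v \<in> carrier VE \<Longrightarrow> \<sigma> (vertex_op u n v) = FS.state_field (\<sigma> u) n (\<sigma> v)"
  unfolding vertex_op_def by (intro state_space_Th FS.state_field_W) simp_all

lemma vertex_op_add_left: "u \<in> carrier VE \<Longrightarrow> u' \<in> carrier VE \<Longrightarrow> v \<in> carrier VE \<Longrightarrow>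
    vertex_op (u \<oplus>\<^bsub>VE\<^esub> u') n v = vertex_op u n v \<oplus>\<^bsub>VE\<^esub> vertex_op u' n v"
  by (simp add: vertex_op_def sg_add FS.state_field_add Th_add)

lemma state_field_lin: "u \<in> carrier VE \<Longrightarrow> C.lin (FS.state_field (\<sigma> u) n)"
  by (rule C.qf_lin[OF FS.state_field_field]) simp

lemma vertex_op_add_right: "u \<in> carrier VE \<Longrightarrow> v \<in> carrier VE \<Longrightarrow> v' \<in> carrier VE \<Longrightarrow>
    vertex_op u n (v \<oplus>\<^bsub>VE\<^esub> v') = vertex_op u n v \<oplus>\<^bsub>VE\<^esub> vertex_op u n v'"
  by (simp add: vertex_op_def sg_add C.lin_add[OF state_field_lin] Th_add)

lemma vertex_op_ks_right:
  assumes "u \<in> carrier VE" "v \<in> carrier VE"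
  shows "vertex_op u n (ind.ks f v) = ind.ks f (vertex_op u n v)"
proof -
  have "lift_op (ind.ks f) (FS.state_field (\<sigma> u) n (\<sigma> v)) = FS.state_field (\<sigma> u) n (lift_op (ind.ks f) (\<sigma> v))"
    by (rule FS.state_field_K) (use assms in auto)
  then have "\<Theta> (lift_op (ind.ks f) (FS.state_field (\<sigma> u) n (\<sigma> v))) = vertex_op u n (ind.ks f v)"
    using assms by (simp add: vertex_op_def lift_op_def)
  then show ?thesis by (simp add: lift_op_def vertex_op_def)
qed

lemma vertex_op_trunc: "u \<in> carrier VE \<Longrightarrow> \<exists>N. \<forall>n\<ge>N. vertex_op u n v = \<zero>\<^bsub>VE\<^esub>"
proof -
  assume "u \<in> carrier VE"
  then obtain N where "\<And>n. N \<le> n \<Longrightarrow> FS.state_field (\<sigma> u) n (\<sigma> v) = 0"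
    using C.qf_trunc[OF FS.state_field_field[of "\<sigma> u"], of "\<sigma> v"] by auto
  then show ?thesis by (intro exI[of _ N]) (simp add: vertex_op_def)
qed

lemma vertex_op_vac: "v \<in> carrier VE \<Longrightarrow> vertex_op vac n v = (if n = -1 then v else \<zero>\<^bsub>VE\<^esub>)"
  by (simp add: vertex_op_def FS.state_field_vac)

lemma vertex_op_creation: "u \<in> carrier VE \<Longrightarrow> vertex_op u (-1) vac = u" "u \<in> carrier VE \<Longrightarrow> 0 \<le> n \<Longrightarrow> vertex_op u n vac = \<zero>\<^bsub>VE\<^esub>"
  by (simp_all add: vertex_op_def FS.state_field_creation FS.state_field_creation_nonneg)

lemma vertex_op_mode: "w \<in> carrier DG \<Longrightarrow> v \<in> carrier VE \<Longrightarrow> vertex_op (mode w (-1) vac) n v = mode w n v"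
  using FS.state_field_gen[of "u_field w" "\<sigma> v" n] by (simp add: vertex_op_def gens_def u_field_def lift_op_def del: DG_simps)

lemma state_field_zero_left: "x \<in> state_space \<Longrightarrow> FS.state_field 0 n x = 0"
  using FS.state_field_add[of 0 0 x n] C.subspace_0[OF FS.W_subspace] by simp

text \<open>Finite support allows both total sums to be replaced by the same finite sum, on which
  \<open>\<Theta>\<close> is additive.\<close>

lemma gsum_Theta:
  assumes "finite {i. g i \<noteq> 0}"
  shows "gsum VE (\<lambda>i. \<Theta> (g i)) = \<Theta> (Sum_any g)"
proof -
  have "gsum VE (\<lambda>i. \<Theta> (g i)) = gfinprod (add_monoid VE) (\<lambda>i. \<Theta> (g i)) {i. g i \<noteq> 0}"
    unfolding gsum_def
    by (rule ind.VE.add.gfinprod_mono_neutral_cong_left[symmetric]) auto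
  also have "\<dots> = finsum VE (\<lambda>i. \<Theta> (g i)) {i. g i \<noteq> 0}"
    using assms ind.VE.add.gfinprod_eq_finprod[of "{i. g i \<noteq> 0}" "\<lambda>i. \<Theta> (g i)"] by (simp add: finsum_def)
  also have "\<dots> = \<Theta> (\<Sum>i | g i \<noteq> 0. g i)"
    using assms by (induction rule: finite_induct) (simp_all add: Th_add)
  also have "\<dots> = \<Theta> (Sum_any g)" by (simp add: Sum_any.expand_set)
  finally show ?thesis .
qed

lemma vertex_op_jacobi:
  assumes "u \<in> carrier VE" "v \<in> carrier VE" "w \<in> carrier VE"
  shows "gsum VE (\<lambda>i. ind.ks (fls_const ((-1) ^ i * (of_int l gchoose i)))
            (vertex_op u (m + l - int i) (vertex_op v (n + int i) w)
              \<ominus>\<^bsub>VE\<^esub> ind.ks (fls_const ((-1) powi l)) (vertex_op v (n + l - int i) (vertex_op u (m + int i) w))))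
        = gsum VE (\<lambda>i. ind.ks (fls_const (of_int m gchoose i)) (vertex_op (vertex_op u (l + int i) v) (m + n - int i) w))"
proof -
  note q = FS.state_field_field[OF sg_state_space[OF assms(1)]] FS.state_field_field[OF sg_state_space[OF assms(2)]]
  let ?U = "FS.state_field (\<sigma> u)" and ?V = "FS.state_field (\<sigma> v)"
  let ?L = "\<lambda>i. csc (C.binc l i) (?U (m + l - int i) (?V (n + int i) (\<sigma> w))
      - csc ((-1) powi l) (?V (n + l - int i) (?U (m + int i) (\<sigma> w))))"
  let ?R = "\<lambda>i. csc (of_int m gchoose i) (FS.state_field (?U (l + int i) (\<sigma> v)) (m + n - int i) (\<sigma> w))"
  \<comment> \<open>u_k v is 0 for large k, and the field of the state 0 is 0.\<close>
  have finR: "finite {i. ?R i \<noteq> 0}"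
  proof -
    obtain N where N: "\<And>k. N \<le> k \<Longrightarrow> ?U k (\<sigma> v) = 0" using C.qf_trunc[OF q(1)] by blast
    have "{i. ?R i \<noteq> 0} \<subseteq> {..<nat (N - l)}"
    proof
      fix i assume i: "i \<in> {i. ?R i \<noteq> 0}"
      have "?R i = 0" if "N \<le> l + int i" using N[OF that] assms by (simp add: state_field_zero_left)
      then show "i \<in> {..<nat (N - l)}" using i by (cases "N \<le> l + int i") auto
    qed
    then show ?thesis by (rule finite_subset) simp
  qed
  have "gsum VE (\<lambda>i. \<Theta> (?L i)) = \<Theta> (Sum_any ?L)"
    by (rule gsum_Theta[OF C.bor_eq_Sum_any(1)[OF q]])
  also have "Sum_any ?L = Sum_any ?R"
    using C.bor_eq_Sum_any(2)[OF q, of l m n "\<sigma> w"] FS.state_field_jacobi[of "\<sigma> u" "\<sigma> v" "\<sigma> w" l m n] assms by simp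
  also have "\<Theta> (Sum_any ?R) = gsum VE (\<lambda>i. \<Theta> (?R i))"
    by (rule gsum_Theta[OF finR, symmetric])
  also have "(\<lambda>i. \<Theta> (?L i)) = (\<lambda>i. ind.ks (fls_const ((-1) ^ i * (of_int l gchoose i)))
            (vertex_op u (m + l - int i) (vertex_op v (n + int i) w)
              \<ominus>\<^bsub>VE\<^esub> ind.ks (fls_const ((-1) powi l)) (vertex_op v (n + l - int i) (vertex_op u (m + int i) w))))"
  proof
    fix i
    show "\<Theta> (?L i) = ind.ks (fls_const ((-1) ^ i * (of_int l gchoose i)))
            (vertex_op u (m + l - int i) (vertex_op v (n + int i) w)
              \<ominus>\<^bsub>VE\<^esub> ind.ks (fls_const ((-1) powi l)) (vertex_op v (n + l - int i) (vertex_op u (m + int i) w)))"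
      unfolding vertex_op_def[of u "m + l - int i"] vertex_op_def[of v "n + l - int i"] sg_vertex_op[OF assms(2,3)] sg_vertex_op[OF assms(1,3)]
      by (simp only: Th_scale Th_minus C.binc_def)
  qed
  also have "(\<lambda>i. \<Theta> (?R i)) = (\<lambda>i. ind.ks (fls_const (of_int m gchoose i)) (vertex_op (vertex_op u (l + int i) v) (m + n - int i) w))"
    unfolding vertex_op_def[of "vertex_op u (l + int i) v" for i] sg_vertex_op[OF assms(1,2)] by (simp only: Th_scale)
  finally show ?thesis .
qed

text \<open>f u equals (f 1)_(-1) u, so its field is the product of index -1 of f(z + x) with Y(u,
  x). Since f(z + x) has no modes of nonnegative index, the reversed half vanishes and f(z + x) Y(u,
  x) remains.\<close>

lemma vertex_op_ks_left:
  assumes "u \<in> carrier VE" "v \<in> carrier VE"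
  shows "vertex_op (ind.ks f u) n v = gsum VE (\<lambda>j. ind.ks (shift_coeff f (int j)) (vertex_op u (n + int j) v))"
proof -
  define a where "a = f_field f (-1) (\<sigma> vac)"
  have f_field: "f_field f \<in> gens" by (auto simp: gens_def)
  have a: "a \<in> state_space" by (simp add: a_def FS.gen_W[OF f_field])
  have Ya: "FS.state_field a k x = f_field f k x" if "x \<in> state_space" for k x
    unfolding a_def by (rule FS.state_field_gen[OF f_field that])
  have u: "FS.state_field a (-1) (\<sigma> u) = \<sigma> (ind.ks f u)"
    using assms by (simp add: Ya f_field_def lift_op_def)
  have W: "FS.state_field (\<sigma> u) k (\<sigma> v) \<in> state_space" for k using assms by (intro FS.state_field_W) auto
  \<comment> \<open>In the expansion of (x1 - x2)^(-1) all coefficients are 1.\<close>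
  have b0: "C.binc (-1) i = 1" for i
    by (simp add: C.binc_def gbinomial_minus) (simp add: binomial_gbinomial[symmetric] flip: power_add mult_2)
  have "FS.state_field (\<sigma> (ind.ks f u)) n (\<sigma> v) = C.nprod (FS.state_field a) (FS.state_field (\<sigma> u)) (-1) n (\<sigma> v)"
    using FS.state_field_nprod[OF a, of "\<sigma> u" "\<sigma> v" "-1" n] assms by (simp add: u)
  also have "\<dots> = Sum_any (\<lambda>i. f_field f (- 1 - int i) (FS.state_field (\<sigma> u) (n + int i) (\<sigma> v)))"
  proof -
    have t: "f_field f (int i) (\<sigma> v) = 0" for i by (simp add: f_field_def lift_op_def assms)
    show ?thesis
      unfolding C.nprod_def C.bor_eq_Sum_any(2)[OF FS.state_field_field[OF a] FS.state_field_field[OF sg_state_space[OF assms(1)]]]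
      using assms W by (intro Sum_any.cong) (simp add: b0 Ya t C.lin_zero[OF state_field_lin])
  qed
  finally have e: "FS.state_field (\<sigma> (ind.ks f u)) n (\<sigma> v) = Sum_any (\<lambda>i. f_field f (- 1 - int i) (FS.state_field (\<sigma> u) (n + int i) (\<sigma> v)))" .
  obtain N where N: "\<And>k. N \<le> k \<Longrightarrow> FS.state_field (\<sigma> u) k (\<sigma> v) = 0"
    using C.qf_trunc[OF FS.state_field_field[OF sg_state_space[OF assms(1)]]] by blast
  have "{i. f_field f (- 1 - int i) (FS.state_field (\<sigma> u) (n + int i) (\<sigma> v)) \<noteq> 0} \<subseteq> {..<nat (N - n)}"
  proof
    fix i assume i: "i \<in> {i. f_field f (- 1 - int i) (FS.state_field (\<sigma> u) (n + int i) (\<sigma> v)) \<noteq> 0}"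
    have "f_field f (- 1 - int i) (FS.state_field (\<sigma> u) (n + int i) (\<sigma> v)) = 0" if "N \<le> n + int i"
      using N[OF that] by (simp add: f_field_def lift_op_def)
    then show "i \<in> {..<nat (N - n)}" using i by (cases "N \<le> n + int i") auto
  qed
  then have "finite {i. f_field f (- 1 - int i) (FS.state_field (\<sigma> u) (n + int i) (\<sigma> v)) \<noteq> 0}" by (rule finite_subset) simp
  from gsum_Theta[OF this] show ?thesis
    unfolding vertex_op_def[of "ind.ks f u"] e by (simp add: f_field_def lift_op_def vertex_op_def)
qed

end

section \<open>Uniqueness of the vertex algebra structure\<close>

text \<open>\<open>VE\<close>, \<open>VM\<close> and \<open>CV\<close> are records over one additive
  group with different scalars; sums and differences may be moved between them.\<close>

lemma gsum_same_group:
  assumes "carrier V = carrier V'" "add V = add V'" "\<zero>\<^bsub>V\<^esub> = \<zero>\<^bsub>V'\<^esub>"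
  shows "gsum V f = gsum V' f"
  using assms by (simp add: gsum_def gfinprod_def finprod_def)

lemma a_minus_same_group:
  assumes "carrier V = carrier V'" "add V = add V'" "\<zero>\<^bsub>V\<^esub> = \<zero>\<^bsub>V'\<^esub>"
  shows "x \<ominus>\<^bsub>V\<^esub> y = x \<ominus>\<^bsub>V'\<^esub> y"
  using assms by (simp add: a_minus_def a_inv_def m_inv_def)

context vacuum_mod
begin

abbreviation CV where "CV \<equiv> complex_restriction VM"

lemma CV_simps: "carrier CV = carrier VE" "add CV = add VE" "\<zero>\<^bsub>CV\<^esub> = \<zero>\<^bsub>VE\<^esub>"
  "c \<odot>\<^bsub>CV\<^esub> v = ind.ks (fls_const c) v"
  by (simp_all add: complex_restriction_def VM_simps)

lemma gsum_CV: "gsum CV f = gsum VE f" and gsum_VM: "gsum VM f = gsum VE f"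
  by (rule gsum_same_group; simp add: CV_simps VM_simps)+

lemma minus_CV: "x \<ominus>\<^bsub>CV\<^esub> y = x \<ominus>\<^bsub>VE\<^esub> y"
  by (rule a_minus_same_group; simp add: CV_simps)

lemma CV_module: "Module.module CC CV"
proof (rule Module.moduleI)
  show "abelian_group CV"
    by (rule abelian_groupI) (auto simp: CV_simps ind.VE.a_ac intro: bexI[of _ "\<ominus>\<^bsub>VE\<^esub> x" for x] ind.VE.l_neg)
qed (auto simp: cring_type_ring CV_simps ind.ks_add ind.ks_mult ind.ks_one amap_add[OF ind.amap_ks]
    simp flip: fls_plus_const fls_const_mult_const)

lemma gsum_single:
  assumes "x \<in> carrier VE" shows "gsum VE (\<lambda>i. if i = 0 then x else \<zero>\<^bsub>VE\<^esub>) = x"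
proof -
  have "gsum VE (\<lambda>i. if i = 0 then x else \<zero>\<^bsub>VE\<^esub>) = gfinprod (add_monoid VE) (\<lambda>i. if i = 0 then x else \<zero>\<^bsub>VE\<^esub>) {0::nat}"
    unfolding gsum_def
    by (rule ind.VE.add.gfinprod_mono_neutral_cong_left[symmetric]) (use assms in auto)
  also have "\<dots> = x"
    using assms ind.VE.add.gfinprod_eq_finprod[of "{0::nat}" "\<lambda>i. if i = 0 then x else \<zero>\<^bsub>VE\<^esub>"]
      ind.VE.add.finprod_singleton_swap[of 0 "{0}" "\<lambda>_. x"]
    by simp
  finally show ?thesis .
qed

text \<open>Induction along generation in the left argument: vacuum and sums by the axioms,
  C((z))-multiples by \<open>shift_compat\<close> with g = 1, and a mode w_l x as u_l x for the
  state u of w, where the Jacobi identity at m = 0 applies.\<close>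

lemma structure_unique:
  assumes 1: "vertex_laurent_algebra VM Y vac" and 2: "vertex_laurent_algebra VM Y' vac"
    and mode: "\<And>w n v. w \<in> carrier DG \<Longrightarrow> v \<in> carrier VE \<Longrightarrow> Y (mode w (-1) vac) n v = mode w n v"
    and mode': "\<And>w n v. w \<in> carrier DG \<Longrightarrow> v \<in> carrier VE \<Longrightarrow> Y' (mode w (-1) vac) n v = mode w n v"
    and u: "u \<in> carrier VE"
  shows "\<forall>n. \<forall>v\<in>carrier VE. Y' u n v = Y u n v"
proof -
  interpret Y: vertex_laurent_algebra VM Y vac by (rule 1)
  interpret Y': vertex_laurent_algebra VM Y' vac by (rule 2)
  \<comment> \<open>For m = 0 the binomials leave only i = 0 on the right-hand side of the Jacobi
    identity, namely the field of a_l u.\<close>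
  have jac0: "gsum VE (\<lambda>i. (ind.ks (fls_const (of_int 0 gchoose i)) (Z (Z a (l + int i) u) (0 + n - int i) v)))
      = Z (Z a l u) n v"
    if "vertex_laurent_algebra VM Z vac" "a \<in> carrier VE" "u \<in> carrier VE" "v \<in> carrier VE" for Z a l u n v
  proof -
    interpret Z: vertex_laurent_algebra VM Z vac by (rule that(1))
    have c: "Z (Z a l u) n v \<in> carrier VE" for l n
      using Z.Y_closed[of "Z a l u" v n] Z.Y_closed[of a u l] that by (simp add: CV_simps)
    have "(\<lambda>i. (ind.ks (fls_const (of_int 0 gchoose i)) (Z (Z a (l + int i) u) (0 + n - int i) v)))
       = (\<lambda>i. if i = 0 then Z (Z a l u) n v else \<zero>\<^bsub>VE\<^esub>)"
    proof
      fix i show "ind.ks (fls_const (of_int 0 gchoose i)) (Z (Z a (l + int i) u) (0 + n - int i) v)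
        = (if i = 0 then Z (Z a l u) n v else \<zero>\<^bsub>VE\<^esub>)"
        using c by (cases i) (simp_all add: ind.ks_one)
    qed
    then show ?thesis using gsum_single[OF c] by simp
  qed
  from u show ?thesis
  proof (induction rule: VE_generated_mode)
    case vac
    then show ?case using Y.vacuum Y'.vacuum by (simp add: CV_simps)
  next
    case (add x y)
    then show ?case using Y.Y_add_left[of x y] Y'.Y_add_left[of x y] by (simp add: CV_simps)
  next
    case (ks c x)
    show ?case
    proof (intro allI ballI)
      fix n v assume v: "v \<in> carrier VE"
      have "Y' (ind.ks c x) n (ind.ks 1 v) = Y (ind.ks c x) n (ind.ks 1 v)"
        using Y.shift_compat[of x v c n 1] Y'.shift_compat[of x v c n 1] ks v by (simp add: VM_simps)
      then show "Y' (ind.ks c x) n v = Y (ind.ks c x) n v" using v by (simp add: ind.ks_one)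
    qed
  next
    case (mode w l x)
    show ?case
    proof (intro allI ballI)
      fix n v assume v: "v \<in> carrier VE"
      let ?a = "mode w (-1) vac"
      have a: "?a \<in> carrier VE" using mode(1) by simp
      have cl: "Y x k v \<in> carrier VE" for k using Y.Y_closed[of x v k] mode(2) v by (simp add: CV_simps)
      have m: "mode w k v \<in> carrier VE" for k using mode(1) v by simp
      have Yx: "Y' x k z = Y x k z" if "z \<in> carrier VE" for k z using mode(3) that by blast
      let ?L = "\<lambda>Z i. ind.ks (fls_const ((-1) ^ i * (of_int l gchoose i)))
          (Z ?a (0 + l - int i) (Z x (n + int i) v)
            \<ominus>\<^bsub>VE\<^esub> ind.ks (fls_const ((-1) powi l)) (Z x (n + l - int i) (Z ?a (0 + int i) v)))"
      have "gsum VE (?L Y) = Y (Y ?a l x) n v"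
        by (rule trans[OF Y.jacobi[unfolded CV_simps gsum_CV minus_CV, OF a mode(2) v] jac0[OF 1 a mode(2) v]])
      moreover have "gsum VE (?L Y') = Y' (Y' ?a l x) n v"
        by (rule trans[OF Y'.jacobi[unfolded CV_simps gsum_CV minus_CV, OF a mode(2) v] jac0[OF 2 a mode(2) v]])
      \<comment> \<open>The left-hand sides contain only the field of w, prescribed for both
        structures, and the field of \<open>x\<close>, equal by induction.\<close>
      moreover have "?L Y = ?L Y'"
        using mode(1) v by (simp only: fun_eq_iff Yx cl m assms(3,4)) simp
      ultimately have "Y (Y ?a l x) n v = Y' (Y' ?a l x) n v" by simp
      then show "Y' (mode w l x) n v = Y (mode w l x) n v"
        using mode(1,2) by (simp add: assms(3,4))
    qed
  qed
qed

end

section \<open>Existence of the structure and the final statement\<close>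

context vacuum_retract
begin

lemma vertex_structure: "vertex_laurent_algebra VM vertex_op vac"
proof -
  have shift: "vertex_op (ind.ks f u) n (ind.ks g v) = gsum VE (\<lambda>j. ind.ks (shift_coeff f (int j) * g) (vertex_op u (n + int j) v))"
    if "u \<in> carrier VE" "v \<in> carrier VE" for f g u n v
    unfolding vertex_op_ks_left[OF that(1) ind.ks_closed[OF that(2)]] by (simp only: vertex_op_ks_right[OF that] ind.ks_mult[OF vertex_op_closed])
  \<comment> \<open>C-linearity in the left argument is the case of a constant f, where f(z + x) = f
    has only the term j = 0.\<close>
  have const: "vertex_op (ind.ks (fls_const c) u) n v = ind.ks (fls_const c) (vertex_op u n v)"
    if "u \<in> carrier VE" "v \<in> carrier VE" for c u n v
  proof -
    have "shift_coeff (fls_const c) (int j) = (if j = 0 then fls_const c else 0)" for j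
    proof (cases j)
      case (Suc k)
      have "(fls_deriv ^^ k) (0 :: complex fls) = 0" by (induction k) auto
      then have "(fls_deriv ^^ Suc k) (fls_const c) = 0" by (simp only: funpow_Suc_right comp_apply fls_deriv_const)
      then show ?thesis using Suc by (simp add: shift_coeff_def del: funpow.simps of_nat_Suc)
    qed simp
    then have "(\<lambda>j. ind.ks (shift_coeff (fls_const c) (int j)) (vertex_op u (n + int j) v))
       = (\<lambda>j. if j = 0 then ind.ks (fls_const c) (vertex_op u n v) else \<zero>\<^bsub>VE\<^esub>)"
      by (auto simp: fun_eq_iff)
    then show ?thesis using that by (simp add: vertex_op_ks_left gsum_single)
  qed
  show ?thesis
  proof (intro vertex_laurent_algebra.intro vertex_algebra.intro vertex_algebra_axioms.intro
      vertex_laurent_algebra_axioms.intro)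
    show "Module.module KK VM" by (rule VM_module)
    show "Module.module CC CV" by (rule CV_module)
    show "gsum CV (\<lambda>i. ((-1) ^ i * (of_int l gchoose i)) \<odot>\<^bsub>CV\<^esub>
            (vertex_op u (m + l - int i) (vertex_op v (n + int i) w)
              \<ominus>\<^bsub>CV\<^esub> ((-1) powi l) \<odot>\<^bsub>CV\<^esub> vertex_op v (n + l - int i) (vertex_op u (m + int i) w)))
        = gsum CV (\<lambda>i. (of_int m gchoose i) \<odot>\<^bsub>CV\<^esub> vertex_op (vertex_op u (l + int i) v) (m + n - int i) w)"
      if "u \<in> carrier CV" "v \<in> carrier CV" "w \<in> carrier CV" for u v w l m n
      using vertex_op_jacobi[of u v w l m n] that by (simp only: CV_simps gsum_CV minus_CV)
    show "vertex_op (f \<odot>\<^bsub>VM\<^esub> u) n (g \<odot>\<^bsub>VM\<^esub> v)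
      = gsum VM (\<lambda>j. (shift_coeff f (int j) * g) \<odot>\<^bsub>VM\<^esub> vertex_op u (n + int j) v)"
      if "u \<in> carrier VM" "v \<in> carrier VM" for f g u n v
      using that shift[of u v f n g] by (simp add: VM_simps gsum_VM)
  qed (use vertex_op_trunc in \<open>auto simp: CV_simps vertex_op_add_left vertex_op_add_right const vertex_op_ks_right vertex_op_vac vertex_op_creation\<close>)
qed

end

text \<open>A retract exists for every module over C((z)); here it is chosen, and it no longer
  appears in the statement.\<close>

lemma (in vacuum_mod) structure_exists:
  "\<exists>Y. vertex_laurent_algebra VM Y vac \<and> (\<forall>w\<in>carrier DG. \<forall>n. \<forall>v\<in>carrier VE. Y (mode w (-1) vac) n v = mode w n v)"
proof (rule module_retract[OF VM_module])
  fix \<Theta> :: "('g vac \<Rightarrow>\<^sub>0 complex fls) \<Rightarrow> 'g vac" and \<sigma>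
  assume *: "\<And>x. \<Theta> x \<in> carrier VM" "\<And>x y. \<Theta> (x + y) = \<Theta> x \<oplus>\<^bsub>VM\<^esub> \<Theta> y"
    "\<And>c x. \<Theta> (pscale c x) = c \<odot>\<^bsub>VM\<^esub> \<Theta> x" "\<And>v. v \<in> carrier VM \<Longrightarrow> \<Theta> (\<sigma> v) = v"
    "\<And>v w. v \<in> carrier VM \<Longrightarrow> w \<in> carrier VM \<Longrightarrow> \<sigma> (v \<oplus>\<^bsub>VM\<^esub> w) = \<sigma> v + \<sigma> w"
    "\<And>c v. v \<in> carrier VM \<Longrightarrow> \<sigma> (c \<odot>\<^bsub>VM\<^esub> v) = pscale c (\<sigma> v)"
  interpret R: vacuum_retract G B p lv \<Theta> \<sigma>
    by (intro vacuum_retract.intro vacuum_retract_axioms.intro vacuum_mod_axioms)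
       (use * in \<open>simp_all add: VM_simps\<close>)
  show ?thesis using R.vertex_structure R.vertex_op_mode by blast
qed

theorem theorem3p15:
  fixes G :: "(complex, 'g) lie_alg" and B :: "'g \<Rightarrow> 'g \<Rightarrow> complex"
    and p :: "complex poly" and lv :: complex
  assumes "lie_algebra_with_form CC G B"
  shows "let V = vacuum_module G B p lv; vac = vacuum_vector G B p lv; act = vacuum_op G B p lv;
             S = (\<lambda>Y. vertex_laurent_algebra V Y vac \<and>
               (\<forall>w \<in> carrier (double G). \<forall>n. \<forall>v \<in> carrier V. Y (act w (-1) vac) n v = act w n v))
         in \<exists>Y. S Y \<and>
              (\<forall>Y'. S Y' \<longrightarrow> (\<forall>u \<in> carrier V. \<forall>n. \<forall>v \<in> carrier V. Y' u n v = Y u n v))"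
proof -
  interpret vacuum_mod G B p lv
    by (intro vacuum_mod.intro loop_algebra.intro assms)
  obtain Y where Y: "vertex_laurent_algebra VM Y vac"
    "\<And>w n v. w \<in> carrier DG \<Longrightarrow> v \<in> carrier VE \<Longrightarrow> Y (mode w (-1) vac) n v = mode w n v"
    using structure_exists by blast
  have "\<forall>n. \<forall>v\<in>carrier VE. Y' u n v = Y u n v"
    if "vertex_laurent_algebra VM Y' vac" "\<forall>w\<in>carrier DG. \<forall>n. \<forall>v\<in>carrier VE. Y' (mode w (-1) vac) n v = mode w n v"
      "u \<in> carrier VE" for Y' u
    using structure_unique[OF Y(1) that(1) Y(2) _ that(3)] that(2) by blast
  then show ?thesis
    unfolding Let_def vac_eq vacuum_op_eq VM_simps
    using Y by (intro exI[of _ Y]) blast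
qed

end
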